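(* (Toggling property.) Let $n$ be a positive integer, let $y\in\tilde I_n$ and $\pi\in\mathcal{A}(y)$, and let $i<j\not\equiv i\pmod n$ be integers such that $\pi\lessdot\pi t_{ij}$ and $y=\tau^n_{ij}(y)$. Under these hypotheses one of the cases (A1)–(A3), (B1)–(B3), (C1), (C2) listed in the context occurs; relative to these cases, define $$k=\begin{cases} j&\text{in cases (A1)–(A3)}\\ y(j)&\text{in cases (B1)–(B3), (C1), (C2)},\end{cases}\qquad l=\begin{cases} y(i)&\text{in cases (A1)–(A3), (C1), (C2)}\\ i&\text{in cases (B1)–(B3)}.\end{cases}$$ Then $k<l\not\equiv k\pmod n$, $\pi\ne\pi t_{ij}t_{kl}\in\mathcal{A}(y)$, and $y=\tau^n_{kl}(y)$.
   Context: **Affine permutations.** $\tilde S_n$ is the group (under composition) of bijections $\pi:\mathbb{Z}\to\mathbb{Z}$ with $\pi(i+n)=\pi(i)+n$ for all $i\in\mathbb{Z}$ and $\pi(1)+\dots+\pi(n)=1+\dots+n$. For $i\in\mathbb{Z}$, $s_i\in\tilde S_n$ interchanges $i$ and $i+1$ and fixes every integer not in $\{i,i+1\}+n\mathbb{Z}$; $s_1,\dots,s_n$ generate $\tilde S_n$, and $\ell(\pi)$ is the minimal length of a factorization of $\pi$ into these generators. For $i<j\not\equiv i\pmod n$, $t_{ij}\in\tilde S_n$ interchanges $i$ and $j$ and fixes every integer not in $\{i,j\}+n\mathbb{Z}$. Write $\tilde I_n=\{z\in\tilde S_n:z=z^{-1}\}$. Write $\pi\lessdot\sigma$ if $\ell(\sigma)=\ell(\pi)+1$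 and $\sigma=\pi t_{ij}$ for some $i<j\not\equiv i\pmod n$. **Atoms.** $\circ$ is the unique associative product on $\tilde S_n$ with $s_i\circ s_i=s_i$ and $\pi'\circ\pi''=\pi'\pi''$ whenever $\ell(\pi'\pi'')=\ell(\pi')+\ell(\pi'')$. For $z\in\tilde I_n$, $\mathcal{A}(z)$ is the (finite, nonempty) set of minimal-length elements of $\{\pi\in\tilde S_n:\pi^{-1}\circ\pi=z\}$. **The operators $\tau^n_{ij}$.** Let $y\in\tilde I_n$ and $i<j\not\equiv i\pmod n$. Let $\overline y\in\tilde I_n$ fix every integer in $\{i,j,y(i),y(j)\}+n\mathbb{Z}$ and act as $k\mapsto y(k)$ on all other integers. Then $\tau^n_{ij}(y)\in\tilde I_n$ is defined to be: - $t_{ij}\,y\,t_{ij}$ if $y(i)<i<j<y(j)$, or $i<j<y(i)<y(j)$, or $y(i)<y(j)<i<j$; - $t_{i,y(j)}\,y\,t_{i,y(j)}$ if $i<y(j)<y(i)<j$ and $i\not\equiv y(j)\pmod n$; - $t_{ij}\,\overline y$ if $i<y(j)<y(i)<j$ and $i\equiv y(j)\pmod n$; - $t_{ij}\,\overline y$ if $i=y(i)<j=y(j)$, or $i=y(i)<y(j)<j$, or $i<y(i)<j=y(j)$, or $i<y(i)<y(j)<j$; - $t_{i,y(j)}\,\overline y$ if $i=y(i)<j<y(j)$ or $i<y(i)<j<y(j)$; - $t_{y(i),j}\,\overline y$ if $y(i)<i<j=y(j)$ or $y(i)<i<y(j)<j$; - $y$ in all other cases. **The cases** (for $y,\pi,i,j$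 as in the claim; the paper shows separately that one of them always occurs): - (A1) $i<j=y(j)<y(i)$ and $\pi(y(i))<\pi(i)<\pi(j)$. - (A2) $i<j<y(j)<y(i)$ and $\pi(y(j))<\pi(y(i))<\pi(i)<\pi(j)$. - (A3) $i<y(j)<j<y(i)$ and $\pi(y(i))<\pi(i)<\pi(j)<\pi(y(j))$. - (B1) $y(j)<i=y(i)<j$ and $\pi(i)<\pi(j)<\pi(y(j))$. - (B2) $y(j)<i<y(i)<j$ and $\pi(y(i))<\pi(i)<\pi(j)<\pi(y(j))$. - (B3) $y(j)<y(i)<i<j$ and $\pi(i)<\pi(j)<\pi(y(j))<\pi(y(i))$. - (C1) $i<j<y(j)<y(i)$ and $\pi(y(i))<\pi(i)<\pi(y(j))<\pi(j)$. - (C2) $y(j)<y(i)<i<j$ and $\pi(i)<\pi(y(i))<\pi(j)<\pi(y(j))$. *)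

theory Defs
  imports "HOL-Number_Theory.Cong" "HOL-Library.FuncSet"
begin

definition aff_perms :: "nat \<Rightarrow> (int \<Rightarrow> int) set" where
  "aff_perms n = {\<pi>. bij \<pi> \<and> (\<forall>i. \<pi> (i + int n) = \<pi> i + int n) \<and>
     (\<Sum>i = 1..int n. \<pi> i) = (\<Sum>i = 1..int n. i)}"

definition aff_invols :: "nat \<Rightarrow> (int \<Rightarrow> int) set" where
  "aff_invols n = {z \<in> aff_perms n. z = inv z}"

text \<open>The reflection \<open>t\<^sub>i\<^sub>j\<close> is only meaningful when \<open>i\<close> and \<open>j\<close> are incongruent; the identity is the
  value in the degenerate case. For \<open>n = 1\<close> this makes every \<open>s\<^sub>i\<close> the identity, as it has to be
  in a trivial group.\<close>

definition aff_trans :: "nat \<Rightarrow> int \<Rightarrow> int \<Rightarrow> int \<Rightarrow> int" where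
  "aff_trans n i j k =
     (if [i = j] (mod int n) then k
      else if [k = i] (mod int n) then k + (j - i)
      else if [k = j] (mod int n) then k + (i - j)
      else k)"

definition aff_simple :: "nat \<Rightarrow> int \<Rightarrow> int \<Rightarrow> int" where
  "aff_simple n i = aff_trans n i (i + 1)"

definition aff_word :: "nat \<Rightarrow> int list \<Rightarrow> int \<Rightarrow> int" where
  "aff_word n is = foldr (\<lambda>i \<sigma>. aff_simple n i \<circ> \<sigma>) is id"

definition aff_length :: "nat \<Rightarrow> (int \<Rightarrow> int) \<Rightarrow> nat" where
  "aff_length n \<pi> =
     (LEAST m. \<exists>is. length is = m \<and> set is \<subseteq> {1..int n} \<and> aff_word n is = \<pi>)"

definition aff_covers :: "nat \<Rightarrow> (int \<Rightarrow> int) \<Rightarrow> (int \<Rightarrow> int) \<Rightarrow> bool" where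
  "aff_covers n \<pi> \<sigma> \<longleftrightarrow> aff_length n \<sigma> = aff_length n \<pi> + 1 \<and>
     (\<exists>i j. i < j \<and> \<not> [j = i] (mod int n) \<and> \<sigma> = \<pi> \<circ> aff_trans n i j)"

text \<open>The Demazure (0-Hecke) product. The extensional function space fixes the value outside
  \<open>aff_perms n\<close>, where the defining properties say nothing, so that the product is unique as a
  HOL function.\<close>

definition is_demazure :: "nat \<Rightarrow> ((int \<Rightarrow> int) \<Rightarrow> (int \<Rightarrow> int) \<Rightarrow> (int \<Rightarrow> int)) \<Rightarrow> bool" where
  "is_demazure n f \<longleftrightarrow>
     f \<in> aff_perms n \<rightarrow>\<^sub>E (aff_perms n \<rightarrow>\<^sub>E aff_perms n) \<and>
     (\<forall>\<pi>\<in>aff_perms n. \<forall>\<sigma>\<in>aff_perms n. \<forall>\<rho>\<in>aff_perms n. f (f \<pi> \<sigma>) \<rho> = f \<pi> (f \<sigma> \<rho>)) \<and>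
     (\<forall>i. f (aff_simple n i) (aff_simple n i) = aff_simple n i) \<and>
     (\<forall>\<pi>\<in>aff_perms n. \<forall>\<sigma>\<in>aff_perms n.
        aff_length n (\<pi> \<circ> \<sigma>) = aff_length n \<pi> + aff_length n \<sigma> \<longrightarrow> f \<pi> \<sigma> = \<pi> \<circ> \<sigma>)"

definition demazure :: "nat \<Rightarrow> (int \<Rightarrow> int) \<Rightarrow> (int \<Rightarrow> int) \<Rightarrow> (int \<Rightarrow> int)" where
  "demazure n = (THE f. is_demazure n f)"

definition atoms :: "nat \<Rightarrow> (int \<Rightarrow> int) \<Rightarrow> (int \<Rightarrow> int) set" where
  "atoms n z =
     {\<pi>. is_arg_min (aff_length n) (\<lambda>\<sigma>. \<sigma> \<in> aff_perms n \<and> demazure n (inv \<sigma>) \<sigma> = z) \<pi>}"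

definition aff_bar :: "nat \<Rightarrow> int \<Rightarrow> int \<Rightarrow> (int \<Rightarrow> int) \<Rightarrow> int \<Rightarrow> int" where
  "aff_bar n i j y k =
     (if \<exists>a\<in>{i, j, y i, y j}. [k = a] (mod int n) then k else y k)"

text \<open>The conditions are pairwise exclusive, so the order of the branches is immaterial.\<close>

definition tau :: "nat \<Rightarrow> int \<Rightarrow> int \<Rightarrow> (int \<Rightarrow> int) \<Rightarrow> int \<Rightarrow> int" where
  "tau n i j y =
     (if (y i < i \<and> i < j \<and> j < y j) \<or> (i < j \<and> j < y i \<and> y i < y j) \<or>
         (y i < y j \<and> y j < i \<and> i < j)
      then aff_trans n i j \<circ> y \<circ> aff_trans n i j
      else if i < y j \<and> y j < y i \<and> y i < j \<and> \<not> [i = y j] (mod int n)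
      then aff_trans n i (y j) \<circ> y \<circ> aff_trans n i (y j)
      else if i < y j \<and> y j < y i \<and> y i < j \<and> [i = y j] (mod int n)
      then aff_trans n i j \<circ> aff_bar n i j y
      else if (i = y i \<and> y i < j \<and> j = y j) \<or> (i = y i \<and> y i < y j \<and> y j < j) \<or>
         (i < y i \<and> y i < j \<and> j = y j) \<or> (i < y i \<and> y i < y j \<and> y j < j)
      then aff_trans n i j \<circ> aff_bar n i j y
      else if (i = y i \<and> y i < j \<and> j < y j) \<or> (i < y i \<and> y i < j \<and> j < y j)
      then aff_trans n i (y j) \<circ> aff_bar n i j y
      else if (y i < i \<and> i < j \<and> j = y j) \<or> (y i < i \<and> i < y j \<and> y j < j)
      then aff_trans n (y i) j \<circ> aff_bar n i j y
      else y)"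

text \<open>The disjuncts of \<open>case_A\<close> are the cases (A1), (A2), (A3) in this order, and likewise for
  (B1), (B2), (B3) and (C1), (C2) below.\<close>

definition case_A :: "(int \<Rightarrow> int) \<Rightarrow> (int \<Rightarrow> int) \<Rightarrow> int \<Rightarrow> int \<Rightarrow> bool" where
  "case_A y \<pi> i j \<longleftrightarrow>
     (i < j \<and> j = y j \<and> y j < y i \<and> \<pi> (y i) < \<pi> i \<and> \<pi> i < \<pi> j) \<or>
     (i < j \<and> j < y j \<and> y j < y i \<and> \<pi> (y j) < \<pi> (y i) \<and> \<pi> (y i) < \<pi> i \<and> \<pi> i < \<pi> j) \<or>
     (i < y j \<and> y j < j \<and> j < y i \<and> \<pi> (y i) < \<pi> i \<and> \<pi> i < \<pi> j \<and> \<pi> j < \<pi> (y j))"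

definition case_B :: "(int \<Rightarrow> int) \<Rightarrow> (int \<Rightarrow> int) \<Rightarrow> int \<Rightarrow> int \<Rightarrow> bool" where
  "case_B y \<pi> i j \<longleftrightarrow>
     (y j < i \<and> i = y i \<and> y i < j \<and> \<pi> i < \<pi> j \<and> \<pi> j < \<pi> (y j)) \<or>
     (y j < i \<and> i < y i \<and> y i < j \<and> \<pi> (y i) < \<pi> i \<and> \<pi> i < \<pi> j \<and> \<pi> j < \<pi> (y j)) \<or>
     (y j < y i \<and> y i < i \<and> i < j \<and> \<pi> i < \<pi> j \<and> \<pi> j < \<pi> (y j) \<and> \<pi> (y j) < \<pi> (y i))"

definition case_C :: "(int \<Rightarrow> int) \<Rightarrow> (int \<Rightarrow> int) \<Rightarrow> int \<Rightarrow> int \<Rightarrow> bool" where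
  "case_C y \<pi> i j \<longleftrightarrow>
     (i < j \<and> j < y j \<and> y j < y i \<and> \<pi> (y i) < \<pi> i \<and> \<pi> i < \<pi> (y j) \<and> \<pi> (y j) < \<pi> j) \<or>
     (y j < y i \<and> y i < i \<and> i < j \<and> \<pi> i < \<pi> (y i) \<and> \<pi> (y i) < \<pi> j \<and> \<pi> j < \<pi> (y j))"

end

theory Submission imports Defs begin

text \<open>The proof rests on a description of the atoms of \<open>y\<close> by conditions on pairs of cycles of \<open>y\<close>: the
  larger element of a 2-cycle takes the smaller value, an element strictly inside a cycle never takes
  a value strictly between its two values, and of two cycles that are not nested the left one takes
  only smaller values than the right one. For an ascent \<open>k\<close> of \<open>y\<close>, this description passes from \<open>\<pi>\<close> and \<open>y\<close>
  to \<open>\<pi> \<circ> s k\<close> and the Demazure conjugate of \<open>y\<close> by \<open>s k\<close>, and back. Each such step raises twice the length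
  of \<open>y\<close> plus the number of residues moved by \<open>y\<close> by 4, so the permutations that fit the description are
  exactly the shortest ones.

  If \<open>tau\<close> fixes \<open>y\<close>, then the cycles of \<open>i\<close> and \<open>j\<close> are nested, and \<open>\<pi>\<close> realizes one of the value patterns
  that an atom can have on such a pair; the toggle moves it to another one. That the result still fits
  with all other cycles, translates included, is a statement about linear orders.\<close>

section \<open>Affine permutations, words and length\<close>

text \<open>The list of cases has a uniform reading. Neither value on the inner of two nested
  2-cycles lies between the two values on the outer one, so the inner values are both above, around,
  or both below the outer ones. (A3) passes from above to around, (A2) from around to below, (C1)
  from above to below; for an inner fixed point, (A1) passes from above to below. The B cases and
  (C2) are the same moves after negating positions and values. The obstacle is the infinite group.
  \<open>demazure\<close> is a definite description and \<open>aff_length\<close> a minimum over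
  words, so existence and uniqueness of the product and every fact about length are derived from
  words, with strong exchange in place of counting inversions. Moreover, a reflection acts on all
  translates of i and j at once, so a toggled cycle has to be compared with toggled translates. The
  covering hypothesis enters through \<pi> i < \<pi> j and an empty rectangle: no point of the graph
  of \<pi> lies strictly between (i, \<pi> i) and (j, \<pi> j).\<close>

locale affine_perms =
  fixes n :: nat
  assumes two_le_n: "2 \<le> n"
begin

abbreviation S :: "(int \<Rightarrow> int) set" where "S \<equiv> aff_perms n"
abbreviation cg :: "int \<Rightarrow> int \<Rightarrow> bool" (infix "\<sim>" 50) where "a \<sim> b \<equiv> [a = b] (mod int n)"
abbreviation t :: "int \<Rightarrow> int \<Rightarrow> int \<Rightarrow> int" where "t \<equiv> aff_trans n"
abbreviation s :: "int \<Rightarrow> int \<Rightarrow> int" where "s \<equiv> aff_simple n"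
abbreviation len :: "(int \<Rightarrow> int) \<Rightarrow> nat" where "len \<equiv> aff_length n"
abbreviation word :: "int list \<Rightarrow> int \<Rightarrow> int" where "word \<equiv> aff_word n"

section \<open>Congruences and periodic functions\<close>

lemma cgE: assumes "a \<sim> b" obtains m where "a = b + m * int n"
  using assms by (metis cong_iff_lin cong_sym mult.commute)

lemma cg_shift [simp]: "a + m * int n \<sim> b \<longleftrightarrow> a \<sim> b" "a \<sim> b + m * int n \<longleftrightarrow> a \<sim> b"
  by (simp_all add: cong_def)

lemma cg_shift1 [simp]: "a + int n \<sim> b \<longleftrightarrow> a \<sim> b" "a \<sim> b + int n \<longleftrightarrow> a \<sim> b"
  by (simp_all add: cong_def)

lemma not_cg_succ: "\<not> a \<sim> a + 1" "\<not> a + 1 \<sim> a"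
proof -
  have "\<not> int n dvd 1" using two_le_n by auto
  then show "\<not> a \<sim> a + 1" "\<not> a + 1 \<sim> a"
    by (auto simp: cong_iff_dvd_diff)
qed

lemma cg_succ_iff [simp]: "a + 1 \<sim> b + 1 \<longleftrightarrow> a \<sim> b"
  by (simp add: cong_add_rcancel)

lemma residue_mem: "(k - 1) mod int n + 1 \<in> {1..int n}" "(k - 1) mod int n + 1 \<sim> k"
proof -
  have "0 \<le> (k - 1) mod int n" "(k - 1) mod int n < int n"
    using two_le_n by auto
  then show "(k - 1) mod int n + 1 \<in> {1..int n}" by auto
  have "(k - 1) mod int n \<sim> k - 1" by (simp add: cong_def)
  then show "(k - 1) mod int n + 1 \<sim> k" by (metis cg_succ_iff diff_add_cancel)
qed

lemma equivariant_shift: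
  assumes "\<And>i. \<pi> (i + int n) = \<pi> i + int n"
  shows "\<pi> (i + m * int n) = \<pi> i + m * int n"
proof -
  have nat: "\<pi> (i + int q * int n) = \<pi> i + int q * int n" for i q
  proof (induction q arbitrary: i)
    case (Suc q)
    then show ?case using assms[of "i + int q * int n"] by (simp add: algebra_simps)
  qed simp
  show ?thesis
  proof (cases "m \<ge> 0")
    case True
    then show ?thesis using nat[of i "nat m"] by simp
  next
    case False
    then show ?thesis using nat[of "i + m * int n" "nat (- m)"] by simp
  qed
qed

lemma periodic_cong:
  assumes "\<And>i. g (i + int n) = (g i :: 'a)" "a \<sim> b"
  shows "g a = g b"
proof -
  have nat: "g (i + int q * int n) = g i" for i q
  proof (induction q arbitrary: i)
    case (Suc q)
    then show ?case using assms(1)[of "i + int q * int n"] by (simp add: algebra_simps)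
  qed simp
  obtain m where m: "a = b + m * int n" using assms(2) by (rule cgE)
  show ?thesis
  proof (cases "m \<ge> 0")
    case True
    then show ?thesis using nat[of b "nat m"] m by simp
  next
    case False
    then show ?thesis using nat[of a "nat (- m)"] m by simp
  qed
qed

text \<open>\<sigma> permutes residue classes: reducing its values into the window 1..n gives a
  bijection of the window, and the periodic \<open>g\<close> does not notice the reduction.\<close>

lemma sum_periodic_reindex:
  fixes g :: "int \<Rightarrow> int"
  assumes "bij \<sigma>" "\<And>i. \<sigma> (i + int n) = \<sigma> i + int n" "\<And>i. g (i + int n) = g i"
  shows "(\<Sum>i = 1..int n. g (\<sigma> i)) = (\<Sum>i = 1..int n. g i)"
proof -
  define h where "h i = (\<sigma> i - 1) mod int n + 1" for i
  have h: "h i \<in> {1..int n}" "h i \<sim> \<sigma> i" for i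
    unfolding h_def using residue_mem by blast+
  have "inj_on h {1..int n}"
  proof (rule inj_onI)
    fix a b assume ab: "a \<in> {1..int n}" "b \<in> {1..int n}" "h a = h b"
    have "\<sigma> a \<sim> \<sigma> b" using h(2) ab(3) by (metis cong_sym cong_trans)
    then obtain m where "\<sigma> a = \<sigma> b + m * int n" by (rule cgE)
    then have "\<sigma> a = \<sigma> (b + m * int n)" using equivariant_shift[of \<sigma>, OF assms(2)] by simp
    then have "a = b + m * int n" using assms(1) by (simp add: bij_def inj_eq)
    then have "a \<sim> b" by simp
    moreover have "\<bar>a - b\<bar> < int n" using ab by auto
    ultimately show "a = b"
      by (metis cong_iff_dvd_diff dvd_imp_le_int eq_iff_diff_eq_0 abs_of_nat linorder_not_le)
  qed
  moreover have "h ` {1..int n} \<subseteq> {1..int n}" using h by blast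
  ultimately have "bij_betw h {1..int n} {1..int n}"
    by (simp add: bij_betw_def endo_inj_surj)
  then have "(\<Sum>i = 1..int n. g (h i)) = (\<Sum>i = 1..int n. g i)"
    by (rule sum.reindex_bij_betw)
  moreover have "g (h i) = g (\<sigma> i)" for i
    using periodic_cong[of g, OF assms(3) h(2)] .
  ultimately show ?thesis by simp
qed

text \<open>The displacement \<pi> i - i is periodic although \<pi> is not. With the normalization
  stated through displacements, sums over a window can be reindexed, which makes the total
  displacement additive under composition (\<open>sum_displacement_comp\<close>).\<close>

lemma mem_S_iff:
  "\<pi> \<in> S \<longleftrightarrow> bij \<pi> \<and> (\<forall>i. \<pi> (i + int n) = \<pi> i + int n) \<and> (\<Sum>i = 1..int n. \<pi> i - i) = 0"
  by (auto simp: aff_perms_def sum_subtractf)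

lemma S_bij: "\<pi> \<in> S \<Longrightarrow> bij \<pi>" and S_inj: "\<pi> \<in> S \<Longrightarrow> inj \<pi>"
  by (auto simp: aff_perms_def bij_def)

lemma S_eq_iff [simp]: "\<pi> \<in> S \<Longrightarrow> \<pi> a = \<pi> b \<longleftrightarrow> a = b"
  using S_inj by (simp add: inj_eq)

lemma S_shift: "\<pi> \<in> S \<Longrightarrow> \<pi> (i + m * int n) = \<pi> i + m * int n"
  by (rule equivariant_shift) (simp add: aff_perms_def)

lemma S_cg_iff [simp]:
  assumes "\<pi> \<in> S"
  shows "\<pi> a \<sim> \<pi> b \<longleftrightarrow> a \<sim> b"
proof
  assume "\<pi> a \<sim> \<pi> b"
  then obtain m where "\<pi> a = \<pi> b + m * int n" by (rule cgE)
  then have "\<pi> a = \<pi> (b + m * int n)" using S_shift[OF assms] by simp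
  then show "a \<sim> b" using assms by simp
next
  assume "a \<sim> b"
  then show "\<pi> a \<sim> \<pi> b" by (elim cgE) (simp add: S_shift[OF assms])
qed

lemma sum_displacement_comp:
  assumes "\<And>i. \<pi> (i + int n) = \<pi> i + int n"
    and "bij \<sigma>" "\<And>i. \<sigma> (i + int n) = \<sigma> i + int n"
  shows "(\<Sum>i = 1..int n. (\<pi> \<circ> \<sigma>) i - i) = (\<Sum>i = 1..int n. \<pi> i - i) + (\<Sum>i = 1..int n. \<sigma> i - i)"
proof -
  have "(\<Sum>i = 1..int n. (\<pi> \<circ> \<sigma>) i - i) = (\<Sum>i = 1..int n. (\<pi> (\<sigma> i) - \<sigma> i) + (\<sigma> i - i))"
    by simp
  also have "\<dots> = (\<Sum>i = 1..int n. \<pi> (\<sigma> i) - \<sigma> i) + (\<Sum>i = 1..int n. \<sigma> i - i)"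
    by (rule sum.distrib)
  also have "(\<Sum>i = 1..int n. \<pi> (\<sigma> i) - \<sigma> i) = (\<Sum>i = 1..int n. \<pi> i - i)"
    using sum_periodic_reindex[of \<sigma> "\<lambda>i. \<pi> i - i"] assms by simp
  finally show ?thesis .
qed

lemma id_S [simp]: "id \<in> S"
  by (simp add: mem_S_iff)

lemma comp_S [simp]: "\<pi> \<in> S \<Longrightarrow> \<sigma> \<in> S \<Longrightarrow> \<pi> \<circ> \<sigma> \<in> S"
  using sum_displacement_comp[of \<pi> \<sigma>] by (simp add: mem_S_iff bij_comp)

lemma inv_S [simp]:
  assumes "\<pi> \<in> S"
  shows "inv \<pi> \<in> S"
proof -
  have b: "bij \<pi>" using assms by (rule S_bij)
  have eq: "inv \<pi> (i + int n) = inv \<pi> i + int n" for i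
  proof -
    have "\<pi> (inv \<pi> i + int n) = i + int n"
      using assms b by (simp add: mem_S_iff bij_is_surj surj_f_inv_f)
    then show ?thesis by (metis b bij_inv_eq_iff)
  qed
  have "(\<Sum>i = 1..int n. (inv \<pi> \<circ> \<pi>) i - i) = (\<Sum>i = 1..int n. inv \<pi> i - i) + (\<Sum>i = 1..int n. \<pi> i - i)"
    using assms eq b by (intro sum_displacement_comp) (auto simp: mem_S_iff)
  then have "(\<Sum>i = 1..int n. inv \<pi> i - i) = 0"
    using assms b by (simp add: mem_S_iff bij_is_inj)
  then show ?thesis using b eq by (simp add: mem_S_iff bij_imp_bij_inv)
qed

lemma S_inv_apply [simp]: "\<pi> \<in> S \<Longrightarrow> inv \<pi> (\<pi> i) = i" "\<pi> \<in> S \<Longrightarrow> \<pi> (inv \<pi> i) = i"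
  using S_bij by (auto simp: bij_is_inj bij_is_surj surj_f_inv_f)

section \<open>Reflections\<close>

lemma trans_involutive [simp]: "t i j (t i j k) = k"
  by (auto simp: aff_trans_def cong_def)
     (metis add_diff_cancel_left' mod_add_left_eq mod_diff_right_eq diff_add_cancel add.commute
        add_diff_eq diff_diff_eq2)+

lemma trans_S [simp]: "t i j \<in> S"
proof -
  have b: "bij (t i j)" by (rule o_bij[of "t i j"]) (auto simp: fun_eq_iff)
  have eq: "t i j (k + int n) = t i j k + int n" for k
    by (simp add: aff_trans_def)
  \<comment> \<open>\<open>t i j\<close> is an involution, so twice its total displacement is that
    of the identity, namely 0.\<close>
  have "(\<Sum>k = 1..int n. (t i j \<circ> t i j) k - k) = (\<Sum>k = 1..int n. t i j k - k) + (\<Sum>k = 1..int n. t i j k - k)"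
    using eq b by (intro sum_displacement_comp)
  then show ?thesis using b eq by (simp add: mem_S_iff)
qed

lemma trans_left: "\<not> i \<sim> j \<Longrightarrow> t i j i = j"
  and trans_right: "\<not> i \<sim> j \<Longrightarrow> t i j j = i"
  and trans_other: "\<not> k \<sim> i \<Longrightarrow> \<not> k \<sim> j \<Longrightarrow> t i j k = k"
  by (auto simp: aff_trans_def cong_sym_eq)

end

lemma word_Nil [simp]: "aff_word n [] = id"
  and word_Cons [simp]: "aff_word n (k # w) = aff_simple n k \<circ> aff_word n w"
  by (simp_all add: aff_word_def)

context affine_perms begin

lemma trans_conj:
  assumes "\<pi> \<in> S"
  shows "\<pi> \<circ> t i j = t (\<pi> i) (\<pi> j) \<circ> \<pi>"
proof
  fix k
  consider "i \<sim> j" | "\<not> i \<sim> j" "k \<sim> i" | "\<not> i \<sim> j" "k \<sim> j" | "\<not> i \<sim> j" "\<not> k \<sim> i" "\<not> k \<sim> j"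
    by blast
  then show "(\<pi> \<circ> t i j) k = (t (\<pi> i) (\<pi> j) \<circ> \<pi>) k"
  proof cases
    case 1
    then show ?thesis using assms by (simp add: aff_trans_def)
  next
    case 2
    then obtain m where m: "k = i + m * int n" by (elim cgE)
    then show ?thesis using 2 assms S_shift[OF assms, of _ m]
      by (simp add: aff_trans_def) (metis add.commute)
  next
    case 3
    then obtain m where m: "k = j + m * int n" by (elim cgE)
    have "\<not> j \<sim> i" using 3 by (simp add: cong_sym_eq)
    then show ?thesis using 3 m assms S_shift[OF assms, of _ m]
      by (simp add: aff_trans_def) (metis add.commute)
  next
    case 4
    then show ?thesis using assms by (simp add: aff_trans_def)
  qed
qed

lemma trans_cong:
  assumes "i' = i + m * int n" "j' = j + m * int n"
  shows "t i' j' = t i j"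
  using assms by (auto simp: aff_trans_def fun_eq_iff cong_sym_eq cong_add_rcancel)

section \<open>Simple reflections and words\<close>

lemma simple_S [simp]: "s k \<in> S"
  by (simp add: aff_simple_def)

lemma simple_involutive [simp]: "s k (s k x) = x" "s k \<circ> s k = id"
  by (auto simp: aff_simple_def fun_eq_iff)

lemma simple_comp_assoc [simp]: "s k \<circ> (s k \<circ> f) = f"
  by (auto simp: fun_eq_iff)

lemma simple_eq_iff [simp]: "s k x = s k y \<longleftrightarrow> x = y"
  using S_eq_iff simple_S by blast

lemma simple_cong: "k \<sim> k' \<Longrightarrow> s k = s k'"
  unfolding aff_simple_def by (elim cgE) (rule trans_cong, auto)

lemma simple_left: "x \<sim> k \<Longrightarrow> s k x = x + 1"
  using not_cg_succ by (simp add: aff_simple_def aff_trans_def)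

lemma simple_right: "x \<sim> k \<Longrightarrow> s k (x + 1) = x"
  using simple_involutive(1)[of k x] by (simp add: simple_left)

lemma simple_other: "\<not> x \<sim> k \<Longrightarrow> \<not> x \<sim> k + 1 \<Longrightarrow> s k x = x"
  by (simp add: aff_simple_def trans_other)

lemma simple_cases:
  obtains "x \<sim> k" "s k x = x + 1" | "x - 1 \<sim> k" "s k x = x - 1"
    | "\<not> x \<sim> k" "\<not> x - 1 \<sim> k" "s k x = x"
proof -
  have "x \<sim> k + 1 \<longleftrightarrow> x - 1 \<sim> k" using cg_succ_iff[of "x - 1" k] by simp
  then show thesis using that simple_left[of x k] simple_right[of "x - 1" k] simple_other[of x k] by auto
qed

lemma simple_less:
  assumes "x < y"
  shows "s k x < s k y \<or> x \<sim> k \<and> y = x + 1"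
proof -
  have "s k x \<noteq> s k y" using assms by simp
  show ?thesis
  proof (cases "x \<sim> k \<and> y = x + 1")
    case False
    \<comment> \<open>Two elements moving towards each other from distance 2 would meet; but then x
      and x + 1 would be congruent.\<close>
    have "y \<noteq> x + 2" if xy: "x \<sim> k" "y - 1 \<sim> k"
    proof
      assume "y = x + 2"
      then have "x + 1 \<sim> k" using xy by (simp add: add.commute)
      then have "x + 1 \<sim> x" using xy by (simp add: cong_def)
      then show False using not_cg_succ by blast
    qed
    then show ?thesis
      using False assms \<open>s k x \<noteq> s k y\<close> by (rule_tac x = x and k = k in simple_cases; rule_tac x = y and k = k in simple_cases) auto
  qed simp
qed

lemma inv_simple [simp]: "inv (s k) = s k"
  by (rule inv_unique_comp) auto

lemma S_inv_comp [simp]: "\<pi> \<in> S \<Longrightarrow> \<sigma> \<in> S \<Longrightarrow> inv (\<pi> \<circ> \<sigma>) = inv \<sigma> \<circ> inv \<pi>"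
  by (simp add: S_bij o_inv_distrib)

lemma S_inv_inv [simp]: "\<pi> \<in> S \<Longrightarrow> inv (inv \<pi>) = \<pi>"
  by (simp add: S_bij inv_inv_eq)

lemma word_append [simp]: "word (v @ w) = word v \<circ> word w"
  by (induction v) (auto simp: comp_assoc)

lemma word_S [simp]: "word w \<in> S"
proof (induction w)
  case Nil
  show "word [] \<in> S" by simp
next
  case (Cons k w)
  then show "word (k # w) \<in> S" by (simp only: word_Cons comp_S simple_S)
qed

lemma inv_word: "inv (word w) = word (rev w)"
proof (induction w)
  case Nil
  show "inv (word []) = word (rev [])" by simp
next
  case (Cons k w)
  have "inv (word (k # w)) = inv (word w) \<circ> s k" by simp
  also have "\<dots> = word (rev (k # w))" by (simp only: Cons.IH) simp
  finally show "inv (word (k # w)) = word (rev (k # w))" .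
qed

lemma word_normalize: "\<exists>v. length v = length w \<and> set v \<subseteq> {1..int n} \<and> word v = word w"
proof (induction w)
  case (Cons k w)
  then obtain v where v: "length v = length w" "set v \<subseteq> {1..int n}" "word v = word w" by blast
  show ?case
    using v residue_mem[of k] simple_cong[OF residue_mem(2)[of k]]
    by (intro exI[of _ "((k - 1) mod int n + 1) # v"]) auto
next
  case Nil
  show "\<exists>v. length v = length [] \<and> set v \<subseteq> {1..int n} \<and> word v = word []"
    by (intro exI[of _ "[]"]) auto
qed

lemma len_word_le: "len (word w) \<le> length w"
proof -
  obtain v where "length v = length w" "set v \<subseteq> {1..int n}" "word v = word w"
    using word_normalize by blast
  then show ?thesis unfolding aff_length_def by (intro Least_le) blast
qed

text \<open>Without a descent each of the n steps of a period rises by at least 1, and together they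
  rise by n, so each rises by exactly 1. What remains is a translation, and the normalization of the
  sum makes it trivial.\<close>

lemma no_descent_id:
  assumes "\<pi> \<in> S" "\<And>k. \<pi> k < \<pi> (k + 1)"
  shows "\<pi> = id"
proof -
  have ge: "\<pi> k + int m \<le> \<pi> (k + int m)" for k m
  proof (induction m)
    case (Suc m)
    then show ?case using assms(2)[of "k + int m"] by (simp add: algebra_simps)
  qed simp
  have step: "\<pi> (k + 1) = \<pi> k + 1" for k
  proof -
    have "\<pi> (k + 1) + int (n - 1) \<le> \<pi> (k + 1 + int (n - 1))" by (rule ge)
    moreover have "k + 1 + int (n - 1) = k + int n" using two_le_n by simp
    moreover have "\<pi> (k + int n) = \<pi> k + int n" using S_shift[OF assms(1), of k 1] by simp
    ultimately have "\<pi> (k + 1) \<le> \<pi> k + 1" using two_le_n by auto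
    then show ?thesis using assms(2)[of k] by linarith
  qed
  define c where "c = \<pi> 0"
  have "\<pi> k = c + k" for k
  proof (induction k rule: int_induct[where k = 0])
    case (step2 i)
    then show ?case using step[of "i - 1"] by simp
  qed (simp_all add: step c_def)
  moreover from this have "c = 0"
    using assms(1) two_le_n by (simp add: mem_S_iff)
  ultimately show ?thesis by auto
qed

text \<open>Sorting a descent decreases the sum of the squared displacements over a period.\<close>

lemma word_surj: "\<pi> \<in> S \<Longrightarrow> \<exists>w. word w = \<pi>"
proof (induction "nat (\<Sum>i = 1..int n. (\<pi> i - i)\<^sup>2)" arbitrary: \<pi> rule: less_induct)
  case less
  note \<pi> = less.prems
  show ?case
  proof (cases "\<forall>k. \<pi> k < \<pi> (k + 1)")
    case True
    then show ?thesis using no_descent_id[OF \<pi>] word_Nil by metis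
  next
    case False
    then obtain k where "\<not> \<pi> k < \<pi> (k + 1)" by blast
    then have k: "\<pi> (k + 1) < \<pi> k" using \<pi> by (metis S_eq_iff add_cancel_left_right linorder_less_linear zero_neq_one)
    \<comment> \<open>By reindexing along \<open>s k\<close>, the sum of \<open>D\<close> over a
      window is the change of the sum of squares. Pairing i with \<open>s k i\<close> gives 2 (\<pi>
      (k + 1) - \<pi> k) on the moved classes and 0 elsewhere.\<close>
    define D where "D i = (\<pi> i - s k i)\<^sup>2 - (\<pi> i - i)\<^sup>2" for i
    have per: "\<pi> (i + int n) = \<pi> i + int n" "s k (i + int n) = s k i + int n" for i
      using \<pi> simple_S[of k] by (auto simp: mem_S_iff)
    have D_left: "D i + D (s k i) = 2 * (\<pi> (k + 1) - \<pi> k)" if ik: "i \<sim> k" for i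
    proof -
      obtain m where m: "i = k + m * int n" using ik by (rule cgE)
      have "\<pi> i = \<pi> k + m * int n" "\<pi> (i + 1) = \<pi> (k + 1) + m * int n"
        using m S_shift[OF \<pi>, of k m] S_shift[OF \<pi>, of "k + 1" m] by (simp_all add: algebra_simps)
      then have "D i = (\<pi> k - k - 1)\<^sup>2 - (\<pi> k - k)\<^sup>2" "D (i + 1) = (\<pi> (k + 1) - k)\<^sup>2 - (\<pi> (k + 1) - k - 1)\<^sup>2"
        unfolding D_def simple_left[OF ik] simple_right[OF ik] using m by (simp_all add: algebra_simps)
      then show ?thesis
        by (simp add: simple_left[OF ik] power2_eq_square algebra_simps)
    qed
    have D_neg: "D i + D (s k i) = 2 * (\<pi> (k + 1) - \<pi> k)" if "i \<sim> k \<or> i - 1 \<sim> k" for i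
    proof (cases "i \<sim> k")
      case False
      then show ?thesis using D_left[of "i - 1"] that simple_left[of "i - 1" k] simple_right[of "i - 1" k] by simp
    qed (rule D_left)
    have D_zero: "D i + D (s k i) = 0" if "\<not> (i \<sim> k \<or> i - 1 \<sim> k)" for i
      using that by (rule_tac x = i and k = k in simple_cases) (auto simp: D_def)
    have "(\<Sum>i = 1..int n. D i + D (s k i)) < (\<Sum>i = 1..int n. 0)"
    proof (rule sum_strict_mono_ex1)
      show "\<forall>i\<in>{1..int n}. D i + D (s k i) \<le> 0"
        using D_neg D_zero k by (metis diff_less_0_iff_less less_imp_le mult_pos_neg order_refl zero_less_numeral)
      show "\<exists>i\<in>{1..int n}. D i + D (s k i) < 0"
        using residue_mem[of k] D_neg k by (intro bexI[of _ "(k - 1) mod int n + 1"]) auto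
    qed simp
    moreover have "(\<Sum>i = 1..int n. D (s k i)) = (\<Sum>i = 1..int n. D i)"
      by (rule sum_periodic_reindex) (auto simp: D_def per S_bij)
    ultimately have "(\<Sum>i = 1..int n. D i) < 0" by (simp add: sum.distrib)
    moreover have "(\<Sum>i = 1..int n. (\<pi> i - s k i)\<^sup>2) = (\<Sum>i = 1..int n. ((\<pi> \<circ> s k) i - i)\<^sup>2)"
      using sum_periodic_reindex[of "s k" "\<lambda>i. (\<pi> i - s k i)\<^sup>2"] by (simp add: per S_bij)
    ultimately have "(\<Sum>i = 1..int n. ((\<pi> \<circ> s k) i - i)\<^sup>2) < (\<Sum>i = 1..int n. (\<pi> i - i)\<^sup>2)"
      by (simp add: D_def sum_subtractf)
    moreover have "0 \<le> (\<Sum>i = 1..int n. ((\<pi> \<circ> s k) i - i)\<^sup>2)" by (intro sum_nonneg) simp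
    ultimately obtain w where "word w = \<pi> \<circ> s k"
      using less.hyps[of "\<pi> \<circ> s k"] \<pi> by (auto simp del: comp_apply)
    then have "word (w @ [k]) = \<pi>" by (simp add: comp_assoc)
    then show ?thesis by blast
  qed
qed

section \<open>Reduced words, strong exchange and descents\<close>

lemma reduced_word:
  assumes "\<pi> \<in> S"
  obtains w where "word w = \<pi>" "length w = len \<pi>"
proof -
  obtain w where "word w = \<pi>" using word_surj[OF assms] by blast
  then obtain v where "set v \<subseteq> {1..int n}" "word v = \<pi>" using word_normalize by metis
  then have "\<exists>m v. length v = m \<and> set v \<subseteq> {1..int n} \<and> word v = \<pi>" by blast
  from LeastI_ex[OF this] show thesis using that unfolding aff_length_def by blast
qed

text \<open>The strong exchange condition: some letter of the word transposes the images of \<open>i\<close> and \<open>j\<close>.\<close>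

lemma strong_exchange:
  "i < j \<Longrightarrow> word w j < word w i \<Longrightarrow> \<exists>v. Suc (length v) = length w \<and> word v = word w \<circ> t i j"
proof (induction w)
  case (Cons k w)
  show ?case
  proof (cases "word w j < word w i")
    case True
    then obtain v where "Suc (length v) = length w" "word v = word w \<circ> t i j"
      using Cons by blast
    then show ?thesis by (intro exI[of _ "k # v"]) (auto simp: comp_assoc)
  next
    case False
    then have "word w i < word w j" using S_eq_iff[OF word_S, of w i j] Cons.prems by linarith
    then have "word w i \<sim> k \<and> word w j = word w i + 1"
      using simple_less[of "word w i" "word w j" k] Cons.prems by auto
    then have "t (word w i) (word w j) = s k"
      using simple_cong[of "word w i" k] by (simp add: aff_simple_def)
    then have "word (k # w) \<circ> t i j = word w"
      using trans_conj[OF word_S, of w i j] by (simp add: comp_assoc del: comp_apply)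
    then have "word w = word (k # w) \<circ> t i j" by (rule sym)
    then show ?thesis by (intro exI[of _ w] conjI) (simp only: list.size)
  qed
qed simp

lemma len_trans_less:
  assumes "\<pi> \<in> S" "i < j" "\<pi> j < \<pi> i"
  shows "len (\<pi> \<circ> t i j) < len \<pi>"
proof -
  obtain w where w: "word w = \<pi>" "length w = len \<pi>" using reduced_word[OF assms(1)] .
  then obtain v where "Suc (length v) = length w" "word v = \<pi> \<circ> t i j"
    using strong_exchange[of i j w] assms by blast
  then show ?thesis using len_word_le[of v] w by simp
qed

lemma comp_trans_trans [simp]: "\<pi> \<circ> t i j \<circ> t i j = \<pi>"
  by (auto simp: fun_eq_iff)

lemma len_trans_greater:
  assumes "\<pi> \<in> S" "i < j" "\<not> i \<sim> j" "\<pi> i < \<pi> j"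
  shows "len \<pi> < len (\<pi> \<circ> t i j)"
  using len_trans_less[of "\<pi> \<circ> t i j" i j] assms by (simp add: trans_left trans_right)

lemma len_inv [simp]:
  assumes "\<pi> \<in> S"
  shows "len (inv \<pi>) = len \<pi>"
proof -
  have le: "len (inv \<sigma>) \<le> len \<sigma>" if \<sigma>: "\<sigma> \<in> S" for \<sigma>
  proof -
    obtain w where "word w = \<sigma>" "length w = len \<sigma>" using reduced_word[OF \<sigma>] .
    then show ?thesis using len_word_le[of "rev w"] inv_word by auto
  qed
  show ?thesis using le[OF assms] le[of "inv \<pi>"] assms by simp
qed

lemma len_id [simp]: "len id = 0"
  using len_word_le[of "[]"] by simp

lemma len_comp_simple_le:
  assumes "\<pi> \<in> S"
  shows "len (\<pi> \<circ> s k) \<le> len \<pi> + 1"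
proof -
  obtain w where "word w = \<pi>" "length w = len \<pi>" using reduced_word[OF assms] .
  then show ?thesis using len_word_le[of "w @ [k]"] by simp
qed

lemma comp_simple_simple [simp]: "\<pi> \<circ> s k \<circ> s k = \<pi>"
  by (simp add: comp_assoc)

lemma len_ascent:
  assumes "\<pi> \<in> S" "\<pi> k < \<pi> (k + 1)"
  shows "len (\<pi> \<circ> s k) = len \<pi> + 1"
  using len_comp_simple_le[OF assms(1), of k] len_trans_greater[of \<pi> k "k + 1"] assms not_cg_succ
  by (simp add: aff_simple_def)

lemma len_descent:
  assumes "\<pi> \<in> S" "\<pi> (k + 1) < \<pi> k"
  shows "len \<pi> = len (\<pi> \<circ> s k) + 1"
  using len_ascent[of "\<pi> \<circ> s k" k] assms by (simp add: simple_left[of k k] simple_right[of k k])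

lemma ascent_or_descent:
  assumes "\<pi> \<in> S"
  obtains "\<pi> k < \<pi> (k + 1)" | "\<pi> (k + 1) < \<pi> k"
  using S_eq_iff[OF assms, of k "k + 1"] by linarith

lemma len_left_ascent:
  assumes "\<pi> \<in> S" "inv \<pi> k < inv \<pi> (k + 1)"
  shows "len (s k \<circ> \<pi>) = len \<pi> + 1"
  using len_ascent[of "inv \<pi>" k] assms len_inv[of "s k \<circ> \<pi>"] by simp

lemma len_left_descent:
  assumes "\<pi> \<in> S" "inv \<pi> (k + 1) < inv \<pi> k"
  shows "len \<pi> = len (s k \<circ> \<pi>) + 1"
  using len_descent[of "inv \<pi>" k] assms len_inv[of "s k \<circ> \<pi>"] by simp

lemma descent_exists:
  assumes "\<pi> \<in> S" "\<pi> \<noteq> id"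
  obtains k where "\<pi> (k + 1) < \<pi> k"
  using no_descent_id[OF assms(1)] assms ascent_or_descent by metis

section \<open>The Demazure product\<close>

text \<open>The generator \<open>s k\<close> of the 0-Hecke monoid acting on the left: it multiplies
  only where that raises the length, and the comparison is the criterion for this
  (\<open>len_left_ascent\<close>). \<open>rstep\<close> is the action on the right.\<close>

definition lstep :: "int \<Rightarrow> (int \<Rightarrow> int) \<Rightarrow> int \<Rightarrow> int" where
  "lstep k \<sigma> = (if inv \<sigma> k < inv \<sigma> (k + 1) then s k \<circ> \<sigma> else \<sigma>)"

definition rstep :: "int \<Rightarrow> (int \<Rightarrow> int) \<Rightarrow> int \<Rightarrow> int" where
  "rstep k \<sigma> = (if \<sigma> k < \<sigma> (k + 1) then \<sigma> \<circ> s k else \<sigma>)"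

lemma lstep_S [simp]: "\<sigma> \<in> S \<Longrightarrow> lstep k \<sigma> \<in> S" and rstep_S [simp]: "\<sigma> \<in> S \<Longrightarrow> rstep k \<sigma> \<in> S"
  by (simp_all add: lstep_def rstep_def)

lemma S_inv_eqI: "\<sigma> \<in> S \<Longrightarrow> \<sigma> x = y \<Longrightarrow> inv \<sigma> y = x"
  using S_inv_apply(1) by blast

text \<open>Together with \<open>adjacent_down\<close> this describes the exceptional situation
  where \<sigma> carries the pair b, b + 1 to a translate of the pair a, a + 1, so that
  \<open>s a \<circ> \<sigma> = \<sigma> \<circ> s b\<close>.\<close>

definition adjacent_up :: "(int \<Rightarrow> int) \<Rightarrow> int \<Rightarrow> int \<Rightarrow> bool" where
  "adjacent_up \<sigma> b a \<longleftrightarrow> \<sigma> b \<sim> a \<and> \<sigma> (b + 1) = \<sigma> b + 1"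

definition adjacent_down :: "(int \<Rightarrow> int) \<Rightarrow> int \<Rightarrow> int \<Rightarrow> bool" where
  "adjacent_down \<sigma> b a \<longleftrightarrow> \<sigma> (b + 1) \<sim> a \<and> \<sigma> b = \<sigma> (b + 1) + 1"

lemma adjacent_up_inv:
  assumes "\<sigma> \<in> S" "adjacent_up \<sigma> b a"
  shows "adjacent_up (inv \<sigma>) a b"
proof -
  obtain m where m: "\<sigma> b = a + m * int n" using assms by (auto simp: adjacent_up_def elim: cgE)
  have "inv \<sigma> a = b + (- m) * int n"
    using m S_shift[OF assms(1), of b "- m"] by (intro S_inv_eqI[OF assms(1)]) simp
  moreover have "inv \<sigma> (a + 1) = b + 1 + (- m) * int n"
    using m S_shift[OF assms(1), of "b + 1" "- m"] assms(2)
    by (intro S_inv_eqI[OF assms(1)]) (simp add: adjacent_up_def)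
  moreover have "b + (- m) * int n \<sim> b" by (simp_all only: cg_shift cong_refl)
  ultimately show ?thesis by (simp add: adjacent_up_def)
qed

lemma adjacent_down_inv:
  assumes "\<sigma> \<in> S" "adjacent_down \<sigma> b a"
  shows "adjacent_down (inv \<sigma>) a b"
proof -
  obtain m where m: "\<sigma> (b + 1) = a + m * int n" using assms by (auto simp: adjacent_down_def elim: cgE)
  have "inv \<sigma> a = b + 1 + (- m) * int n"
    using m S_shift[OF assms(1), of "b + 1" "- m"] by (intro S_inv_eqI[OF assms(1)]) simp
  moreover have "inv \<sigma> (a + 1) = b + (- m) * int n"
    using m S_shift[OF assms(1), of b "- m"] assms(2)
    by (intro S_inv_eqI[OF assms(1)]) (simp add: adjacent_down_def)
  moreover have "b + (- m) * int n \<sim> b" "b + 1 + (- m) * int n \<sim> b + 1" by (simp_all only: cg_shift cong_refl)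
  ultimately show ?thesis by (simp add: adjacent_down_def)
qed

lemma adjacent_inv_iff:
  assumes "\<sigma> \<in> S"
  shows "adjacent_up (inv \<sigma>) a b \<longleftrightarrow> adjacent_up \<sigma> b a"
    and "adjacent_down (inv \<sigma>) a b \<longleftrightarrow> adjacent_down \<sigma> b a"
  using adjacent_up_inv[of \<sigma> b a] adjacent_up_inv[of "inv \<sigma>" a b]
    adjacent_down_inv[of \<sigma> b a] adjacent_down_inv[of "inv \<sigma>" a b] assms by auto

lemma trans_commute: "t i j = t j i"
  by (auto simp: aff_trans_def fun_eq_iff cong_sym_eq) (metis cong_trans cong_sym)+

lemma simple_comp_adjacent:
  assumes "\<sigma> \<in> S" "adjacent_up \<sigma> b a \<or> adjacent_down \<sigma> b a"
  shows "s a \<circ> \<sigma> = \<sigma> \<circ> s b"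
  using trans_conj[OF assms(1), of b "b + 1"] assms(2) simple_cong[of "\<sigma> b" a]
    simple_cong[of "\<sigma> (b + 1)" a] trans_commute[of "\<sigma> b" "\<sigma> (b + 1)"]
  by (auto simp: adjacent_up_def adjacent_down_def aff_simple_def simp del: comp_apply)

lemma simple_preserves_order:
  assumes "\<sigma> \<in> S" "\<not> adjacent_up \<sigma> b a" "\<not> adjacent_down \<sigma> b a"
  shows "s a (\<sigma> b) < s a (\<sigma> (b + 1)) \<longleftrightarrow> \<sigma> b < \<sigma> (b + 1)"
  using simple_less[of "\<sigma> b" "\<sigma> (b + 1)" a] simple_less[of "\<sigma> (b + 1)" "\<sigma> b" a] assms
  by (rule_tac ascent_or_descent[OF assms(1), of b]) (auto simp: adjacent_up_def adjacent_down_def)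

text \<open>Either the two multiplications have the same effect; then the two ascent tests agree,
  and whichever step comes second does nothing. Or \<open>s a\<close> keeps the order of \<sigma> b
  and \<sigma> (b + 1), and \<open>s b\<close> does the same on the side of the inverse, so the
  tests do not influence each other.\<close>

lemma lstep_rstep_commute:
  assumes "\<sigma> \<in> S"
  shows "lstep a (rstep b \<sigma>) = rstep b (lstep a \<sigma>)"
proof (cases "adjacent_up \<sigma> b a \<or> adjacent_down \<sigma> b a")
  case True
  have comm: "s a \<circ> \<sigma> = \<sigma> \<circ> s b" by (rule simple_comp_adjacent[OF assms True])
  have inv_comm: "s b \<circ> inv \<sigma> = inv \<sigma> \<circ> s a"
    using arg_cong[OF comm, of inv] assms by simp
  have iff: "inv \<sigma> a < inv \<sigma> (a + 1) \<longleftrightarrow> \<sigma> b < \<sigma> (b + 1)"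
  proof (cases "adjacent_up \<sigma> b a")
    case up: True
    then have "adjacent_up (inv \<sigma>) a b" using adjacent_up_inv[OF assms] by blast
    then show ?thesis using up unfolding adjacent_up_def by linarith
  next
    case False
    then have down: "adjacent_down \<sigma> b a" using True by blast
    then have "adjacent_down (inv \<sigma>) a b" using adjacent_down_inv[OF assms] by blast
    then show ?thesis using down unfolding adjacent_down_def by linarith
  qed
  have inv_eq: "inv (\<sigma> \<circ> s b) = inv \<sigma> \<circ> s a" using assms inv_comm by simp
  show ?thesis
  proof (cases "\<sigma> b < \<sigma> (b + 1)")
    case less: True
    then have "lstep a \<sigma> = \<sigma> \<circ> s b" "rstep b \<sigma> = \<sigma> \<circ> s b"
      using iff comm by (simp_all add: lstep_def rstep_def)
    moreover have "lstep a (\<sigma> \<circ> s b) = \<sigma> \<circ> s b"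
      using less iff unfolding lstep_def inv_eq by (simp add: simple_left simple_right)
    moreover have "rstep b (\<sigma> \<circ> s b) = \<sigma> \<circ> s b"
      using less unfolding rstep_def by (simp add: simple_left simple_right)
    ultimately show ?thesis by simp
  next
    case False
    then show ?thesis using iff by (simp add: lstep_def rstep_def)
  qed
next
  case False
  have "(s a \<circ> \<sigma>) b < (s a \<circ> \<sigma>) (b + 1) \<longleftrightarrow> \<sigma> b < \<sigma> (b + 1)"
    using simple_preserves_order[of \<sigma> b a] assms False by simp
  moreover have "(s b \<circ> inv \<sigma>) a < (s b \<circ> inv \<sigma>) (a + 1) \<longleftrightarrow> inv \<sigma> a < inv \<sigma> (a + 1)"
    using simple_preserves_order[of "inv \<sigma>" a b] adjacent_inv_iff[OF assms, of a b] assms False by simp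
  ultimately show ?thesis
    using assms by (auto simp: lstep_def rstep_def comp_assoc simp del: comp_apply)
qed

abbreviation lact :: "int list \<Rightarrow> (int \<Rightarrow> int) \<Rightarrow> int \<Rightarrow> int" where
  "lact w \<equiv> foldr lstep w"

lemma lact_S [simp]: "\<sigma> \<in> S \<Longrightarrow> lact w \<sigma> \<in> S"
  by (induction w) auto

lemma lact_rstep: "\<sigma> \<in> S \<Longrightarrow> lact w (rstep b \<sigma>) = rstep b (lact w \<sigma>)"
  by (induction w) (auto simp: lstep_rstep_commute)

text \<open>Every \<sigma> arises from the identity by right steps, found by peeling off descents,
  and the left actions commute with these.\<close>

lemma lact_determined:
  assumes "lact v id = lact w id"
  shows "\<sigma> \<in> S \<Longrightarrow> lact v \<sigma> = lact w \<sigma>"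
proof (induction "len \<sigma>" arbitrary: \<sigma> rule: less_induct)
  case less
  show ?case
  proof (cases "\<sigma> = id")
    case False
    then obtain k where k: "\<sigma> (k + 1) < \<sigma> k" using descent_exists less.prems by metis
    have "\<sigma> = rstep k (\<sigma> \<circ> s k)"
      using k by (simp add: rstep_def simple_left simple_right)
    moreover have "lact v (\<sigma> \<circ> s k) = lact w (\<sigma> \<circ> s k)"
      using len_descent[OF less.prems k] less.prems by (intro less.hyps) auto
    ultimately show ?thesis using less.prems by (metis lact_rstep comp_S simple_S)
  qed (simp add: assms)
qed

lemma len_comp_le:
  assumes "\<pi> \<in> S" "\<sigma> \<in> S"
  shows "len (\<pi> \<circ> \<sigma>) \<le> len \<pi> + len \<sigma>"
proof -
  obtain v w where "word v = \<pi>" "length v = len \<pi>" "word w = \<sigma>" "length w = len \<sigma>"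
    using reduced_word assms by metis
  then show ?thesis using len_word_le[of "v @ w"] by simp
qed

lemma len_simple [simp]: "len (s k) = 1"
  using len_ascent[of id k] by simp

lemma lstep_eqI:
  assumes "\<sigma> \<in> S" "len (s k \<circ> \<sigma>) = len \<sigma> + 1"
  shows "lstep k \<sigma> = s k \<circ> \<sigma>"
  using len_left_descent[OF assms(1), of k] assms ascent_or_descent[of "inv \<sigma>" k]
  by (auto simp: lstep_def)

text \<open>Additivity leaves no room for loss: each letter has to raise the length, so no step is
  idle and the action is plain multiplication.\<close>

lemma lact_reduced:
  assumes "length w = len (word w)" "\<sigma> \<in> S" "len (word w \<circ> \<sigma>) = len (word w) + len \<sigma>"
  shows "lact w \<sigma> = word w \<circ> \<sigma>"
  using assms
proof (induction w)
  case Nil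
  show "lact [] \<sigma> = word [] \<circ> \<sigma>" by simp
next
  case (Cons k w)
  have len_kw: "length (k # w) = len (word (k # w))" by (rule Cons.prems(1))
  have a: "word (k # w) = s k \<circ> word w" by (rule word_Cons)
  have add: "len (word (k # w) \<circ> \<sigma>) = len (word (k # w)) + len \<sigma>" by (rule Cons.prems(3))
  have b: "word (k # w) \<circ> \<sigma> = s k \<circ> (word w \<circ> \<sigma>)" unfolding a by (rule comp_assoc)
  have le: "len (word (k # w)) \<le> 1 + len (word w)"
    unfolding a using len_comp_le[of "s k" "word w"] by simp
  have le2: "len (word (k # w) \<circ> \<sigma>) \<le> 1 + len (word w \<circ> \<sigma>)"
    unfolding b using len_comp_le[of "s k" "word w \<circ> \<sigma>"] Cons.prems by simp
  have w: "length w = len (word w)" using le len_kw len_word_le[of w] by (simp del: word_Cons)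
  have l: "len (word w \<circ> \<sigma>) = len (word w) + len \<sigma>"
    using le2 len_kw Cons.prems(2) add w len_comp_le[of "word w" \<sigma>] by (simp del: word_Cons)
  have "lact w \<sigma> = word w \<circ> \<sigma>" using Cons.IH w l Cons.prems by blast
  moreover have "lstep k (word w \<circ> \<sigma>) = s k \<circ> (word w \<circ> \<sigma>)"
    using Cons.prems(2) l w add len_kw unfolding b by (intro lstep_eqI) (auto simp del: word_Cons)
  ultimately show "lact (k # w) \<sigma> = word (k # w) \<circ> \<sigma>"
    unfolding b by simp
qed

lemma lact_surj:
  assumes "\<pi> \<in> S"
  shows "\<exists>w. lact w id = \<pi>"
proof -
  obtain w where "word w = \<pi>" "length w = len \<pi>" using reduced_word[OF assms] .
  then show ?thesis using lact_reduced[of w id] by auto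
qed

text \<open>The left and right actions of the generators commute, so the left action of a word on \<open>\<sigma>\<close>
  depends only on its action on the identity; this makes the Demazure product well defined.\<close>

definition hecke :: "(int \<Rightarrow> int) \<Rightarrow> (int \<Rightarrow> int) \<Rightarrow> int \<Rightarrow> int" where
  "hecke = (\<lambda>\<pi>\<in>S. \<lambda>\<sigma>\<in>S. lact (SOME w. lact w id = \<pi>) \<sigma>)"

lemma hecke_lact:
  assumes "\<sigma> \<in> S"
  shows "hecke (lact w id) \<sigma> = lact w \<sigma>"
proof -
  have "lact (SOME v. lact v id = lact w id) id = lact w id" by (rule someI) (rule refl)
  then have "lact (SOME v. lact v id = lact w id) \<sigma> = lact w \<sigma>"
    using assms by (rule lact_determined)
  then show ?thesis using assms by (simp add: hecke_def)
qed

section \<open>Existence and uniqueness of the Demazure product\<close>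

lemma is_demazure_hecke: "is_demazure n hecke"
  unfolding is_demazure_def
proof (intro conjI ballI allI impI)
  show "hecke \<in> S \<rightarrow>\<^sub>E (S \<rightarrow>\<^sub>E S)" by (auto simp: hecke_def)
next
  fix \<pi> \<sigma> \<rho> assume S: "\<pi> \<in> S" "\<sigma> \<in> S" "\<rho> \<in> S"
  obtain v w where vw: "lact v id = \<pi>" "lact w id = \<sigma>" using lact_surj S by metis
  have "hecke \<pi> \<sigma> = lact (v @ w) id" using hecke_lact[of \<sigma> v] vw S by simp
  then have "hecke (hecke \<pi> \<sigma>) \<rho> = hecke (lact (v @ w) id) \<rho>" by (rule arg_cong)
  also have "\<dots> = lact (v @ w) \<rho>" by (rule hecke_lact[OF S(3)])
  also have "\<dots> = hecke \<pi> (hecke \<sigma> \<rho>)"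
    using hecke_lact[of \<rho> w] hecke_lact[of "lact w \<rho>" v] vw S by simp
  finally show "hecke (hecke \<pi> \<sigma>) \<rho> = hecke \<pi> (hecke \<sigma> \<rho>)" .
next
  fix k
  have "lact [k] id = s k" by (simp add: lstep_def)
  moreover have "lact [k] (s k) = s k" by (simp add: lstep_def simple_left simple_right)
  ultimately show "hecke (s k) (s k) = s k" using hecke_lact[of "s k" "[k]"] by simp
next
  fix \<pi> \<sigma> assume S: "\<pi> \<in> S" "\<sigma> \<in> S" and l: "len (\<pi> \<circ> \<sigma>) = len \<pi> + len \<sigma>"
  obtain w where w: "word w = \<pi>" "length w = len \<pi>" using reduced_word[OF S(1)] .
  then have "lact w id = \<pi>" using lact_reduced[of w id] by simp
  then show "hecke \<pi> \<sigma> = \<pi> \<circ> \<sigma>"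
    using lact_reduced[of w \<sigma>] hecke_lact[of \<sigma> w] w l S by simp
qed

lemma is_demazure_assoc:
  "is_demazure n f \<Longrightarrow> \<pi> \<in> S \<Longrightarrow> \<sigma> \<in> S \<Longrightarrow> \<rho> \<in> S \<Longrightarrow> f (f \<pi> \<sigma>) \<rho> = f \<pi> (f \<sigma> \<rho>)"
  unfolding is_demazure_def by blast

lemma is_demazure_closed:
  assumes "is_demazure n f" "\<pi> \<in> S" "\<sigma> \<in> S"
  shows "f \<pi> \<sigma> \<in> S"
proof -
  have "f \<in> S \<rightarrow>\<^sub>E (S \<rightarrow>\<^sub>E S)" using assms(1) by (simp add: is_demazure_def)
  then have "f \<pi> \<in> S \<rightarrow>\<^sub>E S" using assms(2) by (rule PiE_mem)
  then show ?thesis using assms(3) by (rule PiE_mem)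
qed

lemma is_demazure_additive:
  "is_demazure n f \<Longrightarrow> \<pi> \<in> S \<Longrightarrow> \<sigma> \<in> S \<Longrightarrow> len (\<pi> \<circ> \<sigma>) = len \<pi> + len \<sigma> \<Longrightarrow> f \<pi> \<sigma> = \<pi> \<circ> \<sigma>"
  unfolding is_demazure_def by blast

text \<open>At a descent, \<sigma> is the length-additive product of \<open>s k\<close> and
  \<open>s k \<circ> \<sigma>\<close>; associativity and idempotence then absorb the additional
  \<open>s k\<close>.\<close>

lemma is_demazure_simple_left:
  assumes f: "is_demazure n f" and \<sigma>: "\<sigma> \<in> S"
  shows "f (s k) \<sigma> = lstep k \<sigma>"
proof (cases "inv \<sigma> k < inv \<sigma> (k + 1)")
  case True
  then show ?thesis using len_left_ascent[OF \<sigma>] f \<sigma> by (simp add: is_demazure_def lstep_def)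
next
  case False
  then have "inv \<sigma> (k + 1) < inv \<sigma> k" using ascent_or_descent[of "inv \<sigma>" k] \<sigma> by auto
  then have "len \<sigma> = len (s k \<circ> \<sigma>) + 1" using len_left_descent \<sigma> by blast
  then have a: "f (s k) (s k \<circ> \<sigma>) = \<sigma>" using f \<sigma> by (simp add: is_demazure_def)
  have "f (s k) (f (s k) (s k \<circ> \<sigma>)) = f (f (s k) (s k)) (s k \<circ> \<sigma>)"
    using f \<sigma> by (simp only: is_demazure_assoc comp_S simple_S)
  also have "\<dots> = f (s k) (s k \<circ> \<sigma>)" using f by (simp add: is_demazure_def)
  finally show ?thesis using False a by (simp add: lstep_def)
qed

lemma is_demazure_simple_right:
  assumes f: "is_demazure n f" and \<sigma>: "\<sigma> \<in> S"
  shows "f \<sigma> (s k) = rstep k \<sigma>"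
proof (cases "\<sigma> k < \<sigma> (k + 1)")
  case True
  then show ?thesis using len_ascent[OF \<sigma>] f \<sigma> by (simp add: is_demazure_def rstep_def)
next
  case False
  then have "\<sigma> (k + 1) < \<sigma> k" using ascent_or_descent[of \<sigma> k] \<sigma> by auto
  then have "len \<sigma> = len (\<sigma> \<circ> s k) + 1" using len_descent \<sigma> by blast
  then have a: "f (\<sigma> \<circ> s k) (s k) = \<sigma>" using f \<sigma> by (simp add: is_demazure_def)
  have "f (f (\<sigma> \<circ> s k) (s k)) (s k) = f (\<sigma> \<circ> s k) (f (s k) (s k))"
    using f \<sigma> by (simp only: is_demazure_assoc comp_S simple_S)
  also have "\<dots> = f (\<sigma> \<circ> s k) (s k)" using f by (simp add: is_demazure_def)
  finally show ?thesis using False a by (simp add: rstep_def)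
qed

lemma is_demazure_word:
  assumes f: "is_demazure n f" and \<sigma>: "\<sigma> \<in> S"
  shows "length w = len (word w) \<Longrightarrow> f (word w) \<sigma> = lact w \<sigma>"
proof (induction w)
  case Nil
  have "f id \<sigma> = id \<circ> \<sigma>" using is_demazure_additive[OF f id_S \<sigma>] by simp
  then show "f (word []) \<sigma> = lact [] \<sigma>" by simp
next
  case (Cons k w)
  have len_kw: "length (k # w) = len (word (k # w))" by (rule Cons.prems(1))
  have a: "word (k # w) = s k \<circ> word w" by (rule word_Cons)
  have le: "len (word (k # w)) \<le> 1 + len (word w)"
    unfolding a using len_comp_le[of "s k" "word w"] by simp
  have w: "length w = len (word w)" using le len_kw len_word_le[of w] by (simp del: word_Cons)
  then have "len (s k \<circ> word w) = len (s k) + len (word w)" using len_kw a by simp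
  then have "f (s k) (word w) = s k \<circ> word w" using f by (simp add: is_demazure_def)
  then have "f (word (k # w)) \<sigma> = f (f (s k) (word w)) \<sigma>" using a by simp
  also have "\<dots> = f (s k) (f (word w) \<sigma>)"
    using f \<sigma> by (simp only: is_demazure_assoc word_S simple_S)
  also have "\<dots> = lstep k (lact w \<sigma>)"
    using Cons.IH[OF w] is_demazure_simple_left[OF f] \<sigma> by simp
  finally show "f (word (k # w)) \<sigma> = lact (k # w) \<sigma>" by simp
qed

text \<open>The axioms determine the product with a simple reflection, hence by associativity the
  product with a reduced word; extensionality settles the arguments outside the group.\<close>

lemma is_demazure_unique:
  assumes "is_demazure n f" "is_demazure n g"
  shows "f = g"
proof -
  have fg: "f \<in> S \<rightarrow>\<^sub>E (S \<rightarrow>\<^sub>E S)" "g \<in> S \<rightarrow>\<^sub>E (S \<rightarrow>\<^sub>E S)"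
    using assms by (simp_all add: is_demazure_def)
  show ?thesis
  proof (rule PiE_ext[OF fg])
    fix \<pi> assume \<pi>: "\<pi> \<in> S"
    obtain w where w: "word w = \<pi>" "length w = len \<pi>" using reduced_word[OF \<pi>] .
    show "f \<pi> = g \<pi>"
    proof (rule PiE_ext)
      show "f \<pi> \<in> S \<rightarrow>\<^sub>E S" "g \<pi> \<in> S \<rightarrow>\<^sub>E S" using fg \<pi> by blast+
      fix \<sigma> assume "\<sigma> \<in> S"
      then show "f \<pi> \<sigma> = g \<pi> \<sigma>" using is_demazure_word assms w by metis
    qed
  qed
qed

lemma is_demazure_demazure: "is_demazure n (demazure n)"
  unfolding demazure_def by (rule theI[where P = "is_demazure n", OF is_demazure_hecke]) (rule is_demazure_unique[OF _ is_demazure_hecke])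

section \<open>Demazure squares\<close>

definition square :: "(int \<Rightarrow> int) \<Rightarrow> int \<Rightarrow> int" where
  "square \<pi> = demazure n (inv \<pi>) \<pi>"

lemma square_S [simp]: "\<pi> \<in> S \<Longrightarrow> square \<pi> \<in> S"
  unfolding square_def by (simp add: is_demazure_closed is_demazure_demazure)

lemma square_id [simp]: "square id = id"
proof -
  have "demazure n id id = id \<circ> id"
    using is_demazure_additive[OF is_demazure_demazure id_S id_S] by simp
  then show ?thesis by (simp add: square_def)
qed

text \<open>At an ascent \<open>s k \<circ> inv \<pi>\<close> and \<open>\<pi> \<circ> s k\<close>
  are themselves Demazure products, so reassociation brings one \<open>s k\<close> to each side of
  \<open>square \<pi>\<close>. Squares thus grow by conjugation in the 0-Hecke monoid.\<close>

lemma square_ascent: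
  assumes \<pi>: "\<pi> \<in> S" "\<pi> k < \<pi> (k + 1)"
  shows "square (\<pi> \<circ> s k) = lstep k (rstep k (square \<pi>))"
proof -
  let ?D = "demazure n"
  note d = is_demazure_demazure
  have cl: "?D a b \<in> S" if "a \<in> S" "b \<in> S" for a b
    using is_demazure_closed[OF d] that .
  have assoc: "?D (?D a b) c = ?D a (?D b c)" if "a \<in> S" "b \<in> S" "c \<in> S" for a b c
    using is_demazure_assoc[OF d] that .
  have l: "?D (s k) (inv \<pi>) = inv (\<pi> \<circ> s k)"
    using is_demazure_simple_left[OF d, of "inv \<pi>" k] \<pi> by (simp add: lstep_def)
  have r: "?D \<pi> (s k) = \<pi> \<circ> s k"
    using is_demazure_simple_right[OF d, of \<pi> k] \<pi> by (simp add: rstep_def)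
  have "square (\<pi> \<circ> s k) = ?D (?D (s k) (inv \<pi>)) (?D \<pi> (s k))"
    unfolding square_def l r ..
  also have "\<dots> = ?D (s k) (?D (?D (inv \<pi>) \<pi>) (s k))"
    using \<pi> cl by (simp add: assoc)
  also have "\<dots> = lstep k (rstep k (square \<pi>))"
    using \<pi> cl by (simp add: is_demazure_simple_left[OF d] is_demazure_simple_right[OF d] square_def)
  finally show ?thesis .
qed

section \<open>Atoms\<close>

abbreviation I :: "(int \<Rightarrow> int) set" where "I \<equiv> aff_invols n"

lemma invol_iff: "z \<in> I \<longleftrightarrow> z \<in> S \<and> (\<forall>x. z (z x) = x)"
proof -
  have "z = inv z \<longleftrightarrow> (\<forall>x. z (z x) = x)" if "z \<in> S"
    using that by (metis S_inv_apply(2) S_inv_eqI ext)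
  then show ?thesis by (auto simp: aff_invols_def)
qed

lemma invol_S: "z \<in> I \<Longrightarrow> z \<in> S" and invol_invol [simp]: "z \<in> I \<Longrightarrow> z (z x) = x"
  by (auto simp: invol_iff)

lemma invol_eq_iff [simp]: "z \<in> I \<Longrightarrow> z x = z y \<longleftrightarrow> x = y"
  by (simp add: invol_S)

lemma invol_inv: "z \<in> I \<Longrightarrow> inv z = z"
  by (simp add: aff_invols_def)

text \<open>The last clause names only two of the four comparisons between the values on two
  non-nested cycles; the other two are its instance at \<open>z x\<close> and \<open>z x'\<close>.
  Fixed points count as cycles.\<close>

definition fits :: "(int \<Rightarrow> int) \<Rightarrow> (int \<Rightarrow> int) \<Rightarrow> bool" where
  "fits \<pi> z \<longleftrightarrow> (\<forall>x. x < z x \<longrightarrow> \<pi> (z x) < \<pi> x) \<and>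
     (\<forall>x e. x < e \<and> e < z x \<longrightarrow> \<not> (\<pi> (z x) < \<pi> e \<and> \<pi> e < \<pi> x)) \<and>
     (\<forall>x x'. x < x' \<and> z x < z x' \<longrightarrow> \<pi> x < \<pi> x' \<and> \<pi> x < \<pi> (z x'))"

lemma fitsD:
  assumes "fits \<pi> z"
  shows "x < z x \<Longrightarrow> \<pi> (z x) < \<pi> x"
    and "x < e \<Longrightarrow> e < z x \<Longrightarrow> \<not> (\<pi> (z x) < \<pi> e \<and> \<pi> e < \<pi> x)"
    and "x < x' \<Longrightarrow> z x < z x' \<Longrightarrow> \<pi> x < \<pi> x' \<and> \<pi> x < \<pi> (z x')"
  using assms unfolding fits_def by blast+

section \<open>How the description changes under one generator\<close>

lemma simple_less_iff:
  "s k u < s k v \<longleftrightarrow> (u < v \<and> \<not> (u \<sim> k \<and> v = u + 1)) \<or> (v \<sim> k \<and> u = v + 1)"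
proof (cases "u = v")
  case False
  then show ?thesis
    using simple_less[of u v k] simple_less[of v u k] simple_left[of u k] simple_right[of u k]
      simple_left[of v k] simple_right[of v k] by (cases "u < v") auto
qed simp

lemma descent_shift:
  assumes "z \<in> S" "x \<sim> k"
  shows "z x < z (x + 1) \<longleftrightarrow> z k < z (k + 1)"
proof -
  obtain m where m: "x = k + m * int n" using assms(2) by (rule cgE)
  have "z (x + 1) = z (k + 1) + m * int n"
    using S_shift[OF assms(1), of "k + 1" m] m by (simp add: algebra_simps)
  then show ?thesis using S_shift[OF assms(1), of k m] m by simp
qed

text \<open>Applying \<open>z\<close> twice doubles the translation, and the result has to be
  0.\<close>

lemma invol_cong_fixed:
  assumes "z \<in> I" "z x \<sim> x"
  shows "z x = x"
proof -
  obtain m where m: "z x = x + m * int n" using assms(2) by (rule cgE)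
  then have "z (z x) = x + 2 * m * int n"
    using S_shift[OF invol_S[OF assms(1)], of x m] by simp
  then have "m = 0" using assms(1) two_le_n by simp
  then show ?thesis using m by simp
qed

text \<open>No nontrivial translation is compatible with an involution, so the only ascent at which
  conjugation by \<open>s k\<close> changes nothing is a pair of fixed points. This singles out the
  branch of \<open>hecke_conj_ascent\<close> that creates a 2-cycle.\<close>

lemma adjacent_up_invol:
  assumes "z \<in> I" "x \<sim> k" "z x \<sim> k" "z (x + 1) = z x + 1"
  shows "z k = k \<and> z (k + 1) = k + 1"
proof -
  have x: "z x = x" using assms invol_cong_fixed cong_sym cong_trans by metis
  obtain m where m: "k = x + m * int n" using assms(2) cong_sym cgE by metis
  then show ?thesis
    using S_shift[OF invol_S[OF assms(1)], of x m] S_shift[OF invol_S[OF assms(1)], of "x + 1" m] x assms(4)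
    by (simp add: algebra_simps)
qed

lemma adjacent_down_invol:
  assumes "z \<in> I" "x \<sim> k" "z (x + 1) \<sim> k" "z x = z (x + 1) + 1"
  shows "z k = k + 1 \<and> z (k + 1) = k"
proof -
  obtain m where m: "z (x + 1) = x + m * int n"
    using assms cong_sym cong_trans cgE by metis
  have "z (x + 1 + m * int n) = z (x + 1) + m * int n"
    using S_shift[OF invol_S[OF assms(1)]] .
  moreover have "x + 1 + m * int n = z x" using m assms(4) by simp
  ultimately have "x = x + m * int n + m * int n" using m assms(1) by simp
  then have "m = 0" using two_le_n by (simp flip: distrib_right)
  then have x: "z (x + 1) = x" "z x = x + 1" using m assms(4) by auto
  obtain q where q: "k = x + q * int n" using assms(2) cong_sym cgE by metis
  then show ?thesis
    using S_shift[OF invol_S[OF assms(1)], of x q] S_shift[OF invol_S[OF assms(1)], of "x + 1" q] x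
    by (simp add: algebra_simps)
qed

text \<open>Substituting x = \<open>s k u\<close> moves the generator off the values: \<pi> and
  \<open>z\<close> appear unchanged, and only comparisons of positions differ, and those only for
  neighbours (\<open>simple_less_iff\<close>).\<close>

lemma fits_conj_iff:
  "fits (\<pi> \<circ> s k) (s k \<circ> z \<circ> s k) \<longleftrightarrow>
     (\<forall>u. s k u < s k (z u) \<longrightarrow> \<pi> (z u) < \<pi> u) \<and>
     (\<forall>u e. s k u < s k e \<and> s k e < s k (z u) \<longrightarrow> \<not> (\<pi> (z u) < \<pi> e \<and> \<pi> e < \<pi> u)) \<and>
     (\<forall>u u'. s k u < s k u' \<and> s k (z u) < s k (z u') \<longrightarrow> \<pi> u < \<pi> u' \<and> \<pi> u < \<pi> (z u'))"
proof -
  have all: "(\<forall>x. P x) \<longleftrightarrow> (\<forall>u. P (s k u))" for P :: "int \<Rightarrow> bool"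
    by (metis simple_involutive(1))
  show ?thesis
    unfolding fits_def by (subst (1 2 4) all, subst (2 3) all) simp
qed

text \<open>Only a newly enclosed element needs an argument: before the swap its cycle and the
  enclosing one were not nested, and the third clause of \<open>fits\<close> orders their values. A
  newly non-nested pair cannot arise: by the ascent, both its ends would have to be swapped at once,
  which leads back to two fixed points.\<close>

lemma fits_conj_up:
  assumes z: "z \<in> I" and f: "fits \<pi> z" and asc: "z k < z (k + 1)"
    and nc: "\<not> (z k = k \<and> z (k + 1) = k + 1)"
  shows "fits (\<pi> \<circ> s k) (s k \<circ> z \<circ> s k)"
proof -
  note zz = invol_invol[OF z]
  have up: "z x < z (x + 1)" if "x \<sim> k" for x
    using descent_shift[OF invol_S[OF z] that] asc by simp
  have nc': "\<not> (x \<sim> k \<and> z x \<sim> k \<and> z (x + 1) = z x + 1)" for x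
    using adjacent_up_invol[OF z] nc by blast
  show ?thesis
    unfolding fits_conj_iff
  proof (intro conjI allI impI)
    fix u assume "s k u < s k (z u)"
    then have "u < z u" using up[of "z u"] zz[of u] unfolding simple_less_iff by auto
    then show "\<pi> (z u) < \<pi> u" by (rule fitsD[OF f])
  next
    fix u e assume a: "s k u < s k e \<and> s k e < s k (z u)"
    consider "u < e" "e < z u" | "e \<sim> k" "u = e + 1" | "z u \<sim> k" "e = z u + 1"
      using a unfolding simple_less_iff by blast
    then show "\<not> (\<pi> (z u) < \<pi> e \<and> \<pi> e < \<pi> u)"
    proof cases
      case 1
      then show ?thesis using fitsD(2)[OF f] by blast
    next
      case 2
      then have "\<pi> e < \<pi> (z u)" using fitsD(3)[OF f, of e u] up[of e] by simp
      then show ?thesis by simp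
    next
      case 3
      then have "u < z e" using up[of "z u"] zz by simp
      then have "\<pi> u < \<pi> e" using fitsD(3)[OF f, of u "z e"] 3 zz by simp
      then show ?thesis by simp
    qed
  next
    fix u u' assume a: "s k u < s k u' \<and> s k (z u) < s k (z u')"
    have "u < u' \<and> z u < z u'"
    proof (rule ccontr)
      assume "\<not> (u < u' \<and> z u < z u')"
      then consider "u' \<sim> k" "u = u' + 1" | "u < u'" "z u' \<sim> k" "z u = z u' + 1"
        using a unfolding simple_less_iff by blast
      then show False
      proof cases
        case 1
        then have "z u' < z u" using up[of u'] by simp
        then have "z u' \<sim> k \<and> z u = z u' + 1" using a unfolding simple_less_iff by auto
        then show False using 1 nc'[of u'] by simp
      next
        case 2
        then show False using up[of "z u'"] zz[of u] zz[of u'] by (metis less_asym)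
      qed
    qed
    then show "\<pi> u < \<pi> u'" "\<pi> u < \<pi> (z u')" using fitsD(3)[OF f] by blast+
  qed
qed

lemma comp_simple_cases:
  assumes "z \<in> S" "z k = k" "z (k + 1) = k + 1"
  shows "x \<sim> k \<Longrightarrow> (z \<circ> s k) x = x + 1" "x - 1 \<sim> k \<Longrightarrow> (z \<circ> s k) x = x - 1"
    "\<not> x \<sim> k \<Longrightarrow> \<not> x - 1 \<sim> k \<Longrightarrow> (z \<circ> s k) x = z x"
    "x \<sim> k \<Longrightarrow> z x = x" "x - 1 \<sim> k \<Longrightarrow> z x = x"
proof -
  have a: "z x = x" "z (x + 1) = x + 1" if xk: "x \<sim> k" for x
  proof -
    obtain m where m: "x = k + m * int n" using xk by (rule cgE)
    then show "z x = x" "z (x + 1) = x + 1"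
      using S_shift[OF assms(1), of k m] S_shift[OF assms(1), of "k + 1" m] assms
      by (simp_all add: algebra_simps)
  qed
  show "x \<sim> k \<Longrightarrow> (z \<circ> s k) x = x + 1" by (simp add: simple_left a)
  show "x - 1 \<sim> k \<Longrightarrow> (z \<circ> s k) x = x - 1" using simple_right[of "x - 1" k] by (simp add: a)
  show "\<not> x \<sim> k \<Longrightarrow> \<not> x - 1 \<sim> k \<Longrightarrow> (z \<circ> s k) x = z x"
    by (rule_tac x = x and k = k in simple_cases) auto
  show "x \<sim> k \<Longrightarrow> z x = x" by (rule a)
  show "x - 1 \<sim> k \<Longrightarrow> z x = x" using a(2)[of "x - 1"] by simp
qed

lemma simple_less_unmoved:
  assumes "\<not> a \<sim> k" "\<not> a - 1 \<sim> k"
  shows "s k b < a \<longleftrightarrow> b < a" "a < s k b \<longleftrightarrow> a < b"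
proof -
  have sa: "s k a = a" using assms by (rule_tac x = a and k = k in simple_cases) auto
  show "s k b < a \<longleftrightarrow> b < a" "a < s k b \<longleftrightarrow> a < b"
    using simple_less_iff[of k b a] simple_less_iff[of k a b] assms unfolding sa by auto
qed

text \<open>The moved elements (\<open>?M\<close>) are exactly those of the new 2-cycles, each of
  which joins two neighbours. An unmoved element lies on the same side of both neighbours, so
  replacing x by \<open>s k x\<close> keeps its comparisons, and nothing lies inside a new
  cycle.\<close>

lemma fits_mult_up:
  assumes z: "z \<in> I" and f: "fits \<pi> z" and fixed: "z k = k" "z (k + 1) = k + 1"
    and \<pi>: "\<pi> \<in> S"
  shows "fits (\<pi> \<circ> s k) (z \<circ> s k)"
proof -
  let ?M = "\<lambda>x. x \<sim> k \<or> x - 1 \<sim> k"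
  let ?w = "z \<circ> s k"
  note zz = invol_invol[OF z]
  have "\<pi> k < \<pi> (k + 1)" using fitsD(3)[OF f, of k "k + 1"] fixed by simp
  then have up: "\<pi> x < \<pi> (x + 1)" if "x \<sim> k" for x using descent_shift[OF \<pi> that] by simp
  have zM: "z x = x" if "?M x" for x
    using comp_simple_cases(4,5)[OF invol_S[OF z] fixed, of x] that by blast
  have sM: "?M (s k x)" if "?M x" for x
    using that by (rule_tac x = x and k = k in simple_cases) auto
  have wM: "?w x = s k x" if "?M x" for x using zM[OF sM[OF that]] by simp
  have s_unmoved: "s k x = x" if "\<not> ?M x" for x
    using that by (rule_tac x = x and k = k in simple_cases) auto
  have w_unmoved: "?w x = z x" if "\<not> ?M x" for x using s_unmoved[OF that] by simp
  have z_unmoved: "\<not> ?M (z x)" if "\<not> ?M x" for x using zM[of "z x"] zz that by metis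
  note less = simple_less_unmoved[of _ k]
  show ?thesis
    unfolding fits_def
  proof (intro conjI allI impI)
    fix x assume a: "x < ?w x"
    show "(\<pi> \<circ> s k) (?w x) < (\<pi> \<circ> s k) x"
    proof (cases "?M x")
      case True
      then have "x \<sim> k" "s k x = x + 1"
        using a wM[OF True] by (rule_tac x = x and k = k in simple_cases; simp)+
      then show ?thesis using up[of x] wM[OF True] by (simp add: simple_right)
    next
      case False
      then show ?thesis
        using a fitsD(1)[OF f, of x] s_unmoved z_unmoved[OF False] w_unmoved[OF False] by simp
    qed
  next
    fix x e assume a: "x < e \<and> e < ?w x"
    have x: "\<not> ?M x"
    proof
      assume "?M x"
      then have "e < s k x" using a wM by simp
      then show False using a by (rule_tac x = x and k = k in simple_cases) auto
    qed
    then have "x < s k e" "s k e < z x"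
      using a less[of x e] less[of "z x" e] z_unmoved[OF x] w_unmoved[OF x] by auto
    then show "\<not> ((\<pi> \<circ> s k) (?w x) < (\<pi> \<circ> s k) e \<and> (\<pi> \<circ> s k) e < (\<pi> \<circ> s k) x)"
      using fitsD(2)[OF f, of x "s k e"] s_unmoved[OF x] w_unmoved[OF x] s_unmoved[OF z_unmoved[OF x]] by simp
  next
    fix x x' assume a: "x < x' \<and> ?w x < ?w x'"
    have "\<pi> (s k x) < \<pi> (s k x') \<and> \<pi> (s k x) < \<pi> (s k (?w x'))"
    proof (cases "?M x")
      case x: True
      show ?thesis
      proof (cases "?M x'")
        case x': True
        have lt: "s k x < s k x'" using a wM[OF x] wM[OF x'] by simp
        moreover have "s k x < x'"
        proof (rule ccontr)
          assume "\<not> s k x < x'"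
          then have "x' < s k x \<or> x' = s k x" by linarith
          then show False
          proof
            assume "x' = s k x"
            then show False using lt a by simp
          next
            assume "x' < s k x"
            then show False using a by (rule_tac x = x and k = k in simple_cases) auto
          qed
        qed
        ultimately show ?thesis
          using fitsD(3)[OF f, of "s k x" "s k x'"] fitsD(3)[OF f, of "s k x" x']
            zM[OF x'] zM[OF sM[OF x]] zM[OF sM[OF x']] wM[OF x'] by simp
      next
        case x': False
        have "s k x < x'" "s k x < z x'"
          using less[of x' x] a x' wM[OF x] w_unmoved[OF x'] by auto
        then show ?thesis
          using fitsD(3)[OF f, of "s k x" x'] zM[OF sM[OF x]] s_unmoved[OF x'] w_unmoved[OF x']
            s_unmoved[OF z_unmoved[OF x']] by simp
      qed
    next
      case x: False
      show ?thesis
      proof (cases "?M x'")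
        case x': True
        have "x < s k x'" "z x < s k x'" "z x < x'"
          using less[of x x'] less[of "z x" x'] z_unmoved[OF x] a x wM[OF x'] w_unmoved[OF x] by auto
        then show ?thesis
          using fitsD(3)[OF f, of x "s k x'"] fitsD(3)[OF f, of x x'] a
            zM[OF sM[OF x']] zM[OF x'] s_unmoved[OF x] wM[OF x'] by simp
      next
        case x': False
        show ?thesis
          using fitsD(3)[OF f, of x x'] a w_unmoved[OF x] w_unmoved[OF x']
            s_unmoved[OF x] s_unmoved[OF x'] s_unmoved[OF z_unmoved[OF x']] by simp
      qed
    qed
    then show "(\<pi> \<circ> s k) x < (\<pi> \<circ> s k) x'" "(\<pi> \<circ> s k) x < (\<pi> \<circ> s k) (?w x')" by simp_all
  qed
qed

text \<open>The descent inside each 2-cycle of neighbours becomes, after composing with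
  \<open>s k\<close>, the ascent required of two fixed points; unmoved elements behave as in
  \<open>fits_mult_up\<close>.\<close>

lemma fits_mult_down:
  assumes z: "z \<in> I" and f: "fits \<pi> z" and swap: "z k = k + 1"
    and \<pi>: "\<pi> \<in> S"
  shows "fits (\<pi> \<circ> s k) (z \<circ> s k)"
proof -
  let ?M = "\<lambda>x. x \<sim> k \<or> x - 1 \<sim> k"
  let ?w = "z \<circ> s k"
  note zz = invol_invol[OF z]
  have swap': "z (k + 1) = k" using zz[of k] swap by simp
  have "\<pi> (k + 1) < \<pi> k" using fitsD(1)[OF f, of k] swap by simp
  then have dn: "\<pi> (x + 1) < \<pi> x" if xk: "x \<sim> k" for x
    using descent_shift[OF \<pi> xk] S_eq_iff[OF \<pi>, of x "x + 1"] by linarith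
  have zk: "z x = x + 1" "z (x + 1) = x" if xk: "x \<sim> k" for x
  proof -
    obtain m where m: "x = k + m * int n" using xk by (rule cgE)
    then show "z x = x + 1" "z (x + 1) = x"
      using S_shift[OF invol_S[OF z], of k m] S_shift[OF invol_S[OF z], of "k + 1" m] swap swap'
      by (simp_all add: algebra_simps)
  qed
  have zM: "z x = s k x" if xM: "?M x" for x
  proof (cases "x \<sim> k")
    case False
    then show ?thesis using xM zk[of "x - 1"] simple_right[of "x - 1" k] by simp
  qed (simp add: zk simple_left)
  have sM: "?M (s k x)" if "?M x" for x
    using that by (rule_tac x = x and k = k in simple_cases) auto
  have wM: "?w x = x" if "?M x" for x using zM[OF sM[OF that]] by simp
  have s_unmoved: "s k x = x" if "\<not> ?M x" for x
    using that by (rule_tac x = x and k = k in simple_cases) auto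
  have w_unmoved: "?w x = z x" if "\<not> ?M x" for x using s_unmoved[OF that] by simp
  have z_unmoved: "\<not> ?M (z x)" if "\<not> ?M x" for x
    using zM[of "z x"] sM[of "z x"] zz[of x] that by metis
  note less = simple_less_unmoved[of _ k]
  show ?thesis
    unfolding fits_def
  proof (intro conjI allI impI)
    fix x assume a: "x < ?w x"
    then have False: "\<not> ?M x" using wM by auto
    show "(\<pi> \<circ> s k) (?w x) < (\<pi> \<circ> s k) x"
      using a fitsD(1)[OF f, of x] s_unmoved[OF False] s_unmoved[OF z_unmoved[OF False]] w_unmoved[OF False] by simp
  next
    fix x e assume a: "x < e \<and> e < ?w x"
    then have x: "\<not> ?M x" using wM[of x] by auto
    then have "x < s k e" "s k e < z x"
      using a less[of x e] less[of "z x" e] z_unmoved[OF x] w_unmoved[OF x] by auto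
    then show "\<not> ((\<pi> \<circ> s k) (?w x) < (\<pi> \<circ> s k) e \<and> (\<pi> \<circ> s k) e < (\<pi> \<circ> s k) x)"
      using fitsD(2)[OF f, of x "s k e"] s_unmoved[OF x] w_unmoved[OF x] s_unmoved[OF z_unmoved[OF x]] by simp
  next
    fix x x' assume a: "x < x' \<and> ?w x < ?w x'"
    have "\<pi> (s k x) < \<pi> (s k x') \<and> \<pi> (s k x) < \<pi> (s k (?w x'))"
    proof (cases "?M x")
      case x: True
      show ?thesis
      proof (cases "?M x'")
        case x': True
        show ?thesis
        proof (cases "x \<sim> k \<and> x' = x + 1")
          case True
          then show ?thesis using dn[of x] wM[OF x'] by (simp add: simple_left simple_right)
        next
          case False
          then have "s k x < s k x'" using a simple_less by blast
          then show ?thesis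
            using fitsD(3)[OF f, of "s k x" "s k x'"] a wM[OF x] wM[OF x'] by simp
        qed
      next
        case x': False
        have "s k x < x'" "x < z x'"
          using less[of x' x] a x' wM[OF x] w_unmoved[OF x'] by auto
        then show ?thesis
          using fitsD(3)[OF f, of "s k x" x'] wM[OF x] s_unmoved[OF x'] w_unmoved[OF x']
            s_unmoved[OF z_unmoved[OF x']] by simp
      qed
    next
      case x: False
      show ?thesis
      proof (cases "?M x'")
        case x': True
        have "x < s k x'" "z x < x'"
          using less[of x x'] less[of "z x" x'] z_unmoved[OF x] a x wM[OF x'] w_unmoved[OF x] by auto
        then show ?thesis
          using fitsD(3)[OF f, of x "s k x'"] a s_unmoved[OF x] wM[OF x'] by simp
      next
        case x': False
        show ?thesis
          using fitsD(3)[OF f, of x x'] a w_unmoved[OF x] w_unmoved[OF x']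
            s_unmoved[OF x] s_unmoved[OF x'] s_unmoved[OF z_unmoved[OF x']] by simp
      qed
    qed
    then show "(\<pi> \<circ> s k) x < (\<pi> \<circ> s k) x'" "(\<pi> \<circ> s k) x < (\<pi> \<circ> s k) (?w x')" by simp_all
  qed
qed

lemma fits_descent:
  assumes "z \<in> I" "\<pi> \<in> S" "fits \<pi> z" "\<pi> (k + 1) < \<pi> k"
  shows "z (k + 1) < z k"
  using fitsD(3)[OF assms(3), of k "k + 1"] assms(4) invol_eq_iff[OF assms(1), of k "k + 1"] by linarith

text \<open>Undoing the conjugation may leave the cycles through k and k + 1 non-nested, and the
  third clause then asks for four comparisons between their values. These are \<open>dn\<close>,
  \<open>b\<close>, \<open>b'\<close> and \<open>c\<close>, drawn from the descent of \<pi> and the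
  clauses of \<open>fits\<close> before the step.\<close>

lemma fits_conj_down:
  assumes z: "z \<in> I" and \<pi>: "\<pi> \<in> S" and f: "fits \<pi> z" and desc: "\<pi> (k + 1) < \<pi> k"
    and ns: "z k \<noteq> k + 1"
  shows "fits (\<pi> \<circ> s k) (s k \<circ> z \<circ> s k)"
proof -
  note zz = invol_invol[OF z]
  have dn: "\<pi> (x + 1) < \<pi> x" if "x \<sim> k" for x
    using descent_shift[OF \<pi> that] S_eq_iff[OF \<pi>, of x "x + 1"] desc by linarith
  have zdn: "z (x + 1) < z x" if "x \<sim> k" for x
    using fits_descent[OF z \<pi> f dn[OF that]] .
  have ns': "\<not> (x \<sim> k \<and> z (x + 1) \<sim> k \<and> z x = z (x + 1) + 1)" for x
    using adjacent_down_invol[OF z] ns by blast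
  have ne: "z x \<noteq> x + 1" if "x \<sim> k" for x
    using ns'[of x] that zz[of x] by auto
  have b: "\<pi> (x + 1) < \<pi> (z x)" if xk: "x \<sim> k" for x
  proof -
    consider "z x \<le> x" | "x + 1 < z x" using ne[OF xk] by linarith
    then show ?thesis
    proof cases
      case 1
      then have "\<pi> x \<le> \<pi> (z x)" using fitsD(1)[OF f, of "z x"] zz[of x] by (cases "z x = x") auto
      then show ?thesis using dn[OF xk] by simp
    next
      case 2
      then have "\<pi> (x + 1) \<noteq> \<pi> (z x)" using \<pi> by simp
      then show ?thesis using fitsD(2)[OF f, of x "x + 1"] 2 dn[OF xk] by linarith
    qed
  qed
  have b': "\<pi> (z (x + 1)) < \<pi> x" if xk: "x \<sim> k" for x
  proof -
    have "z (x + 1) \<noteq> x" using ne[OF xk] zz[of "x + 1"] by auto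
    then consider "x + 1 \<le> z (x + 1)" | "z (x + 1) < x" by linarith
    then show ?thesis
    proof cases
      case 1
      then have "\<pi> (z (x + 1)) \<le> \<pi> (x + 1)"
        using fitsD(1)[OF f, of "x + 1"] by (cases "z (x + 1) = x + 1") auto
      then show ?thesis using dn[OF xk] by simp
    next
      case 2
      then have "\<pi> (z (x + 1)) \<noteq> \<pi> x" using \<pi> by simp
      then show ?thesis using fitsD(2)[OF f, of "z (x + 1)" x] 2 zz[of "x + 1"] dn[OF xk] by fastforce
    qed
  qed
  have c: "\<pi> (z (x + 1)) < \<pi> (z x)" if xk: "x \<sim> k" for x
  proof -
    have "z (x + 1) \<noteq> x" using ne[OF xk] zz[of "x + 1"] by auto
    then consider "x + 1 \<le> z (x + 1)" | "z (x + 1) < x" "z x \<le> x" | "z (x + 1) < x" "x + 1 < z x"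
      using ne[OF xk] by linarith
    then show ?thesis
    proof cases
      case 1
      then have "\<pi> (z (x + 1)) \<le> \<pi> (x + 1)"
        using fitsD(1)[OF f, of "x + 1"] by (cases "z (x + 1) = x + 1") auto
      then show ?thesis using b[OF xk] by simp
    next
      case 2
      then have "\<pi> x \<le> \<pi> (z x)" using fitsD(1)[OF f, of "z x"] zz[of x] by (cases "z x = x") auto
      then show ?thesis using b'[OF xk] by simp
    next
      case 3
      then show ?thesis using fitsD(3)[OF f, of "z (x + 1)" x] zz by simp
    qed
  qed
  show ?thesis
    unfolding fits_conj_iff
  proof (intro conjI allI impI)
    fix u assume "s k u < s k (z u)"
    then have "u < z u" using ns'[of "z u"] zz[of u] unfolding simple_less_iff by auto
    then show "\<pi> (z u) < \<pi> u" by (rule fitsD[OF f])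
  next
    fix u e assume a: "s k u < s k e \<and> s k e < s k (z u)"
    consider "u < e" "e < z u" | "e \<sim> k" "u = e + 1" | "z u \<sim> k" "e = z u + 1"
      using a unfolding simple_less_iff by blast
    then show "\<not> (\<pi> (z u) < \<pi> e \<and> \<pi> e < \<pi> u)"
    proof cases
      case 1
      then show ?thesis using fitsD(2)[OF f] by blast
    next
      case 2
      then show ?thesis using dn[of e] by simp
    next
      case 3
      then show ?thesis using dn[of "z u"] by simp
    qed
  next
    fix u u' assume a: "s k u < s k u' \<and> s k (z u) < s k (z u')"
    consider "u < u'" "z u < z u'" | "u' \<sim> k" "u = u' + 1" | "z u' \<sim> k" "z u = z u' + 1"
      using a unfolding simple_less_iff by blast
    then have "\<pi> u < \<pi> u' \<and> \<pi> u < \<pi> (z u')"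
    proof cases
      case 1
      then show ?thesis using fitsD(3)[OF f] by blast
    next
      case 2
      then show ?thesis using dn[of u'] b[of u'] by simp
    next
      case 3
      then show ?thesis using c[of "z u'"] b'[of "z u'"] zz[of u] zz[of u'] by metis
    qed
    then show "\<pi> u < \<pi> u'" "\<pi> u < \<pi> (z u')" by blast+
  qed
qed

text \<open>After the right step, the left step is idle only if left and right multiplication by
  \<open>s k\<close> agree, which for an involution at an ascent means that k and k + 1 are
  fixed.\<close>

lemma hecke_conj_ascent:
  assumes z: "z \<in> I" and asc: "z k < z (k + 1)"
  shows "lstep k (rstep k z) = (if z k = k \<and> z (k + 1) = k + 1 then z \<circ> s k else s k \<circ> z \<circ> s k)"
proof -
  have inv: "inv (z \<circ> s k) = s k \<circ> z" using invol_S[OF z] invol_inv[OF z] by simp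
  show ?thesis
  proof (cases "z k = k \<and> z (k + 1) = k + 1")
    case True
    then show ?thesis using asc
      by (simp add: rstep_def lstep_def inv simple_left simple_right del: comp_apply S_inv_comp) (simp add: simple_left simple_right)
  next
    case False
    then have "s k (z k) < s k (z (k + 1))"
      using simple_less[OF asc, of k] adjacent_up_invol[OF z, of k k] by auto
    then show ?thesis using asc False unfolding rstep_def lstep_def by (simp only: if_True inv comp_apply comp_assoc if_False)
  qed
qed

lemma hecke_conj_descent:
  assumes "z \<in> I" "z (k + 1) < z k"
  shows "lstep k (rstep k z) = z"
  using assms by (simp add: rstep_def lstep_def invol_inv)

section \<open>Rank, and minimal length of a square root\<close>

definition supp :: "(int \<Rightarrow> int) \<Rightarrow> int" where
  "supp z = (\<Sum>x = 1..int n. of_bool (z x \<noteq> x))"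

text \<open>A step \<open>z \<mapsto> s k \<circ> z \<circ> s k\<close> upwards adds 2 to the length, a step \<open>z \<mapsto> z \<circ> s k\<close> creating a
  2-cycle adds 1 to the length and 2 to \<open>supp\<close>; both add 4 to \<open>rank\<close>.\<close>

definition rank :: "(int \<Rightarrow> int) \<Rightarrow> int" where
  "rank z = 2 * int (len z) + supp z"

lemma sum_residue_class: "(\<Sum>x = 1..int n. of_bool (x \<sim> k)) = (1 :: int)"
proof -
  define r where "r = (k - 1) mod int n + 1"
  have r: "r \<in> {1..int n}" "r \<sim> k" unfolding r_def by (rule residue_mem)+
  have "x = r" if "x \<in> {1..int n}" "x \<sim> k" for x
  proof -
    have "x \<sim> r" using that(2) r(2) cong_sym cong_trans by blast
    moreover have "\<bar>x - r\<bar> < int n" using that(1) r(1) by auto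
    ultimately show ?thesis
      by (metis cong_iff_dvd_diff dvd_imp_le_int eq_iff_diff_eq_0 abs_of_nat linorder_not_le)
  qed
  then have "{x \<in> {1..int n}. x \<sim> k} = {r}" using r by blast
  moreover have "(\<Sum>x = 1..int n. of_bool (x \<sim> k)) = int (card {x \<in> {1..int n}. x \<sim> k})"
    by (simp add: of_bool_def sum.If_cases Int_def)
  ultimately show ?thesis by simp
qed

lemma supp_conj:
  assumes "z \<in> S"
  shows "supp (s k \<circ> z \<circ> s k) = supp z"
proof -
  have per: "\<sigma> (x + int n) = \<sigma> x + int n" if "\<sigma> \<in> S" for \<sigma> x using that by (simp add: mem_S_iff)
  have "supp (s k \<circ> z \<circ> s k) = (\<Sum>x = 1..int n. of_bool (z (s k x) \<noteq> s k x))"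
    unfolding supp_def
  proof (intro sum.cong refl)
    fix x
    have "s k (z (s k x)) \<noteq> s k (s k x) \<longleftrightarrow> z (s k x) \<noteq> s k x" by (simp only: simple_eq_iff)
    then show "of_bool ((s k \<circ> z \<circ> s k) x \<noteq> x) = (of_bool (z (s k x) \<noteq> s k x) :: int)" by simp
  qed
  also have "\<dots> = supp z"
    unfolding supp_def
    by (rule sum_periodic_reindex[of "s k" "\<lambda>x. of_bool (z x \<noteq> x)"]) (simp_all add: per assms S_bij)
  finally show ?thesis .
qed

lemma supp_mult:
  assumes "z \<in> S" "z k = k" "z (k + 1) = k + 1"
  shows "supp (z \<circ> s k) = supp z + 2"
proof -
  note c = comp_simple_cases[OF assms]
  have "of_bool ((z \<circ> s k) x \<noteq> x) = (of_bool (z x \<noteq> x) + of_bool (x \<sim> k) + of_bool (x \<sim> k + 1) :: int)" for x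
  proof -
    have eq: "x \<sim> k + 1 \<longleftrightarrow> x - 1 \<sim> k" using cg_succ_iff[of "x - 1" k] by simp
    have "\<not> (x \<sim> k \<and> x \<sim> k + 1)" using not_cg_succ(1)[of k] cong_sym cong_trans by blast
    then show ?thesis
      using c(1)[of x] c(2)[of x] c(3)[of x] c(4)[of x] c(5)[of x] eq
      by (cases "x \<sim> k"; cases "x - 1 \<sim> k") (simp_all del: comp_apply)
  qed
  then show ?thesis
    using sum_residue_class[of k] sum_residue_class[of "k + 1"]
    by (simp add: supp_def sum.distrib del: comp_apply)
qed

lemma invol_conj: "z \<in> I \<Longrightarrow> s k \<circ> z \<circ> s k \<in> I"
  by (simp add: invol_iff)

lemma invol_mult:
  assumes z: "z \<in> I" and a: "z k = k \<and> z (k + 1) = k + 1 \<or> z k = k + 1"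
  shows "z \<circ> s k \<in> I"
proof -
  have "adjacent_up z k k \<or> adjacent_down z k k"
    using a invol_invol[OF z, of k] by (auto simp: adjacent_up_def adjacent_down_def)
  then have "s k \<circ> z = z \<circ> s k" by (rule simple_comp_adjacent[OF invol_S[OF z]])
  then have "s k (z x) = z (s k x)" for x by (metis comp_apply)
  then show ?thesis using z by (simp add: invol_iff)
qed

lemma hecke_conj_up:
  assumes z: "z \<in> I" and asc: "z k < z (k + 1)"
  defines "w \<equiv> lstep k (rstep k z)"
  shows "w \<in> I" "rank w = rank z + 4"
    and "\<And>\<pi>. \<pi> \<in> S \<Longrightarrow> fits \<pi> z \<Longrightarrow> \<pi> k < \<pi> (k + 1)"
    and "\<And>\<pi>. \<pi> \<in> S \<Longrightarrow> fits \<pi> z \<Longrightarrow> fits (\<pi> \<circ> s k) w"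
proof -
  note zS = invol_S[OF z]
  have len1: "len (z \<circ> s k) = len z + 1" using len_ascent[OF zS asc] .
  show "w \<in> I" "rank w = rank z + 4" "\<And>\<pi>. \<pi> \<in> S \<Longrightarrow> fits \<pi> z \<Longrightarrow> fits (\<pi> \<circ> s k) w"
  proof (atomize (full), cases "z k = k \<and> z (k + 1) = k + 1")
    case True
    then have "w = z \<circ> s k" using hecke_conj_ascent[OF z asc] by (simp add: w_def)
    then show "w \<in> I \<and> rank w = rank z + 4 \<and> (\<forall>\<pi>. \<pi> \<in> S \<longrightarrow> fits \<pi> z \<longrightarrow> fits (\<pi> \<circ> s k) w)"
      using invol_mult[OF z, of k] True fits_mult_up[OF z] len1 supp_mult[OF zS, of k]
      by (auto simp: rank_def simp del: comp_apply)
  next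
    case False
    then have w: "w = s k \<circ> z \<circ> s k" using hecke_conj_ascent[OF z asc] by (simp only: w_def if_False)
    have "s k (z k) < s k (z (k + 1))"
      using simple_less[OF asc, of k] adjacent_up_invol[OF z, of k k] False by auto
    then have "inv (z \<circ> s k) k < inv (z \<circ> s k) (k + 1)" using zS invol_inv[OF z] by simp
    then have "len w = len z + 2"
      using len_left_ascent[of "z \<circ> s k" k] len1 zS unfolding w by (simp add: comp_assoc del: comp_apply)
    then show "w \<in> I \<and> rank w = rank z + 4 \<and> (\<forall>\<pi>. \<pi> \<in> S \<longrightarrow> fits \<pi> z \<longrightarrow> fits (\<pi> \<circ> s k) w)"
      using invol_conj[OF z, of k] fits_conj_up[OF z _ asc False] supp_conj[OF zS, of k]
      unfolding w rank_def by (auto simp del: comp_apply)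
  qed
  show "\<And>\<pi>. \<pi> \<in> S \<Longrightarrow> fits \<pi> z \<Longrightarrow> \<pi> k < \<pi> (k + 1)"
    using fitsD(3)[of _ z k "k + 1"] asc by simp
qed

text \<open>Inverts the two branches of \<open>hecke_conj_ascent\<close>, told apart by whether
  \<open>z\<close> swaps k and k + 1. In the second branch the conjugate cannot fix both points,
  since \<open>z\<close> would then fix them too and have no descent there.\<close>

lemma hecke_conj_down:
  assumes z: "z \<in> I" and desc: "z (k + 1) < z k"
  obtains z' where "z' \<in> I" "z' k < z' (k + 1)" "lstep k (rstep k z') = z"
    "\<And>\<pi>. \<pi> \<in> S \<Longrightarrow> fits \<pi> z \<Longrightarrow> \<pi> (k + 1) < \<pi> k \<Longrightarrow> fits (\<pi> \<circ> s k) z'"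
proof (cases "z k = k + 1")
  case True
  have "z (k + 1) = k" using invol_invol[OF z, of k] True by simp
  then have k: "(z \<circ> s k) k = k" "(z \<circ> s k) (k + 1) = k + 1"
    using True by (simp_all add: simple_left simple_right)
  have "z \<circ> s k \<in> I" by (rule invol_mult[OF z]) (simp add: True)
  moreover from this have "lstep k (rstep k (z \<circ> s k)) = z"
    using hecke_conj_ascent[of "z \<circ> s k" k] k by (simp del: comp_apply)
  ultimately show ?thesis
    using that[of "z \<circ> s k"] k fits_mult_down[OF z _ True] by simp
next
  case False
  let ?z = "s k \<circ> z \<circ> s k"
  have "s k (z (k + 1)) < s k (z k)"
    using simple_less[OF desc, of k] adjacent_down_invol[OF z, of k k] False by auto
  then have asc: "?z k < ?z (k + 1)" by (simp add: simple_left simple_right)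
  have "\<not> (?z k = k \<and> ?z (k + 1) = k + 1)"
  proof
    assume "?z k = k \<and> ?z (k + 1) = k + 1"
    then have "s k (z (k + 1)) = k" "s k (z k) = k + 1" by (simp_all add: simple_left simple_right)
    then have "z (k + 1) = s k k" "z k = s k (k + 1)" by (metis simple_involutive(1))+
    then show False using desc by (simp add: simple_left simple_right)
  qed
  then have "lstep k (rstep k ?z) = s k \<circ> ?z \<circ> s k"
    using hecke_conj_ascent[OF invol_conj[OF z] asc] by (simp only: if_False)
  also have "\<dots> = z" by (auto simp: fun_eq_iff)
  finally show ?thesis
    using that[of ?z] invol_conj[OF z] asc fits_conj_down[OF z _ _ _ False] by blast
qed

lemma id_I [simp]: "id \<in> I"
  by (simp add: invol_iff)

lemma rank_id [simp]: "rank id = 0"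
  by (simp add: rank_def supp_def)

lemma fits_id_iff:
  assumes "z \<in> I"
  shows "fits id z \<longleftrightarrow> z = id"
proof
  assume f: "fits id z"
  have le: "z x \<le> x" for x using fitsD(1)[OF f, of x] by force
  have "z x = x" for x using le[of x] le[of "z x"] invol_invol[OF assms] by simp
  then show "z = id" by auto
qed (simp add: fits_def)

text \<open>A descent of \<pi> is a descent of \<open>z\<close> (\<open>fits_descent\<close>), so
  \<pi> can be taken apart letter by letter with \<open>z\<close> following; every letter costs rank
  4.\<close>

lemma square_of_fits:
  "\<pi> \<in> S \<Longrightarrow> z \<in> I \<Longrightarrow> fits \<pi> z \<Longrightarrow> square \<pi> = z \<and> rank z = 4 * int (len \<pi>)"
proof (induction "len \<pi>" arbitrary: \<pi> z rule: less_induct)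
  case less
  note \<pi> = less.prems(1) and z = less.prems(2) and f = less.prems(3)
  show ?case
  proof (cases "\<pi> = id")
    case True
    then show ?thesis using f fits_id_iff[OF z] by simp
  next
    case False
    then obtain k where k: "\<pi> (k + 1) < \<pi> k" using descent_exists \<pi> by metis
    obtain z' where z': "z' \<in> I" "z' k < z' (k + 1)" "lstep k (rstep k z') = z" "fits (\<pi> \<circ> s k) z'"
      using hecke_conj_down[OF z fits_descent[OF z \<pi> f k]] \<pi> f k by metis
    have l: "len \<pi> = len (\<pi> \<circ> s k) + 1" using len_descent[OF \<pi> k] .
    have "square (\<pi> \<circ> s k) = z' \<and> rank z' = 4 * int (len (\<pi> \<circ> s k))"
      using less.hyps[of "\<pi> \<circ> s k" z'] l \<pi> z' by (simp del: comp_apply)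
    moreover have "square (\<pi> \<circ> s k \<circ> s k) = lstep k (rstep k (square (\<pi> \<circ> s k)))"
      using \<pi> k by (intro square_ascent) (simp_all add: simple_left simple_right)
    ultimately show ?thesis
      using hecke_conj_up(2)[OF z'(1,2)] z'(3) l by simp
  qed
qed

text \<open>Along a reduced word each letter raises the length by 1 and conjugates the square, which
  gains rank 4 at an ascent and is unchanged at a descent. Equality therefore means that no letter
  was wasted, and then \<open>fits\<close> is carried along by \<open>hecke_conj_up\<close>.\<close>

lemma square_rank_le:
  "\<pi> \<in> S \<Longrightarrow> square \<pi> \<in> I \<and> rank (square \<pi>) \<le> 4 * int (len \<pi>) \<and>
     (rank (square \<pi>) = 4 * int (len \<pi>) \<longrightarrow> fits \<pi> (square \<pi>))"
proof (induction "len \<pi>" arbitrary: \<pi> rule: less_induct)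
  case less
  note \<pi> = less.prems
  show ?case
  proof (cases "\<pi> = id")
    case True
    then show ?thesis using fits_id_iff[of id] by simp
  next
    case False
    then obtain k where k: "\<pi> (k + 1) < \<pi> k" using descent_exists \<pi> by metis
    let ?\<pi> = "\<pi> \<circ> s k"
    have l: "len \<pi> = len ?\<pi> + 1" using len_descent[OF \<pi> k] .
    have IH: "square ?\<pi> \<in> I" "rank (square ?\<pi>) \<le> 4 * int (len ?\<pi>)"
      "rank (square ?\<pi>) = 4 * int (len ?\<pi>) \<Longrightarrow> fits ?\<pi> (square ?\<pi>)"
      using less.hyps[of ?\<pi>] l \<pi> by (simp_all del: comp_apply)
    have "square (?\<pi> \<circ> s k) = lstep k (rstep k (square ?\<pi>))"
      using \<pi> k by (intro square_ascent) (simp_all add: simple_left simple_right)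
    then have sq: "square \<pi> = lstep k (rstep k (square ?\<pi>))" by simp
    consider "square ?\<pi> k < square ?\<pi> (k + 1)" | "square ?\<pi> (k + 1) < square ?\<pi> k"
      using ascent_or_descent[OF invol_S[OF IH(1)], of k] by blast
    then show ?thesis
    proof cases
      case 1
      note up = hecke_conj_up[OF IH(1) 1, folded sq]
      show ?thesis
        using up(1,2) up(4)[of ?\<pi>] IH(2,3) l \<pi> by (auto simp del: comp_apply)
    next
      case 2
      then have "square \<pi> = square ?\<pi>" using hecke_conj_descent[OF IH(1)] sq by simp
      then show ?thesis using IH l by simp
    qed
  qed
qed

lemma supp_nonneg: "0 \<le> supp z"
  unfolding supp_def by (intro sum_nonneg) simp

text \<open>The bound of \<open>square_rank_le\<close> identifies the shortest permutations only if
  it is attained. The induction takes descents from \<open>z\<close> itself, as no permutation is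
  given yet.\<close>

lemma fits_exists: "z \<in> I \<Longrightarrow> \<exists>\<pi>\<in>S. fits \<pi> z"
proof (induction "nat (rank z)" arbitrary: z rule: less_induct)
  case less
  note z = less.prems
  show ?case
  proof (cases "z = id")
    case True
    then show ?thesis using fits_id_iff[OF z] by (intro bexI[of _ id]) auto
  next
    case False
    then obtain k where k: "z (k + 1) < z k" using descent_exists invol_S[OF z] by metis
    obtain z' where z': "z' \<in> I" "z' k < z' (k + 1)" "lstep k (rstep k z') = z"
      using hecke_conj_down[OF z k] by metis
    note up = hecke_conj_up[OF z'(1,2), unfolded z'(3)]
    have "0 \<le> rank z'" using supp_nonneg[of z'] by (simp add: rank_def)
    then obtain \<pi> where "\<pi> \<in> S" "fits \<pi> z'" using less.hyps[OF _ z'(1)] up(2) by auto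
    then show ?thesis using up(4)[of \<pi>] by (intro bexI[of _ "\<pi> \<circ> s k"]) auto
  qed
qed

lemma atoms_iff_fits:
  assumes y: "y \<in> I"
  shows "\<pi> \<in> atoms n y \<longleftrightarrow> \<pi> \<in> S \<and> fits \<pi> y"
proof
  assume "\<pi> \<in> atoms n y"
  then have \<pi>: "\<pi> \<in> S" "square \<pi> = y"
    and min: "\<And>\<sigma>. \<sigma> \<in> S \<Longrightarrow> square \<sigma> = y \<Longrightarrow> len \<pi> \<le> len \<sigma>"
    by (force simp: atoms_def is_arg_min_def square_def not_less)+
  obtain \<sigma> where \<sigma>: "\<sigma> \<in> S" "fits \<sigma> y" using fits_exists[OF y] by blast
  then have "len \<pi> \<le> len \<sigma>" "rank y = 4 * int (len \<sigma>)"
    using square_of_fits[OF \<sigma>(1) y \<sigma>(2)] min[of \<sigma>] by auto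
  then show "\<pi> \<in> S \<and> fits \<pi> y" using square_rank_le[OF \<pi>(1)] \<pi> by simp
next
  assume \<pi>: "\<pi> \<in> S \<and> fits \<pi> y"
  then have sq: "square \<pi> = y" "rank y = 4 * int (len \<pi>)" using square_of_fits y by blast+
  then have "len \<pi> \<le> len \<sigma>" if "\<sigma> \<in> S" "square \<sigma> = y" for \<sigma>
    using square_rank_le[OF that(1)] that(2) by simp
  then show "\<pi> \<in> atoms n y"
    using \<pi> sq(1) by (force simp: atoms_def is_arg_min_def square_def not_less)
qed

section \<open>Coverings\<close>

lemma S_eqI:
  assumes "f \<in> S" "g \<in> S" "f i = g i" "f j = g j" "\<And>k. \<not> k \<sim> i \<Longrightarrow> \<not> k \<sim> j \<Longrightarrow> f k = g k"
  shows "f = g"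
proof
  fix k
  show "f k = g k"
  proof (cases "k \<sim> i \<or> k \<sim> j")
    case True
    then obtain m where "k = i + m * int n \<or> k = j + m * int n" by (auto elim!: cgE)
    then show ?thesis using assms(1-4) S_shift by metis
  next
    case False
    then show ?thesis using assms(5) by blast
  qed
qed

lemma trans_shift:
  assumes "\<not> i \<sim> j"
  shows "t i j (i + m * int n) = j + m * int n" "t i j (j + m * int n) = i + m * int n"
  using assms by (simp_all add: S_shift trans_left trans_right)

text \<open>Factors the reflection through an intermediate e in such a way that, when the value at e
  is intermediate too, each of the three factors raises the length.\<close>

lemma trans_braid:
  assumes "\<not> i \<sim> j" "\<not> e \<sim> i" "\<not> e \<sim> j"
  shows "t i e \<circ> t i j \<circ> t e j = t i j"
proof -
  have "t i j \<circ> t e j = t (t i j e) (t i j j) \<circ> t i j" by (rule trans_conj) simp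
  also have "\<dots> = t i e \<circ> t i j" using assms by (simp add: trans_right trans_other trans_commute)
  finally have "t i e \<circ> (t i j \<circ> t e j) = t i e \<circ> t i e \<circ> t i j" by (simp add: comp_assoc)
  then show ?thesis by (simp add: comp_assoc) (auto simp: fun_eq_iff)
qed

text \<open>For an element \<open>e\<close> congruent to \<open>i\<close> or \<open>j\<close> there is no braid relation as above; below, \<open>R\<close> is
  chosen such that each of the three factors raises the length.\<close>

lemma trans_dihedral:
  assumes ij: "\<not> i \<sim> j" and M: "M = m * int n" and R: "R = r * int n"
  shows "t i j \<circ> t i (j + R) \<circ> t i (j + R + M) = t i (j + M)"
proof (rule S_eqI[of _ _ i j])
  have c: "\<not> i \<sim> j + R" "\<not> i \<sim> j + M" "\<not> i \<sim> j + R + M" using ij by (simp_all add: M R)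
  \<comment> \<open>On the classes of i and j, the product of three reflections
    \<open>t i (j + _ * int n)\<close> with multiples a, b, c is the one with multiple a - b + c;
    here 0 - r + (r + m) = m.\<close>
  have sh: "t i (j + a * int n) (j + b * int n) = i + (b - a) * int n" for a b
    using trans_shift(2)[of i "j + a * int n" "b - a"] ij by (simp add: algebra_simps)
  have sh': "t i (j + a * int n) (i + b * int n) = j + (a + b) * int n" for a b
    using trans_shift(1)[of i "j + a * int n" b] ij by (simp add: algebra_simps)
  have RM: "j + R + M = j + (r + m) * int n" by (simp add: M R algebra_simps)
  show "(t i j \<circ> t i (j + R) \<circ> t i (j + R + M)) i = t i (j + M) i"
    using sh'[of "r + m" 0] sh[of r "r + m"] sh'[of 0 m] sh'[of m 0] unfolding RM unfolding M R by simp
  show "(t i j \<circ> t i (j + R) \<circ> t i (j + R + M)) j = t i (j + M) j"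
    using sh[of "r + m" 0] sh'[of r "- r - m"] sh[of 0 "- m"] sh[of m 0] unfolding RM unfolding M R by simp
  show "(t i j \<circ> t i (j + R) \<circ> t i (j + R + M)) k = t i (j + M) k" if "\<not> k \<sim> i" "\<not> k \<sim> j" for k
    using that by (simp add: trans_other M R)
qed simp_all

lemma len_trans_between:
  assumes \<pi>: "\<pi> \<in> S" and ij: "\<not> i \<sim> j" and e: "i < e" "e < j" "\<pi> i < \<pi> e" "\<pi> e < \<pi> j"
  shows "len \<pi> + 3 \<le> len (\<pi> \<circ> t i j)"
proof -
  have ji: "\<not> j \<sim> i" using ij cong_sym by blast
  show ?thesis
  proof (cases "e \<sim> i \<or> e \<sim> j")
    case False
    then have ne: "\<not> e \<sim> i" "\<not> e \<sim> j" "\<not> i \<sim> e" "\<not> j \<sim> e" using cong_sym by blast+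
    define \<rho> where "\<rho> = \<pi> \<circ> t i e"
    define \<upsilon> where "\<upsilon> = \<rho> \<circ> t i j"
    have v: "\<rho> i = \<pi> e" "\<rho> e = \<pi> i" "\<rho> j = \<pi> j" "\<upsilon> e = \<pi> i" "\<upsilon> j = \<pi> e"
      using ij ji ne by (simp_all add: \<upsilon>_def \<rho>_def trans_left trans_right trans_other)
    have "len \<pi> < len \<rho>" unfolding \<rho>_def using e ne by (intro len_trans_greater[OF \<pi>]) auto
    moreover have "len \<rho> < len \<upsilon>"
      unfolding \<upsilon>_def using e ij v \<pi> by (intro len_trans_greater) (simp_all add: \<rho>_def del: comp_apply)
    moreover have "len \<upsilon> < len (\<upsilon> \<circ> t e j)"
      using e ne v \<pi> by (intro len_trans_greater) (simp_all add: \<rho>_def \<upsilon>_def del: comp_apply)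
    moreover have "\<upsilon> \<circ> t e j = \<pi> \<circ> t i j"
      using trans_braid[OF ij ne(1,2)] by (simp add: \<upsilon>_def \<rho>_def comp_assoc)
    ultimately show ?thesis by simp
  next
    case True
    \<comment> \<open>An intermediate e in the class of i or of j yields a translation to the right
      that keeps i below j both in position and in value.\<close>
    have "\<exists>m>0. i + m * int n < j \<and> \<pi> i + m * int n < \<pi> j"
      using True
    proof
      assume "e \<sim> i"
      then obtain m where m: "e = i + m * int n" by (rule cgE)
      moreover have "m > 0" using m e(1) by (simp add: zero_less_mult_iff)
      ultimately show ?thesis using e S_shift[OF \<pi>, of i m] by (intro exI[of _ m]) auto
    next
      assume "e \<sim> j"
      then obtain m where m: "e = j + m * int n" by (rule cgE)
      moreover have "- m > 0" using m e(2) by (simp add: mult_less_0_iff)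
      ultimately show ?thesis using e S_shift[OF \<pi>, of j m] by (intro exI[of _ "- m"]) auto
    qed
    then obtain m where m: "m > 0" "i + m * int n < j" "\<pi> i + m * int n < \<pi> j" by blast
    define M where "M = m * int n"
    define j' where "j' = j - M"
    have j': "j = j' + M" "\<pi> j = \<pi> j' + M" "i < j'" "\<pi> i < \<pi> j'"
      using S_shift[OF \<pi>, of j' m] m by (simp_all add: j'_def M_def)
    have ij': "\<not> i \<sim> j'" using ij j'(1) by (simp add: M_def)
    \<comment> \<open>The second factor raises the length if d < R, the third if R < d + M.
      \<open>R\<close> is the least multiple of n above d; since d is no multiple of n and M is at
      least n, both hold.\<close>
    define d where "d = \<pi> j' - \<pi> i"
    define r where "r = d div int n + 1"
    define R where "R = r * int n"
    have "d mod int n \<noteq> 0"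
      using ij' \<pi> by (metis S_cg_iff cong_iff_dvd_diff cong_sym d_def mod_eq_0_iff_dvd)
    then have dm: "0 < d mod int n" "d mod int n < int n"
      using two_le_n pos_mod_sign[of "int n" d] pos_mod_bound[of "int n" d] by linarith+
    have "R = d - d mod int n + int n"
      using div_mult_mod_eq[of d "int n"] by (simp add: R_def r_def algebra_simps)
    moreover have "int n \<le> M" using m(1) two_le_n by (simp add: M_def)
    ultimately have R: "d < R" "R < d + M" using dm by linarith+
    have R0: "0 < R" using R(1) j'(4) by (simp add: d_def)
    have M0: "0 < M" using \<open>int n \<le> M\<close> two_le_n by simp
    define \<rho> where "\<rho> = \<pi> \<circ> t i j'"
    define \<upsilon> where "\<upsilon> = \<rho> \<circ> t i (j' + R)"
    have c: "\<not> i \<sim> j' + R" "\<not> i \<sim> j' + R + M" using ij' by (simp_all add: R_def M_def)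
    have \<rho>: "\<rho> \<in> S" "\<rho> i = \<pi> j'" "\<rho> j' = \<pi> i" using \<pi> ij' by (simp_all add: \<rho>_def trans_left trans_right)
    have \<rho>R: "\<rho> (j' + R) = \<pi> i + R" using S_shift[OF \<rho>(1), of j' r] \<rho>(3) by (simp add: R_def)
    have \<upsilon>: "\<upsilon> \<in> S" "\<upsilon> i = \<pi> i + R" "\<upsilon> (j' + R) = \<pi> j'"
      using \<rho> \<rho>R c by (simp_all add: \<upsilon>_def trans_left trans_right)
    have \<upsilon>M: "\<upsilon> (j' + R + M) = \<pi> j' + M" using S_shift[OF \<upsilon>(1), of "j' + R" m] \<upsilon>(3) by (simp add: M_def)
    have "len \<pi> < len \<rho>" unfolding \<rho>_def using j' ij' by (intro len_trans_greater[OF \<pi>]) auto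
    moreover have "len \<rho> < len \<upsilon>"
      unfolding \<upsilon>_def using j' c \<rho> \<rho>R R R0 by (intro len_trans_greater) (simp_all add: d_def)
    moreover have "len \<upsilon> < len (\<upsilon> \<circ> t i (j' + R + M))"
      using j' c \<upsilon> \<upsilon>M R R0 M0 by (intro len_trans_greater) (simp_all add: d_def)
    moreover have "\<upsilon> \<circ> t i (j' + R + M) = \<pi> \<circ> t i j"
      using trans_dihedral[OF ij' M_def R_def] j'(1) by (simp add: \<upsilon>_def \<rho>_def comp_assoc)
    ultimately show ?thesis by simp
  qed
qed

lemma covers_trans:
  assumes "\<pi> \<in> S" "i < j" "\<not> i \<sim> j" "aff_covers n \<pi> (\<pi> \<circ> t i j)"
  shows "\<pi> i < \<pi> j" "\<And>e. i < e \<Longrightarrow> e < j \<Longrightarrow> \<not> (\<pi> i < \<pi> e \<and> \<pi> e < \<pi> j)"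
proof -
  have l: "len (\<pi> \<circ> t i j) = len \<pi> + 1" using assms(4) by (simp add: aff_covers_def)
  have "i \<noteq> j" using assms(2) by simp
  then have "\<pi> i \<noteq> \<pi> j" using assms(1) by simp
  then show "\<pi> i < \<pi> j" using len_trans_less[OF assms(1,2)] l by fastforce
  show "\<And>e. i < e \<Longrightarrow> e < j \<Longrightarrow> \<not> (\<pi> i < \<pi> e \<and> \<pi> e < \<pi> j)"
    using len_trans_between[OF assms(1,3)] l by fastforce
qed

end

section \<open>Toggling two nested cycles\<close>

text \<open>The condition \<open>fits\<close> on a pair of cycles \<open>x \<le> u\<close> and \<open>e \<le> f\<close> at which the permutation takes the
  values \<open>a\<close>, \<open>b\<close> and \<open>c\<close>, \<open>d\<close>.\<close>

definition cycle_compat :: "int \<Rightarrow> int \<Rightarrow> int \<Rightarrow> int \<Rightarrow> int \<Rightarrow> int \<Rightarrow> int \<Rightarrow> int \<Rightarrow> bool" where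
  "cycle_compat x u e f a b c d \<longleftrightarrow> (x < u \<longrightarrow> b < a) \<and> (e < f \<longrightarrow> d < c) \<and>
     (x < e \<and> u < f \<longrightarrow> a < d) \<and> (e < x \<and> f < u \<longrightarrow> c < b) \<and>
     (x < e \<and> f < u \<longrightarrow> \<not> (b < c \<and> c < a) \<and> \<not> (b < d \<and> d < a)) \<and>
     (e < x \<and> u < f \<longrightarrow> \<not> (d < a \<and> a < c) \<and> \<not> (d < b \<and> b < c))"

text \<open>One instance of the covering criterion: the point (d, vd) avoids the open rectangle
  spanned by (i, vi) and (j, vj).\<close>

definition gap :: "int \<Rightarrow> int \<Rightarrow> int \<Rightarrow> int \<Rightarrow> int \<Rightarrow> int \<Rightarrow> bool" where
  "gap i j vi vj d vd \<longleftrightarrow> \<not> (i < d \<and> d < j \<and> vi < vd \<and> vd < vj)"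

text \<open>In the next lemmas \<open>i < m\<close> is the outer and \<open>a \<le> b\<close> the inner cycle, \<open>vx\<close> is the value at \<open>x\<close>
  before toggling, and \<open>j\<close> is \<open>b\<close> in the case (A3) and \<open>a\<close> otherwise.\<close>

lemma toggle_A1_other:
  fixes i m a va vi vm e f ve vf :: int
  assumes "i < a \<and> a < m" "vm < vi \<and> vi < va" "e \<le> f"
    "e \<notin> {i,m,a}" "f \<notin> {i,m,a}" "ve \<notin> {vi,vm,va}" "vf \<notin> {vi,vm,va}" "e = f \<longleftrightarrow> ve = vf"
    "cycle_compat i m e f vi vm ve vf" "cycle_compat a a e f va va ve vf"
    "gap i a vi va e ve" "gap i a vi va f vf"
  shows "cycle_compat i m e f va vi ve vf" "cycle_compat a a e f vm vm ve vf"
  using assms unfolding cycle_compat_def gap_def insert_iff empty_iff by (smt (z3))+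

text \<open>Translates of a toggled cycle are toggled too, so values change on both sides of each
  comparison. The hypotheses at \<open>- R\<close> relate the original cycles to the rectangle and
  the outer cycle translated by \<open>R\<close>. A cycle against its own translate needs only
  \<open>R > 0\<close> by symmetry, the mixed pair both signs.\<close>

lemma toggle_A1_shift:
  fixes i m a va vi vm R :: int
  assumes "i < a \<and> a < m" "vm < vi \<and> vi < va"
    "i + R \<notin> {i,m,a}" "m + R \<notin> {i,m,a}" "vi + R \<notin> {vi,vm,va}" "vm + R \<notin> {vi,vm,va}"
    "a + R \<notin> {i,m,a}" "va + R \<notin> {vi,vm,va}"
    "cycle_compat i m (i + R) (m + R) vi vm (vi + R) (vm + R)" "cycle_compat a a (a + R) (a + R) va va (va + R) (va + R)"
    "cycle_compat i m (a + R) (a + R) vi vm (va + R) (va + R)" "cycle_compat i m (a - R) (a - R) vi vm (va - R) (va - R)"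
    "gap i a vi va (i + R) (vi + R)" "gap i a vi va (i - R) (vi - R)"
    "gap i a vi va (m + R) (vm + R)" "gap i a vi va (m - R) (vm - R)"
    "gap i a vi va (a + R) (va + R)" "gap i a vi va (a - R) (va - R)"
  shows "R > 0 \<Longrightarrow> cycle_compat i m (i + R) (m + R) va vi (va + R) (vi + R)"
    "R > 0 \<Longrightarrow> cycle_compat a a (a + R) (a + R) vm vm (vm + R) (vm + R)"
    "cycle_compat i m (a + R) (a + R) va vi (vm + R) (vm + R)"
  using assms unfolding cycle_compat_def gap_def insert_iff empty_iff by (smt (z3))+

lemma toggle_A2_other:
  fixes i m a b va vb vi vm e f ve vf :: int
  assumes "i < a \<and> a < b \<and> b < m" "vb < vm \<and> vm < vi \<and> vi < va" "e \<le> f"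
    "e \<notin> {i,m,a,b}" "f \<notin> {i,m,a,b}" "ve \<notin> {vi,vm,va,vb}" "vf \<notin> {vi,vm,va,vb}" "e = f \<longleftrightarrow> ve = vf"
    "cycle_compat i m e f vi vm ve vf" "cycle_compat a b e f va vb ve vf"
    "gap i a vi va e ve" "gap i a vi va f vf"
  shows "cycle_compat i m e f va vi ve vf" "cycle_compat a b e f vm vb ve vf"
  using assms unfolding cycle_compat_def gap_def insert_iff empty_iff by (smt (z3))+

lemma toggle_A2_shift:
  fixes i m a b va vb vi vm R :: int
  assumes "i < a \<and> a < b \<and> b < m" "vb < vm \<and> vm < vi \<and> vi < va"
    "i + R \<notin> {i,m,a,b}" "m + R \<notin> {i,m,a,b}" "vi + R \<notin> {vi,vm,va,vb}" "vm + R \<notin> {vi,vm,va,vb}"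
    "a + R \<notin> {i,m,a,b}" "va + R \<notin> {vi,vm,va,vb}"
    "b + R \<notin> {i,m,a,b}" "vb + R \<notin> {vi,vm,va,vb}"
    "cycle_compat i m (i + R) (m + R) vi vm (vi + R) (vm + R)" "cycle_compat a b (a + R) (b + R) va vb (va + R) (vb + R)"
    "cycle_compat i m (a + R) (b + R) vi vm (va + R) (vb + R)" "cycle_compat i m (a - R) (b - R) vi vm (va - R) (vb - R)"
    "gap i a vi va (i + R) (vi + R)" "gap i a vi va (i - R) (vi - R)"
    "gap i a vi va (m + R) (vm + R)" "gap i a vi va (m - R) (vm - R)"
    "gap i a vi va (a + R) (va + R)" "gap i a vi va (a - R) (va - R)"
    "gap i a vi va (b + R) (vb + R)" "gap i a vi va (b - R) (vb - R)"
  shows "R > 0 \<Longrightarrow> cycle_compat i m (i + R) (m + R) va vi (va + R) (vi + R)"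
    "R > 0 \<Longrightarrow> cycle_compat a b (a + R) (b + R) vm vb (vm + R) (vb + R)"
    "cycle_compat i m (a + R) (b + R) va vi (vm + R) (vb + R)"
  using assms unfolding cycle_compat_def gap_def insert_iff empty_iff by (smt (z3))+

lemma toggle_A3_other:
  fixes i m a b va vb vi vm e f ve vf :: int
  assumes "i < a \<and> a < b \<and> b < m" "vm < vi \<and> vi < vb \<and> vb < va" "e \<le> f"
    "e \<notin> {i,m,a,b}" "f \<notin> {i,m,a,b}" "ve \<notin> {vi,vm,va,vb}" "vf \<notin> {vi,vm,va,vb}" "e = f \<longleftrightarrow> ve = vf"
    "cycle_compat i m e f vi vm ve vf" "cycle_compat a b e f va vb ve vf"
    "gap i b vi vb e ve" "gap i b vi vb f vf"
  shows "cycle_compat i m e f vb vi ve vf" "cycle_compat a b e f va vm ve vf"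
  using assms unfolding cycle_compat_def gap_def insert_iff empty_iff by (smt (z3))+

lemma toggle_A3_shift:
  fixes i m a b va vb vi vm R :: int
  assumes "i < a \<and> a < b \<and> b < m" "vm < vi \<and> vi < vb \<and> vb < va"
    "i + R \<notin> {i,m,a,b}" "m + R \<notin> {i,m,a,b}" "vi + R \<notin> {vi,vm,va,vb}" "vm + R \<notin> {vi,vm,va,vb}"
    "a + R \<notin> {i,m,a,b}" "va + R \<notin> {vi,vm,va,vb}"
    "b + R \<notin> {i,m,a,b}" "vb + R \<notin> {vi,vm,va,vb}"
    "cycle_compat i m (i + R) (m + R) vi vm (vi + R) (vm + R)" "cycle_compat a b (a + R) (b + R) va vb (va + R) (vb + R)"
    "cycle_compat i m (a + R) (b + R) vi vm (va + R) (vb + R)" "cycle_compat i m (a - R) (b - R) vi vm (va - R) (vb - R)"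
    "gap i b vi vb (i + R) (vi + R)" "gap i b vi vb (i - R) (vi - R)"
    "gap i b vi vb (m + R) (vm + R)" "gap i b vi vb (m - R) (vm - R)"
    "gap i b vi vb (a + R) (va + R)" "gap i b vi vb (a - R) (va - R)"
    "gap i b vi vb (b + R) (vb + R)" "gap i b vi vb (b - R) (vb - R)"
  shows "R > 0 \<Longrightarrow> cycle_compat i m (i + R) (m + R) vb vi (vb + R) (vi + R)"
    "R > 0 \<Longrightarrow> cycle_compat a b (a + R) (b + R) va vm (va + R) (vm + R)"
    "cycle_compat i m (a + R) (b + R) vb vi (va + R) (vm + R)"
  using assms unfolding cycle_compat_def gap_def insert_iff empty_iff by (smt (z3))+

text \<open>The toggle exchanges the two pairs of values as wholes. Among the cases with two
  2-cycles this is the one in which all four values move.\<close>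

lemma toggle_C1_other:
  fixes i m a b va vb vi vm e f ve vf :: int
  assumes "i < a \<and> a < b \<and> b < m" "vm < vi \<and> vi < vb \<and> vb < va" "e \<le> f"
    "e \<notin> {i,m,a,b}" "f \<notin> {i,m,a,b}" "ve \<notin> {vi,vm,va,vb}" "vf \<notin> {vi,vm,va,vb}" "e = f \<longleftrightarrow> ve = vf"
    "cycle_compat i m e f vi vm ve vf" "cycle_compat a b e f va vb ve vf"
    "gap i a vi va e ve" "gap i a vi va f vf"
  shows "cycle_compat i m e f va vb ve vf" "cycle_compat a b e f vi vm ve vf"
  using assms unfolding cycle_compat_def gap_def insert_iff empty_iff by (smt (z3))+

lemma toggle_C1_shift:
  fixes i m a b va vb vi vm R :: int
  assumes "i < a \<and> a < b \<and> b < m" "vm < vi \<and> vi < vb \<and> vb < va"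
    "i + R \<notin> {i,m,a,b}" "m + R \<notin> {i,m,a,b}" "vi + R \<notin> {vi,vm,va,vb}" "vm + R \<notin> {vi,vm,va,vb}"
    "a + R \<notin> {i,m,a,b}" "va + R \<notin> {vi,vm,va,vb}"
    "b + R \<notin> {i,m,a,b}" "vb + R \<notin> {vi,vm,va,vb}"
    "cycle_compat i m (i + R) (m + R) vi vm (vi + R) (vm + R)" "cycle_compat a b (a + R) (b + R) va vb (va + R) (vb + R)"
    "cycle_compat i m (a + R) (b + R) vi vm (va + R) (vb + R)" "cycle_compat i m (a - R) (b - R) vi vm (va - R) (vb - R)"
    "gap i a vi va (i + R) (vi + R)" "gap i a vi va (i - R) (vi - R)"
    "gap i a vi va (m + R) (vm + R)" "gap i a vi va (m - R) (vm - R)"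
    "gap i a vi va (a + R) (va + R)" "gap i a vi va (a - R) (va - R)"
    "gap i a vi va (b + R) (vb + R)" "gap i a vi va (b - R) (vb - R)"
  shows "R > 0 \<Longrightarrow> cycle_compat i m (i + R) (m + R) va vb (va + R) (vb + R)"
    "R > 0 \<Longrightarrow> cycle_compat a b (a + R) (b + R) vi vm (vi + R) (vm + R)"
    "cycle_compat i m (a + R) (b + R) va vb (vi + R) (vm + R)"
  using assms unfolding cycle_compat_def gap_def insert_iff empty_iff by (smt (z3))+

lemma cycle_compat_commute: "cycle_compat x u e f a b c d \<longleftrightarrow> cycle_compat e f x u c d a b"
  unfolding cycle_compat_def by blast

lemma cycle_compat_shift:
  "cycle_compat (x + R) (u + R) (e + R) (f + R) (a + R) (b + R) (c + R) (d + R) \<longleftrightarrow> cycle_compat x u e f a b c d"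
  unfolding cycle_compat_def by simp

context affine_perms begin

section \<open>From pairs of cycles back to the whole permutation\<close>

abbreviation cp :: "(int \<Rightarrow> int) \<Rightarrow> (int \<Rightarrow> int) \<Rightarrow> int \<Rightarrow> int \<Rightarrow> bool" where
  "cp y \<sigma> x e \<equiv> cycle_compat x (y x) e (y e) (\<sigma> x) (\<sigma> (y x)) (\<sigma> e) (\<sigma> (y e))"

lemma cp_commute: "cp y \<sigma> x e \<longleftrightarrow> cp y \<sigma> e x"
  by (rule cycle_compat_commute)

lemma cp_shift:
  assumes "y \<in> I" "\<sigma> \<in> S"
  shows "cp y \<sigma> (x + r * int n) (e + r * int n) \<longleftrightarrow> cp y \<sigma> x e"
  using S_shift[OF invol_S[OF assms(1)]] S_shift[OF assms(2)] by (simp only: cycle_compat_shift)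

lemma fits_imp_cp:
  assumes y: "y \<in> I" and f: "fits \<sigma> y" and x: "x \<le> y x" and e: "e \<le> y e"
  shows "cp y \<sigma> x e"
proof -
  note fD = fitsD[OF f]
  show ?thesis
    unfolding cycle_compat_def
  proof (intro conjI impI)
    show "x < y x \<Longrightarrow> \<sigma> (y x) < \<sigma> x" "e < y e \<Longrightarrow> \<sigma> (y e) < \<sigma> e" by (rule fD(1), assumption)+
    show "x < e \<and> y x < y e \<Longrightarrow> \<sigma> x < \<sigma> (y e)" using fD(3)[of x e] by blast
    show "e < x \<and> y e < y x \<Longrightarrow> \<sigma> e < \<sigma> (y x)" using fD(3)[of e x] by blast
    show "\<not> (\<sigma> (y x) < \<sigma> e \<and> \<sigma> e < \<sigma> x)" "\<not> (\<sigma> (y x) < \<sigma> (y e) \<and> \<sigma> (y e) < \<sigma> x)"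
      if "x < e \<and> y e < y x"
      using fD(2)[of x e] fD(2)[of x "y e"] that e by simp_all
    show "\<not> (\<sigma> (y e) < \<sigma> x \<and> \<sigma> x < \<sigma> e)" "\<not> (\<sigma> (y e) < \<sigma> (y x) \<and> \<sigma> (y x) < \<sigma> e)"
      if "e < x \<and> y x < y e"
      using fD(2)[of e x] fD(2)[of e "y x"] that x by simp_all
  qed
qed

text \<open>\<open>cp\<close> is known only at lower ends of cycles while \<open>fits\<close> speaks
  of arbitrary elements, so each element is replaced by the ends of its cycle; the first clause says
  which end carries the larger value.\<close>

lemma cp_imp_fits:
  assumes y: "y \<in> I" and \<sigma>: "\<sigma> \<in> S" and cp: "\<And>x e. x \<le> y x \<Longrightarrow> e \<le> y e \<Longrightarrow> cp y \<sigma> x e"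
  shows "fits \<sigma> y"
  unfolding fits_def
proof (intro conjI allI impI)
  note yy = invol_invol[OF y]
  show lower: "\<sigma> (y x) < \<sigma> x" if "x < y x" for x
    using cp[of x x] that unfolding cycle_compat_def by simp
  fix x e
  {
    assume a: "x < e \<and> e < y x"
    show "\<not> (\<sigma> (y x) < \<sigma> e \<and> \<sigma> e < \<sigma> x)"
    \<comment> \<open>If the cycle of e lies inside that of x, \<open>cp\<close> forbids the value
      outright; if it crosses, the comparison of non-nested cycles puts all its values on one
      side.\<close>
    proof (cases "e \<le> y e")
      case True
      have "\<not> (x < e \<and> y e < y x \<and> \<sigma> (y x) < \<sigma> e \<and> \<sigma> e < \<sigma> x)" "x < e \<and> y x < y e \<longrightarrow> \<sigma> x < \<sigma> (y e)"
        using cp[of x e] True a unfolding cycle_compat_def by auto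
      moreover have "y e \<noteq> y x" using a y by auto
      moreover have "\<sigma> (y e) \<le> \<sigma> e" using lower[of e] True by (cases "y e = e") auto
      ultimately show ?thesis using a by linarith
    next
      case False
      have "cp y \<sigma> x (y e)" using cp[of x "y e"] False a yy by simp
      then have "\<not> (x < y e \<and> e < y x \<and> \<sigma> (y x) < \<sigma> e \<and> \<sigma> e < \<sigma> x)" "y e < x \<and> e < y x \<longrightarrow> \<sigma> (y e) < \<sigma> (y x)"
        unfolding cycle_compat_def yy by auto
      moreover have "y e \<noteq> x" using a yy[of e] by auto
      moreover have "\<sigma> e < \<sigma> (y e)" using lower[of "y e"] False yy by simp
      ultimately show ?thesis using a by linarith
    qed
  }
  {
    fix x x' assume a: "x < x' \<and> y x < y x'"
    have le: "\<sigma> (max x (y x)) \<le> \<sigma> x" "\<sigma> x \<le> \<sigma> (min x (y x))" "x \<in> {min x (y x), max x (y x)}"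
      "min x (y x) \<le> y (min x (y x))" "y (min x (y x)) = max x (y x)" for x
      using lower[of x] lower[of "y x"] yy[of x] by (cases "x < y x"; cases "x = y x"; simp add: max_def min_def)+
    \<comment> \<open>\<open>p\<close> and \<open>q\<close> are the lower ends: \<sigma> p is the
      largest value on the cycle of x and \<sigma> (y q) the smallest on that of x', so one
      inequality between them gives both claims.\<close>
    define p where "p = min x (y x)"
    define q where "q = min x' (y x')"
    have yp: "y p = max x (y x)" "y q = max x' (y x')" unfolding p_def q_def by (rule le)+
    have "p < q" unfolding p_def q_def using a by auto
    moreover have "y p < y q" unfolding yp using a by auto
    moreover have "cp y \<sigma> p q" unfolding p_def q_def by (intro cp le)
    ultimately have "\<sigma> p < \<sigma> (y q)" unfolding cycle_compat_def by simp
    moreover have "\<sigma> x \<le> \<sigma> p" unfolding p_def by (rule le)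
    moreover have "\<sigma> (y q) \<le> \<sigma> x'" unfolding yp by (rule le)
    moreover have "\<sigma> (y q) \<le> \<sigma> (y x')" using le(1)[of "y x'"] unfolding yp yy by (simp add: max.commute)
    ultimately show "\<sigma> x < \<sigma> x'" "\<sigma> x < \<sigma> (y x')" by linarith+
  }
qed

text \<open>Leaves only a few kinds of pairs to check for the toggled permutation. It agrees with
  \<pi> off the toggled classes, a cycle inside them is a translate of the outer or the inner one,
  and translating both members of a pair brings one of them back to i or a.\<close>

lemma toggle_fits:
  assumes y: "y \<in> I" and \<pi>: "\<pi> \<in> S" and f: "fits \<pi> y" and \<sigma>: "\<sigma> \<in> S"
    and ia: "y i = m" "y a = b" "i < m" "a \<le> b"
    and out: "\<And>k. k \<notin> {k. k \<sim> i \<or> k \<sim> m \<or> k \<sim> a \<or> k \<sim> b} \<Longrightarrow> \<sigma> k = \<pi> k"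
    and other: "\<And>e. e \<le> y e \<Longrightarrow> e \<notin> {k. k \<sim> i \<or> k \<sim> m \<or> k \<sim> a \<or> k \<sim> b} \<Longrightarrow> cp y \<sigma> i e \<and> cp y \<sigma> a e"
    and shift: "\<And>R r. R = r * int n \<Longrightarrow> R \<noteq> 0 \<Longrightarrow>
      (0 < R \<longrightarrow> cp y \<sigma> i (i + R)) \<and> (0 < R \<longrightarrow> cp y \<sigma> a (a + R)) \<and> cp y \<sigma> i (a + R)"
    and self: "cp y \<sigma> i a"
  shows "fits \<sigma> y"
proof (rule cp_imp_fits[OF y \<sigma>])
  note yy = invol_invol[OF y] and ysh = S_shift[OF invol_S[OF y]]
  let ?C = "{k. k \<sim> i \<or> k \<sim> m \<or> k \<sim> a \<or> k \<sim> b}"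
  have lower: "x \<notin> ?C \<or> (\<exists>r. x = i + r * int n \<or> x = a + r * int n)" if "x \<le> y x" for x
  proof (rule disjCI)
    assume "\<not> (\<exists>r. x = i + r * int n \<or> x = a + r * int n)"
    then have no: "x \<noteq> i + r * int n" "x \<noteq> a + r * int n" for r by blast+
    have "\<not> x \<sim> i" "\<not> x \<sim> a" using no by (auto elim!: cgE)
    moreover have "\<not> x \<sim> m"
    proof
      assume "x \<sim> m"
      then obtain r where r: "x = m + r * int n" by (rule cgE)
      then have "y x = i + r * int n" using ysh[of m r] yy[of i] ia by simp
      then show False using r that ia by simp
    qed
    moreover have "\<not> x \<sim> b"
    proof
      assume "x \<sim> b"
      then obtain r where r: "x = b + r * int n" by (rule cgE)
      then have "y x = a + r * int n" using ysh[of b r] yy[of a] ia by simp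
      then show False using r that ia no(2)[of r] by simp
    qed
    ultimately show "x \<notin> ?C" by blast
  qed
  have lower': "x \<notin> ?C \<or> (\<exists>c r. (c = i \<or> c = a) \<and> x = c + r * int n)" if "x \<le> y x" for x
    using lower[OF that] by blast
  have yC: "y x \<notin> ?C" if x: "x \<notin> ?C" for x
  proof
    assume "y x \<in> ?C"
    then have "y (y x) \<sim> y i \<or> y (y x) \<sim> y m \<or> y (y x) \<sim> y a \<or> y (y x) \<sim> y b"
      using invol_S[OF y] by simp
    then show False using x ia yy by auto
  qed
  have in_out: "cp y \<sigma> (c + r * int n) e" if c: "c = i \<or> c = a" and e: "e \<le> y e" "e \<notin> ?C" for c r e
  proof -
    have ye: "e - r * int n \<le> y (e - r * int n)" using ysh[of e "- r"] e by simp
    moreover have "e - r * int n \<notin> ?C" using e(2) cg_shift(1)[of e "- r"] by simp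
    ultimately have "cp y \<sigma> c (e - r * int n)" using other c by blast
    then show ?thesis using cp_shift[OF y \<sigma>, of c r "e - r * int n"] by simp
  qed
  have ii: "cp y \<sigma> i (i + r * int n)" and aa: "cp y \<sigma> a (a + r * int n)" and ia': "cp y \<sigma> i (a + r * int n)" for r
  proof -
    have 0: "cp y \<sigma> i i" "cp y \<sigma> a a" using self by (auto simp: cycle_compat_def)
    show "cp y \<sigma> i (a + r * int n)" using shift[OF refl, of r] self two_le_n by (cases "r = 0") auto
    \<comment> \<open>Negative translations follow from positive ones by translating both cycles and
      exchanging their roles; hence \<open>shift\<close> asks only for \<open>0 < R\<close> when a
      cycle meets its own translate.\<close>
    consider "r = 0" | "0 < r * int n" | "0 < (- r) * int n"
      using two_le_n by (cases r "0 :: int" rule: linorder_cases) (auto simp: mult_less_0_iff)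
    then show "cp y \<sigma> i (i + r * int n)" "cp y \<sigma> a (a + r * int n)"
    proof (atomize (full), cases)
      case 3
      then have "(- r) * int n \<noteq> 0" by linarith
      then have "cp y \<sigma> i (i + (- r) * int n)" "cp y \<sigma> a (a + (- r) * int n)"
        using shift[OF refl, of "- r"] 3 by blast+
      then show "cp y \<sigma> i (i + r * int n) \<and> cp y \<sigma> a (a + r * int n)"
        using cp_shift[OF y \<sigma>, of i r "i + (- r) * int n"] cp_shift[OF y \<sigma>, of a r "a + (- r) * int n"]
          cp_commute[where y = y and \<sigma> = \<sigma> and x = i] cp_commute[where y = y and \<sigma> = \<sigma> and x = a] by simp
    next
      case 2
      then have "r * int n \<noteq> 0" by linarith
      then show "cp y \<sigma> i (i + r * int n) \<and> cp y \<sigma> a (a + r * int n)"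
        using shift[OF refl, of r] 2 by blast
    qed (use 0 in simp)
  qed
  fix x e assume xe: "x \<le> y x" "e \<le> y e"
  show "cp y \<sigma> x e"
  proof (cases "x \<in> ?C")
    case x: False
    show ?thesis
    proof (cases "e \<in> ?C")
      case e: False
      have "\<sigma> x = \<pi> x" "\<sigma> e = \<pi> e" "\<sigma> (y x) = \<pi> (y x)" "\<sigma> (y e) = \<pi> (y e)"
        using out yC x e by blast+
      then show ?thesis using fits_imp_cp[OF y f xe] by (simp only:)
    next
      case True
      then obtain c r where c: "c = i \<or> c = a" "e = c + r * int n" using lower'[OF xe(2)] by blast
      have "cp y \<sigma> e x" unfolding c(2) by (rule in_out[OF c(1) xe(1) x])
      then show ?thesis by (subst cp_commute)
    qed
  next
    case True
    then obtain c r where c: "c = i \<or> c = a" "x = c + r * int n" using lower'[OF xe(1)] by blast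
    show ?thesis
    proof (cases "e \<in> ?C")
      case False
      show ?thesis unfolding c(2) by (rule in_out[OF c(1) xe(2) False])
    next
      case True
      then obtain d q where d: "d = i \<or> d = a" "e = d + q * int n" using lower'[OF xe(2)] by blast
      have "cp y \<sigma> (a + (r - q) * int n + (q - r) * int n) (i + (q - r) * int n)"
        unfolding cp_shift[OF y \<sigma>] by (subst cp_commute) (rule ia')
      then have "cp y \<sigma> a (i + (q - r) * int n)" by (simp add: algebra_simps)
      then have "cp y \<sigma> c (d + (q - r) * int n)" using c(1) d(1) ii aa ia' by blast
      then have "cp y \<sigma> (c + r * int n) (d + (q - r) * int n + r * int n)"
        using cp_shift[OF y \<sigma>, of c r] by blast
      moreover have "d + (q - r) * int n + r * int n = d + q * int n" by (simp add: algebra_simps)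
      ultimately show ?thesis unfolding c(2) d(2) by (simp only:)
    qed
  qed
qed

text \<open>A translation carrying i to y j would carry y i to j as well, hence move to the right
  and to the left at once.\<close>

lemma nested_incongruent:
  assumes y: "y \<in> I" and o: "i < y j" "y j < y i" "j < y i" and ij: "\<not> i \<sim> j"
  shows "\<not> i \<sim> y i" "\<not> i \<sim> y j" "\<not> j \<sim> y i" "\<not> y i \<sim> y j" "j \<sim> y j \<Longrightarrow> y j = j"
proof -
  note yy = invol_invol[OF y] and yS = invol_S[OF y]
  show ni: "\<not> i \<sim> y i" using invol_cong_fixed[OF y, of i] o cong_sym by fastforce
  show nj: "\<not> i \<sim> y j"
  proof
    assume "i \<sim> y j"
    then obtain q where q: "y j = i + q * int n" using cong_sym cgE by blast
    then have "j = y i + q * int n" using S_shift[OF yS, of i q] yy[of j] by simp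
    then show False using q o by linarith
  qed
  show "\<not> j \<sim> y i"
  proof
    assume "j \<sim> y i"
    then have "y j \<sim> y (y i)" using yS by simp
    then show False using nj yy cong_sym by metis
  qed
  show "\<not> y i \<sim> y j" using yS ij by simp
  show "j \<sim> y j \<Longrightarrow> y j = j" using invol_cong_fixed[OF y] cong_sym by blast
qed

text \<open>The situation where i is the lower end of the outer cycle; \<open>k\<close> is y j
  exactly in case (C1). The second conclusion serves to show that the toggle differs from \<pi>, as
  its value at i is \<pi> j.\<close>

lemma toggle_left:
  fixes i j :: int
  assumes y: "y \<in> I" and \<pi>: "\<pi> \<in> S" and f: "fits \<pi> y" and ij: "i < j" "\<not> i \<sim> j" "\<pi> i < \<pi> j"
    and gap: "\<And>e. i < e \<Longrightarrow> e < j \<Longrightarrow> \<not> (\<pi> i < \<pi> e \<and> \<pi> e < \<pi> j)"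
    and o: "i < y j" "y j < y i" "j < y i"
  defines "k \<equiv> if j < y j \<and> \<pi> i < \<pi> (y j) then y j else j"
  shows "fits (\<pi> \<circ> t i j \<circ> t k (y i)) y" "(\<pi> \<circ> t i j \<circ> t k (y i)) i = \<pi> j" "\<not> k \<sim> y i"
proof -
  define m where "m = y i"
  define p where "p = y j"
  define \<sigma> where "\<sigma> = \<pi> \<circ> t i j \<circ> t k m"
  define X where "X = {i, m, j, p}"
  note yy = invol_invol[OF y] and yS = invol_S[OF y]
  note o' = o[folded m_def p_def]
  note inc = nested_incongruent[OF y o ij(2), folded m_def p_def]
  have inc': "\<not> m \<sim> i" "\<not> p \<sim> i" "\<not> m \<sim> j" "\<not> p \<sim> m" using inc(1-4) cong_sym by blast+
  have ym: "y i = m" "y m = i" "y j = p" "y p = j" using yy by (simp_all add: m_def p_def)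
  have ji: "\<not> j \<sim> i" using ij(2) cong_sym by blast
  \<comment> \<open>Distinct elements of the two cycles are incongruent, so on them the reflections
    act as plain transpositions, and neither cycle meets a translate of the other.\<close>
  have X: "c = d" if "c \<in> X" "d \<in> X" "c \<sim> d" for c d
    using that inc inc' ij(2) ji cong_sym[of p j] unfolding X_def by auto
  have gapI: "gap i j (\<pi> i) (\<pi> j) e (\<pi> e)" for e using gap unfolding gap_def by blast
  have yX: "y c \<in> X" if "c \<in> X" for c using that ym unfolding X_def by auto
  have O: "e \<notin> X" "y e \<notin> X" "\<pi> e \<notin> \<pi> ` X" "\<pi> (y e) \<notin> \<pi> ` X" "e = y e \<longleftrightarrow> \<pi> e = \<pi> (y e)"
    if "\<And>c. c \<in> X \<Longrightarrow> \<not> e \<sim> c" for e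
  proof -
    show e: "e \<notin> X" using that[of e] by auto
    then show ye: "y e \<notin> X" using yX[of "y e"] yy by auto
    show "\<pi> e \<notin> \<pi> ` X" "\<pi> (y e) \<notin> \<pi> ` X" "e = y e \<longleftrightarrow> \<pi> e = \<pi> (y e)" using e ye \<pi> by auto
  qed
  have Sh: "c + R \<notin> X" "\<pi> c + R \<notin> \<pi> ` X" if c: "c \<in> X" and R: "R = r * int n" "R \<noteq> 0" for c R r
  proof -
    show cR: "c + R \<notin> X"
    proof
      assume "c + R \<in> X"
      moreover have "c + R \<sim> c" using R by simp
      ultimately show False using X c R by fastforce
    qed
    have "\<pi> c + R = \<pi> (c + R)" using S_shift[OF \<pi>, of c r] R by simp
    then show "\<pi> c + R \<notin> \<pi> ` X" using cR \<pi> by auto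
  qed
  have ysh: "y (c + R) = y c + R" and \<pi>sh: "\<pi> (c + R) = \<pi> c + R" if "R = r * int n" for c R r
    using S_shift[OF yS, of c r] S_shift[OF \<pi>, of c r] that by simp_all
  have ysh': "y (c - R) = y c - R" and \<pi>sh': "\<pi> (c - R) = \<pi> c - R" if "R = r * int n" for c R r
    using S_shift[OF yS, of c "- r"] S_shift[OF \<pi>, of c "- r"] that by simp_all
  have ne: "\<pi> p \<noteq> \<pi> i" "\<pi> p \<noteq> \<pi> m" "m \<noteq> i" "p = j \<longleftrightarrow> \<pi> p = \<pi> j" using \<pi> o' by auto
  have mi: "\<pi> m < \<pi> i" using fitsD(1)[OF f, of i] o' ym by simp
  have \<sigma>S: "\<sigma> \<in> S" using \<pi> by (simp add: \<sigma>_def)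
  have k: "k = p \<and> j < p \<and> \<pi> i < \<pi> p \<or> k = j \<and> \<not> (j < p \<and> \<pi> i < \<pi> p)" unfolding k_def p_def by auto
  have \<sigma>i: "\<sigma> i = \<pi> j"
    using k inc(1-4) inc' ij(2) ji by (elim disjE conjE) (simp_all add: \<sigma>_def trans_left trans_right trans_other)
  have \<sigma>out: "\<sigma> e = \<pi> e" if "\<And>c. c \<in> X \<Longrightarrow> \<not> e \<sim> c" for e
  proof -
    have "\<not> e \<sim> i" "\<not> e \<sim> j" "\<not> e \<sim> m" "\<not> e \<sim> k" using that k unfolding X_def by auto
    then show ?thesis by (simp add: \<sigma>_def trans_other)
  qed
  have km: "\<not> k \<sim> m" using k inc(3) inc'(4) by blast
  \<comment> \<open>p lies strictly inside the outer cycle, so its value avoids the interval between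
    the outer values; this leaves the four cases below.\<close>
  have inner: "\<not> (\<pi> m < \<pi> p \<and> \<pi> p < \<pi> i)" using fitsD(2)[OF f, of i p] o' ym by auto
  have jp: "j < p \<Longrightarrow> \<pi> p < \<pi> j" "p < j \<Longrightarrow> \<pi> j < \<pi> p"
    using fitsD(1)[OF f, of j] fitsD(1)[OF f, of p] ym by auto
  consider (A1) "p = j" | (A2) "j < p" "\<pi> p < \<pi> m" | (A3) "p < j" | (C1) "j < p" "\<pi> i < \<pi> p"
    using inner ne by linarith
  then have "fits \<sigma> y"
  proof cases
    case A1
    have k': "k = j" using k A1 ne mi by auto
    have ord: "i < j \<and> j < m" using A1 o' ij by simp
    have vord: "\<pi> m < \<pi> i \<and> \<pi> i < \<pi> j" using A1 mi ij jp by simp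
    have \<sigma>: "\<sigma> j = \<pi> m" "\<sigma> m = \<pi> i"
      using A1 inc(1-4) inc' ij(2) ji by (simp_all add: \<sigma>_def k' trans_left trans_right trans_other)
    show ?thesis
    proof (rule toggle_fits[OF y \<pi> f \<sigma>S, of i m j j])
      show "y i = m" "y j = j" "i < m" "j \<le> j" using ym ord A1 by auto
      have C: "{e. e \<sim> i \<or> e \<sim> m \<or> e \<sim> j \<or> e \<sim> j} = {e. \<exists>c\<in>X. e \<sim> c}"
        using A1 unfolding X_def by auto
      have cp0: "cp y \<pi> i j" using fits_imp_cp[OF y f, of i j] ym ord A1 by simp
      show "cp y \<sigma> i j"
        using cp0 ord vord unfolding ym \<sigma> \<sigma>i cycle_compat_def by (simp add: A1 \<sigma>)
      show "\<sigma> e = \<pi> e" if "e \<notin> {e. e \<sim> i \<or> e \<sim> m \<or> e \<sim> j \<or> e \<sim> j}" for e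
        using that unfolding C by (intro \<sigma>out) blast
      show "cp y \<sigma> i e \<and> cp y \<sigma> j e"
        if e: "e \<le> y e" "e \<notin> {e. e \<sim> i \<or> e \<sim> m \<or> e \<sim> j \<or> e \<sim> j}" for e
      proof -
        have eX: "\<And>c. c \<in> X \<Longrightarrow> \<not> e \<sim> c" using e(2) unfolding C by blast
        have yeX: "\<not> y e \<sim> c" if c: "c \<in> X" for c
        proof
          assume "y e \<sim> c"
          then have "y (y e) \<sim> y c" using yS by simp
          then show False using eX[OF yX[OF c]] yy by simp
        qed
        have \<sigma>e: "\<sigma> e = \<pi> e" "\<sigma> (y e) = \<pi> (y e)" using \<sigma>out eX yeX by blast+
        have cpe: "cp y \<pi> i e" "cp y \<pi> j e"
          using fits_imp_cp[OF y f _ e(1), of i] fits_imp_cp[OF y f _ e(1), of j] ym ord A1 by simp_all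
        have nin: "e \<notin> {i,m,j}" "y e \<notin> {i,m,j}"
          "\<pi> e \<notin> {\<pi> i,\<pi> m,\<pi> j}" "\<pi> (y e) \<notin> {\<pi> i,\<pi> m,\<pi> j}"
          using O(1-4)[OF eX] unfolding X_def by (simp_all add: A1)
        show ?thesis
          unfolding \<sigma>e ym A1 \<sigma> \<sigma>i
          using toggle_A1_other[OF ord vord e(1) nin O(5)[OF eX] cpe[unfolded ym A1] gapI gapI] by (intro conjI)
      qed
      show "(0 < R \<longrightarrow> cp y \<sigma> i (i + R)) \<and> (0 < R \<longrightarrow> cp y \<sigma> j (j + R)) \<and> cp y \<sigma> i (j + R)"
        if R: "R = r * int n" "R \<noteq> 0" for R r
      proof -
        have \<sigma>R: "\<sigma> (c + R) = \<sigma> c + R" for c using S_shift[OF \<sigma>S, of c r] R by simp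
        have le: "i \<le> y i" "j \<le> y j" "i + R \<le> y (i + R)" "j + R \<le> y (j + R)" "j - R \<le> y (j - R)"
          using ym ord A1 ysh[OF R(1)] ysh'[OF R(1)] by simp_all
        have cpR: "cp y \<pi> i (i + R)" "cp y \<pi> j (j + R)" "cp y \<pi> i (j + R)" "cp y \<pi> i (j - R)"
          using fits_imp_cp[OF y f] le by blast+
        have gapR: "gap i j (\<pi> i) (\<pi> j) (c + R) (\<pi> c + R)" "gap i j (\<pi> i) (\<pi> j) (c - R) (\<pi> c - R)" for c
          using gapI[of "c + R"] gapI[of "c - R"] \<pi>sh[OF R(1)] \<pi>sh'[OF R(1)] by simp_all
        have nin: "i + R \<notin> {i,m,j}" "m + R \<notin> {i,m,j}"
          "\<pi> i + R \<notin> {\<pi> i,\<pi> m,\<pi> j}" "\<pi> m + R \<notin> {\<pi> i,\<pi> m,\<pi> j}"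
          "j + R \<notin> {i,m,j}" "\<pi> j + R \<notin> {\<pi> i,\<pi> m,\<pi> j}"
          using Sh[OF _ R, of i] Sh[OF _ R, of m] Sh[OF _ R, of j] Sh[OF _ R, of p] unfolding X_def by (simp_all add: A1)
        note T = toggle_A1_shift[OF ord vord nin cpR[unfolded ysh[OF R(1)] ysh'[OF R(1)] \<pi>sh[OF R(1)] \<pi>sh'[OF R(1)] ym A1]
          gapR gapR gapR]
        show ?thesis
          unfolding \<sigma>R ysh[OF R(1)] ym A1 \<sigma> \<sigma>i using T by (intro conjI impI)
      qed
    qed
  next
    case A2
    have k': "k = j" using k A2 ne mi by auto
    have ord: "i < j \<and> j < p \<and> p < m" using A2 o' ij by simp
    have vord: "\<pi> p < \<pi> m \<and> \<pi> m < \<pi> i \<and> \<pi> i < \<pi> j" using A2 mi ij jp by simp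
    have pj: "\<not> p \<sim> j" "\<not> j \<sim> p" using inc(5) cong_sym[of p j] A2 by auto
    have \<sigma>: "\<sigma> j = \<pi> m" "\<sigma> p = \<pi> p" "\<sigma> m = \<pi> i"
      using A2 inc(1-4) inc' ij(2) ji pj by (simp_all add: \<sigma>_def k' trans_left trans_right trans_other)
    show ?thesis
    proof (rule toggle_fits[OF y \<pi> f \<sigma>S, of i m j p])
      show "y i = m" "y j = p" "i < m" "j \<le> p" using ym ord A2 by auto
      have C: "{e. e \<sim> i \<or> e \<sim> m \<or> e \<sim> j \<or> e \<sim> p} = {e. \<exists>c\<in>X. e \<sim> c}"
        using A2 unfolding X_def by auto
      have cp0: "cp y \<pi> i j" using fits_imp_cp[OF y f, of i j] ym ord A2 by simp
      show "cp y \<sigma> i j"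
        using cp0 ord vord unfolding ym \<sigma> \<sigma>i cycle_compat_def by auto
      show "\<sigma> e = \<pi> e" if "e \<notin> {e. e \<sim> i \<or> e \<sim> m \<or> e \<sim> j \<or> e \<sim> p}" for e
        using that unfolding C by (intro \<sigma>out) blast
      show "cp y \<sigma> i e \<and> cp y \<sigma> j e"
        if e: "e \<le> y e" "e \<notin> {e. e \<sim> i \<or> e \<sim> m \<or> e \<sim> j \<or> e \<sim> p}" for e
      proof -
        have eX: "\<And>c. c \<in> X \<Longrightarrow> \<not> e \<sim> c" using e(2) unfolding C by blast
        have yeX: "\<not> y e \<sim> c" if c: "c \<in> X" for c
        proof
          assume "y e \<sim> c"
          then have "y (y e) \<sim> y c" using yS by simp
          then show False using eX[OF yX[OF c]] yy by simp
        qed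
        have \<sigma>e: "\<sigma> e = \<pi> e" "\<sigma> (y e) = \<pi> (y e)" using \<sigma>out eX yeX by blast+
        have cpe: "cp y \<pi> i e" "cp y \<pi> j e"
          using fits_imp_cp[OF y f _ e(1), of i] fits_imp_cp[OF y f _ e(1), of j] ym ord A2 by simp_all
        have nin: "e \<notin> {i,m,j,p}" "y e \<notin> {i,m,j,p}"
          "\<pi> e \<notin> {\<pi> i,\<pi> m,\<pi> j,\<pi> p}" "\<pi> (y e) \<notin> {\<pi> i,\<pi> m,\<pi> j,\<pi> p}"
          using O(1-4)[OF eX] unfolding X_def by (auto)
        show ?thesis
          unfolding \<sigma>e ym \<sigma> \<sigma>i
          using toggle_A2_other[OF ord vord e(1) nin O(5)[OF eX] cpe[unfolded ym ] gapI gapI] by (intro conjI)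
      qed
      show "(0 < R \<longrightarrow> cp y \<sigma> i (i + R)) \<and> (0 < R \<longrightarrow> cp y \<sigma> j (j + R)) \<and> cp y \<sigma> i (j + R)"
        if R: "R = r * int n" "R \<noteq> 0" for R r
      proof -
        have \<sigma>R: "\<sigma> (c + R) = \<sigma> c + R" for c using S_shift[OF \<sigma>S, of c r] R by simp
        have le: "i \<le> y i" "j \<le> y j" "i + R \<le> y (i + R)" "j + R \<le> y (j + R)" "j - R \<le> y (j - R)"
          using ym ord A2 ysh[OF R(1)] ysh'[OF R(1)] by simp_all
        have cpR: "cp y \<pi> i (i + R)" "cp y \<pi> j (j + R)" "cp y \<pi> i (j + R)" "cp y \<pi> i (j - R)"
          using fits_imp_cp[OF y f] le by blast+
        have gapR: "gap i j (\<pi> i) (\<pi> j) (c + R) (\<pi> c + R)" "gap i j (\<pi> i) (\<pi> j) (c - R) (\<pi> c - R)" for c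
          using gapI[of "c + R"] gapI[of "c - R"] \<pi>sh[OF R(1)] \<pi>sh'[OF R(1)] by simp_all
        have nin: "i + R \<notin> {i,m,j,p}" "m + R \<notin> {i,m,j,p}"
          "\<pi> i + R \<notin> {\<pi> i,\<pi> m,\<pi> j,\<pi> p}" "\<pi> m + R \<notin> {\<pi> i,\<pi> m,\<pi> j,\<pi> p}"
          "j + R \<notin> {i,m,j,p}" "\<pi> j + R \<notin> {\<pi> i,\<pi> m,\<pi> j,\<pi> p}"
          "p + R \<notin> {i,m,j,p}" "\<pi> p + R \<notin> {\<pi> i,\<pi> m,\<pi> j,\<pi> p}"
          using Sh[OF _ R, of i] Sh[OF _ R, of m] Sh[OF _ R, of j] Sh[OF _ R, of p] unfolding X_def by (auto)
        note T = toggle_A2_shift[OF ord vord nin cpR[unfolded ysh[OF R(1)] ysh'[OF R(1)] \<pi>sh[OF R(1)] \<pi>sh'[OF R(1)] ym ]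
          gapR gapR gapR gapR]
        show ?thesis
          unfolding \<sigma>R ysh[OF R(1)] ym \<sigma> \<sigma>i using T by (intro conjI impI)
      qed
    qed
  next
    case A3
    have k': "k = j" using k A3 ne mi by auto
    have ord: "i < p \<and> p < j \<and> j < m" using A3 o' ij by simp
    have vord: "\<pi> m < \<pi> i \<and> \<pi> i < \<pi> j \<and> \<pi> j < \<pi> p" using A3 mi ij jp by simp
    have pj: "\<not> p \<sim> j" "\<not> j \<sim> p" using inc(5) cong_sym[of p j] A3 by auto
    have \<sigma>: "\<sigma> j = \<pi> m" "\<sigma> p = \<pi> p" "\<sigma> m = \<pi> i"
      using A3 inc(1-4) inc' ij(2) ji pj by (simp_all add: \<sigma>_def k' trans_left trans_right trans_other)
    show ?thesis
    proof (rule toggle_fits[OF y \<pi> f \<sigma>S, of i m p j])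
      show "y i = m" "y p = j" "i < m" "p \<le> j" using ym ord A3 by auto
      have C: "{e. e \<sim> i \<or> e \<sim> m \<or> e \<sim> p \<or> e \<sim> j} = {e. \<exists>c\<in>X. e \<sim> c}"
        using A3 unfolding X_def by auto
      have cp0: "cp y \<pi> i p" using fits_imp_cp[OF y f, of i p] ym ord A3 by simp
      show "cp y \<sigma> i p"
        using cp0 ord vord unfolding ym \<sigma> \<sigma>i cycle_compat_def by auto
      show "\<sigma> e = \<pi> e" if "e \<notin> {e. e \<sim> i \<or> e \<sim> m \<or> e \<sim> p \<or> e \<sim> j}" for e
        using that unfolding C by (intro \<sigma>out) blast
      show "cp y \<sigma> i e \<and> cp y \<sigma> p e"
        if e: "e \<le> y e" "e \<notin> {e. e \<sim> i \<or> e \<sim> m \<or> e \<sim> p \<or> e \<sim> j}" for e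
      proof -
        have eX: "\<And>c. c \<in> X \<Longrightarrow> \<not> e \<sim> c" using e(2) unfolding C by blast
        have yeX: "\<not> y e \<sim> c" if c: "c \<in> X" for c
        proof
          assume "y e \<sim> c"
          then have "y (y e) \<sim> y c" using yS by simp
          then show False using eX[OF yX[OF c]] yy by simp
        qed
        have \<sigma>e: "\<sigma> e = \<pi> e" "\<sigma> (y e) = \<pi> (y e)" using \<sigma>out eX yeX by blast+
        have cpe: "cp y \<pi> i e" "cp y \<pi> p e"
          using fits_imp_cp[OF y f _ e(1), of i] fits_imp_cp[OF y f _ e(1), of p] ym ord A3 by simp_all
        have nin: "e \<notin> {i,m,p,j}" "y e \<notin> {i,m,p,j}"
          "\<pi> e \<notin> {\<pi> i,\<pi> m,\<pi> p,\<pi> j}" "\<pi> (y e) \<notin> {\<pi> i,\<pi> m,\<pi> p,\<pi> j}"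
          using O(1-4)[OF eX] unfolding X_def by (auto)
        show ?thesis
          unfolding \<sigma>e ym \<sigma> \<sigma>i
          using toggle_A3_other[OF ord vord e(1) nin O(5)[OF eX] cpe[unfolded ym ] gapI gapI] by (intro conjI)
      qed
      show "(0 < R \<longrightarrow> cp y \<sigma> i (i + R)) \<and> (0 < R \<longrightarrow> cp y \<sigma> p (p + R)) \<and> cp y \<sigma> i (p + R)"
        if R: "R = r * int n" "R \<noteq> 0" for R r
      proof -
        have \<sigma>R: "\<sigma> (c + R) = \<sigma> c + R" for c using S_shift[OF \<sigma>S, of c r] R by simp
        have le: "i \<le> y i" "p \<le> y p" "i + R \<le> y (i + R)" "p + R \<le> y (p + R)" "p - R \<le> y (p - R)"
          using ym ord A3 ysh[OF R(1)] ysh'[OF R(1)] by simp_all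
        have cpR: "cp y \<pi> i (i + R)" "cp y \<pi> p (p + R)" "cp y \<pi> i (p + R)" "cp y \<pi> i (p - R)"
          using fits_imp_cp[OF y f] le by blast+
        have gapR: "gap i j (\<pi> i) (\<pi> j) (c + R) (\<pi> c + R)" "gap i j (\<pi> i) (\<pi> j) (c - R) (\<pi> c - R)" for c
          using gapI[of "c + R"] gapI[of "c - R"] \<pi>sh[OF R(1)] \<pi>sh'[OF R(1)] by simp_all
        have nin: "i + R \<notin> {i,m,p,j}" "m + R \<notin> {i,m,p,j}"
          "\<pi> i + R \<notin> {\<pi> i,\<pi> m,\<pi> p,\<pi> j}" "\<pi> m + R \<notin> {\<pi> i,\<pi> m,\<pi> p,\<pi> j}"
          "p + R \<notin> {i,m,p,j}" "\<pi> p + R \<notin> {\<pi> i,\<pi> m,\<pi> p,\<pi> j}"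
          "j + R \<notin> {i,m,p,j}" "\<pi> j + R \<notin> {\<pi> i,\<pi> m,\<pi> p,\<pi> j}"
          using Sh[OF _ R, of i] Sh[OF _ R, of m] Sh[OF _ R, of j] Sh[OF _ R, of p] unfolding X_def by (auto)
        note T = toggle_A3_shift[OF ord vord nin cpR[unfolded ysh[OF R(1)] ysh'[OF R(1)] \<pi>sh[OF R(1)] \<pi>sh'[OF R(1)] ym ]
          gapR gapR gapR gapR]
        show ?thesis
          unfolding \<sigma>R ysh[OF R(1)] ym \<sigma> \<sigma>i using T by (intro conjI impI)
      qed
    qed
  next
    case C1
    have k': "k = p" using k C1 ne mi by auto
    have ord: "i < j \<and> j < p \<and> p < m" using C1 o' ij by simp
    have vord: "\<pi> m < \<pi> i \<and> \<pi> i < \<pi> p \<and> \<pi> p < \<pi> j" using C1 mi ij jp by simp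
    have pj: "\<not> p \<sim> j" "\<not> j \<sim> p" using inc(5) cong_sym[of p j] C1 by auto
    have \<sigma>: "\<sigma> j = \<pi> i" "\<sigma> p = \<pi> m" "\<sigma> m = \<pi> p"
      using C1 inc(1-4) inc' ij(2) ji pj by (simp_all add: \<sigma>_def k' trans_left trans_right trans_other)
    show ?thesis
    proof (rule toggle_fits[OF y \<pi> f \<sigma>S, of i m j p])
      show "y i = m" "y j = p" "i < m" "j \<le> p" using ym ord C1 by auto
      have C: "{e. e \<sim> i \<or> e \<sim> m \<or> e \<sim> j \<or> e \<sim> p} = {e. \<exists>c\<in>X. e \<sim> c}"
        using C1 unfolding X_def by auto
      have cp0: "cp y \<pi> i j" using fits_imp_cp[OF y f, of i j] ym ord C1 by simp
      show "cp y \<sigma> i j"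
        using cp0 ord vord unfolding ym \<sigma> \<sigma>i cycle_compat_def by auto
      show "\<sigma> e = \<pi> e" if "e \<notin> {e. e \<sim> i \<or> e \<sim> m \<or> e \<sim> j \<or> e \<sim> p}" for e
        using that unfolding C by (intro \<sigma>out) blast
      show "cp y \<sigma> i e \<and> cp y \<sigma> j e"
        if e: "e \<le> y e" "e \<notin> {e. e \<sim> i \<or> e \<sim> m \<or> e \<sim> j \<or> e \<sim> p}" for e
      proof -
        have eX: "\<And>c. c \<in> X \<Longrightarrow> \<not> e \<sim> c" using e(2) unfolding C by blast
        have yeX: "\<not> y e \<sim> c" if c: "c \<in> X" for c
        proof
          assume "y e \<sim> c"
          then have "y (y e) \<sim> y c" using yS by simp
          then show False using eX[OF yX[OF c]] yy by simp
        qed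
        have \<sigma>e: "\<sigma> e = \<pi> e" "\<sigma> (y e) = \<pi> (y e)" using \<sigma>out eX yeX by blast+
        have cpe: "cp y \<pi> i e" "cp y \<pi> j e"
          using fits_imp_cp[OF y f _ e(1), of i] fits_imp_cp[OF y f _ e(1), of j] ym ord C1 by simp_all
        have nin: "e \<notin> {i,m,j,p}" "y e \<notin> {i,m,j,p}"
          "\<pi> e \<notin> {\<pi> i,\<pi> m,\<pi> j,\<pi> p}" "\<pi> (y e) \<notin> {\<pi> i,\<pi> m,\<pi> j,\<pi> p}"
          using O(1-4)[OF eX] unfolding X_def by (auto)
        show ?thesis
          unfolding \<sigma>e ym \<sigma> \<sigma>i
          using toggle_C1_other[OF ord vord e(1) nin O(5)[OF eX] cpe[unfolded ym ] gapI gapI] by (intro conjI)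
      qed
      show "(0 < R \<longrightarrow> cp y \<sigma> i (i + R)) \<and> (0 < R \<longrightarrow> cp y \<sigma> j (j + R)) \<and> cp y \<sigma> i (j + R)"
        if R: "R = r * int n" "R \<noteq> 0" for R r
      proof -
        have \<sigma>R: "\<sigma> (c + R) = \<sigma> c + R" for c using S_shift[OF \<sigma>S, of c r] R by simp
        have le: "i \<le> y i" "j \<le> y j" "i + R \<le> y (i + R)" "j + R \<le> y (j + R)" "j - R \<le> y (j - R)"
          using ym ord C1 ysh[OF R(1)] ysh'[OF R(1)] by simp_all
        have cpR: "cp y \<pi> i (i + R)" "cp y \<pi> j (j + R)" "cp y \<pi> i (j + R)" "cp y \<pi> i (j - R)"
          using fits_imp_cp[OF y f] le by blast+
        have gapR: "gap i j (\<pi> i) (\<pi> j) (c + R) (\<pi> c + R)" "gap i j (\<pi> i) (\<pi> j) (c - R) (\<pi> c - R)" for c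
          using gapI[of "c + R"] gapI[of "c - R"] \<pi>sh[OF R(1)] \<pi>sh'[OF R(1)] by simp_all
        have nin: "i + R \<notin> {i,m,j,p}" "m + R \<notin> {i,m,j,p}"
          "\<pi> i + R \<notin> {\<pi> i,\<pi> m,\<pi> j,\<pi> p}" "\<pi> m + R \<notin> {\<pi> i,\<pi> m,\<pi> j,\<pi> p}"
          "j + R \<notin> {i,m,j,p}" "\<pi> j + R \<notin> {\<pi> i,\<pi> m,\<pi> j,\<pi> p}"
          "p + R \<notin> {i,m,j,p}" "\<pi> p + R \<notin> {\<pi> i,\<pi> m,\<pi> j,\<pi> p}"
          using Sh[OF _ R, of i] Sh[OF _ R, of m] Sh[OF _ R, of j] Sh[OF _ R, of p] unfolding X_def by (auto)
        note T = toggle_C1_shift[OF ord vord nin cpR[unfolded ysh[OF R(1)] ysh'[OF R(1)] \<pi>sh[OF R(1)] \<pi>sh'[OF R(1)] ym ]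
          gapR gapR gapR gapR]
        show ?thesis
          unfolding \<sigma>R ysh[OF R(1)] ym \<sigma> \<sigma>i using T by (intro conjI impI)
      qed
    qed
  qed
  then show "fits (\<pi> \<circ> t i j \<circ> t k (y i)) y" unfolding \<sigma>_def m_def .
  show "(\<pi> \<circ> t i j \<circ> t k (y i)) i = \<pi> j" using \<sigma>i unfolding \<sigma>_def m_def .
  show "\<not> k \<sim> y i" using km unfolding m_def .
qed

text \<open>Conjugation with \<open>x \<mapsto> - x\<close> exchanges the cases (A1), (A2), (A3), (C1) with (B1), (B3), (B2), (C2).\<close>

definition mirror :: "(int \<Rightarrow> int) \<Rightarrow> int \<Rightarrow> int" where
  "mirror f x = - f (- x)"

lemma mirror_mirror [simp]: "mirror (mirror f) = f"
  by (simp add: mirror_def fun_eq_iff)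

lemma mirror_comp: "mirror (f \<circ> g) = mirror f \<circ> mirror g"
  by (simp add: mirror_def fun_eq_iff)

lemma mirror_trans: "mirror (t i j) = t (- j) (- i)"
proof -
  have "[- a = - b] (mod int n) \<longleftrightarrow> a \<sim> b" for a b by (simp add: cong_minus_minus_iff)
  then have "mirror (t i j) = t (- i) (- j)"
    using \<open>\<And>b a. ([- a = - b] (mod int n)) = (a \<sim> b)\<close>[of "- x" for x]
    by (auto simp: mirror_def aff_trans_def fun_eq_iff)
  then show ?thesis by (simp add: trans_commute)
qed

lemma mirror_S:
  assumes "\<pi> \<in> S"
  shows "mirror \<pi> \<in> S"
proof -
  have per: "\<pi> (i + m * int n) = \<pi> i + m * int n" for i m using S_shift[OF assms] .
  have "bij (mirror \<pi>)"
  proof (rule o_bij[of "mirror (inv \<pi>)"])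
    show "mirror (inv \<pi>) \<circ> mirror \<pi> = id" "mirror \<pi> \<circ> mirror (inv \<pi>) = id"
      using assms by (simp_all add: mirror_def fun_eq_iff)
  qed
  moreover have "mirror \<pi> (i + int n) = mirror \<pi> i + int n" for i
    using per[of "- i" "- 1"] by (simp add: mirror_def)
  moreover have "(\<Sum>i = 1..int n. mirror \<pi> i - i) = 0"
  proof -
    \<comment> \<open>Negation sends the window 1..n to a translate of 0..n - 1. The shift by one in
      \<open>g\<close> compensates for this, so that the reversal x \<mapsto> n + 1 - x of the
      window can be used.\<close>
    define g where "g x = \<pi> (x - 1) - (x - 1)" for x
    have gper: "g (x + int n) = g x" for x using per[of "x - 1" 1] by (simp add: g_def algebra_simps)
    have "bij (\<lambda>x :: int. x + 1)" by (rule o_bij[of "\<lambda>x. x - 1"]) auto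
    then have "(\<Sum>x = 1..int n. g (x + 1)) = (\<Sum>x = 1..int n. g x)"
      by (rule sum_periodic_reindex) (simp_all add: gper)
    then have "(\<Sum>x = 1..int n. g x) = 0" using assms by (simp add: g_def mem_S_iff)
    moreover have "(\<Sum>x = 1..int n. g (int n + 1 - x)) = (\<Sum>x = 1..int n. g x)"
      by (rule sum.reindex_bij_witness[of _ "\<lambda>x. int n + 1 - x" "\<lambda>x. int n + 1 - x"]) auto
    moreover have "mirror \<pi> x - x = - g (int n + 1 - x)" for x
      using per[of "- x" 1] by (simp add: mirror_def g_def algebra_simps)
    ultimately show ?thesis by (simp add: sum_negf)
  qed
  ultimately show ?thesis by (simp add: mem_S_iff)
qed

lemma mirror_I: "y \<in> I \<Longrightarrow> mirror y \<in> I"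
  by (simp add: invol_iff mirror_S) (simp add: mirror_def)

text \<open>Negation exchanges the ends of every cycle and reverses positions and values together,
  so each clause goes over to itself with roles exchanged; hence arguments such as
  \<open>y (- x)\<close>.\<close>

lemma fits_mirror:
  assumes "y \<in> I" "fits \<pi> y"
  shows "fits (mirror \<pi>) (mirror y)"
  unfolding fits_def
proof (intro conjI allI impI)
  note f = fitsD[OF assms(2)] and yy = invol_invol[OF assms(1)]
  show "mirror \<pi> (mirror y x) < mirror \<pi> x" if "x < mirror y x" for x
    using f(1)[of "y (- x)"] that yy by (simp add: mirror_def)
  show "\<not> (mirror \<pi> (mirror y x) < mirror \<pi> e \<and> mirror \<pi> e < mirror \<pi> x)" if "x < e \<and> e < mirror y x" for x e
    using f(2)[of "y (- x)" "- e"] that yy by (auto simp: mirror_def)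
  fix x x' assume a: "x < x' \<and> mirror y x < mirror y x'"
  show "mirror \<pi> x < mirror \<pi> x'" using f(3)[of "- x'" "- x"] a by (simp add: mirror_def)
  show "mirror \<pi> x < mirror \<pi> (mirror y x')" using f(3)[of "y (- x')" "y (- x)"] a yy by (simp add: mirror_def)
qed

text \<open>This is \<open>toggle_left\<close> for the mirror images, with - j, - i in place of i,
  j; the point chosen there becomes - l.\<close>

lemma toggle_right:
  fixes i j :: int
  assumes y: "y \<in> I" and \<pi>: "\<pi> \<in> S" and f: "fits \<pi> y" and ij: "i < j" "\<not> i \<sim> j" "\<pi> i < \<pi> j"
    and gap: "\<And>e. i < e \<Longrightarrow> e < j \<Longrightarrow> \<not> (\<pi> i < \<pi> e \<and> \<pi> e < \<pi> j)"
    and o: "y i < j" "y j < y i" "y j < i"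
  defines "l \<equiv> if y i < i \<and> \<pi> (y i) < \<pi> j then y i else i"
  shows "fits (\<pi> \<circ> t i j \<circ> t (y j) l) y" "\<pi> \<circ> t i j \<circ> t (y j) l \<noteq> \<pi>" "\<not> l \<sim> y j"
proof -
  let ?y = "mirror y" and ?\<pi> = "mirror \<pi>" and ?\<sigma> = "\<pi> \<circ> t i j \<circ> t (y j) l"
  have cm: "[- a = - b] (mod int n) \<longleftrightarrow> a \<sim> b" for a b by (simp add: cong_minus_minus_iff)
  have gap': "\<not> (?\<pi> (- j) < ?\<pi> e \<and> ?\<pi> e < ?\<pi> (- i))" if "- j < e" "e < - i" for e
    using gap[of "- e"] that by (auto simp: mirror_def)
  have ij': "\<not> [- j = - i] (mod int n)" using ij(2) cm cong_sym by blast
  have k: "(if - i < ?y (- i) \<and> ?\<pi> (- j) < ?\<pi> (?y (- i)) then ?y (- i) else - i) = - l"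
    by (simp add: l_def mirror_def)
  have o': "- j < - i" "?\<pi> (- j) < ?\<pi> (- i)" "- j < ?y (- i)" "?y (- i) < ?y (- j)" "- i < ?y (- j)"
    using ij o by (simp_all add: mirror_def)
  note T = toggle_left[OF mirror_I[OF y] mirror_S[OF \<pi>] fits_mirror[OF y f] o'(1) ij' o'(2) gap' o'(3-5), unfolded k]
  have yj: "?y (- j) = - y j" by (simp add: mirror_def)
  have \<sigma>: "?\<pi> \<circ> t (- j) (- i) \<circ> t (- l) (?y (- j)) = mirror ?\<sigma>"
    by (simp only: mirror_comp mirror_trans yj)
  show "fits ?\<sigma> y" using fits_mirror[OF mirror_I[OF y] T(1)] unfolding \<sigma> mirror_mirror .
  have "mirror ?\<sigma> (- j) = ?\<pi> (- i)" using T(2) unfolding \<sigma> .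
  then have "?\<sigma> j = \<pi> i" unfolding mirror_def by simp
  then show "?\<sigma> \<noteq> \<pi>" using ij(3) by (metis less_irrefl)
  show "\<not> l \<sim> y j" using T(3) cm unfolding yj by blast
qed

text \<open>All branches of \<open>tau\<close> that alter \<open>y\<close> require y k < y l, except
  the two that require both k < y l and y k < l.\<close>

lemma tau_eqI: "y l < y k \<Longrightarrow> \<not> k < y l \<or> \<not> y k < l \<Longrightarrow> k < l \<Longrightarrow> tau n k l y = y"
  unfolding tau_def by auto

lemma aff_bar_fixed: "aff_bar n i j y i = i" "aff_bar n i j y j = j"
  by (simp_all add: aff_bar_def)

text \<open>Each altering branch really alters \<open>y\<close>, as evaluation at i or j shows, so
  none of their conditions holds. The rest is order, together with y i \<noteq> y j and the
  equivalence of y j = i and y i = j.\<close>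

lemma tau_fixed:
  assumes y: "y \<in> I" and ij: "i < j" "\<not> i \<sim> j" and tau: "tau n i j y = y"
  shows "y j < y i" "\<not> (i < y j \<and> y i < j)"
proof -
  note yy = invol_invol[OF y] and yS = invol_S[OF y]
  have yinj: "y a = y b \<longleftrightarrow> a = b" for a b using y by simp
  let ?c1 = "(y i < i \<and> i < j \<and> j < y j) \<or> (i < j \<and> j < y i \<and> y i < y j) \<or> (y i < y j \<and> y j < i \<and> i < j)"
  let ?c2 = "i < y j \<and> y j < y i \<and> y i < j"
  let ?c4 = "(i = y i \<and> y i < j \<and> j = y j) \<or> (i = y i \<and> y i < y j \<and> y j < j) \<or>
         (i < y i \<and> y i < j \<and> j = y j) \<or> (i < y i \<and> y i < y j \<and> y j < j)"
  let ?c5 = "(i = y i \<and> y i < j \<and> j < y j) \<or> (i < y i \<and> y i < j \<and> j < y j)"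
  let ?c6 = "(y i < i \<and> i < j \<and> j = y j) \<or> (y i < i \<and> i < y j \<and> y j < j)"
  have ji: "\<not> j \<sim> i" using ij(2) cong_sym by blast
  have 1: "\<not> ?c1"
  proof
    assume c: ?c1
    then have "t i j \<circ> y \<circ> t i j = y" using tau unfolding tau_def by simp
    from fun_cong[OF this, of i] have t: "t i j (y j) = y i" by (simp add: trans_left ij)
    show False
    proof (cases "y j \<sim> i \<or> y j \<sim> j")
      case False
      then have "y j = y i" using t by (simp add: trans_other)
      then show False using yinj ij by simp
    next
      case True
      then show False
      proof
        assume "y j \<sim> j"
        then have "y j = j" by (rule invol_cong_fixed[OF y])
        then show False using c by linarith
      next
        assume "y j \<sim> i"
        then obtain q where q: "y j = i + q * int n" by (rule cgE)
        then have "y i = j + q * int n" using t trans_shift(1)[OF ij(2), of q] by simp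
        then show False using c q by linarith
      qed
    qed
  qed
  have 2: "\<not> ?c2"
  proof
    assume c: ?c2
    show False
    proof (cases "i \<sim> y j")
      case True
      then have "t i j \<circ> aff_bar n i j y = y" using tau 1 c unfolding tau_def by simp
      from fun_cong[OF this, of i] have "y i = j" by (simp add: aff_bar_fixed trans_left ij)
      then show False using c by simp
    next
      case False
      then have "t i (y j) \<circ> y \<circ> t i (y j) = y" using tau 1 c unfolding tau_def by simp
      from fun_cong[OF this, of i] have t: "t i (y j) j = y i" by (simp add: trans_left False yy)
      have "\<not> j \<sim> y j"
      proof
        assume "j \<sim> y j"
        then have "y j = j" using invol_cong_fixed[OF y] cong_sym by blast
        then show False using c by simp
      qed
      then have "y i = j" using t by (simp add: trans_other ji)
      then show False using c by simp
    qed
  qed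
  have 3: "\<not> (i < y j \<and> y j < y i \<and> y i < j \<and> \<not> i \<sim> y j)" "\<not> (i < y j \<and> y j < y i \<and> y i < j \<and> i \<sim> y j)"
    using 2 by blast+
  note tau3 = tau[unfolded tau_def if_not_P[OF 1] if_not_P[OF 3(1)] if_not_P[OF 3(2)]]
  have 4: "\<not> ?c4"
  proof
    assume c: ?c4
    have "t i j \<circ> aff_bar n i j y = y" using tau3[unfolded if_P[OF c]] .
    from fun_cong[OF this, of i] have "y i = j" by (simp add: aff_bar_fixed trans_left ij)
    then show False using c by auto
  qed
  have 5: "\<not> ?c5"
  proof
    assume c: ?c5
    have T: "t i (y j) \<circ> aff_bar n i j y = y" using tau3[unfolded if_not_P[OF 4] if_P[OF c]] .
    show False
    proof (cases "i \<sim> y j")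
      \<comment> \<open>For congruent arguments \<open>aff_trans\<close> is the identity by its
        default, so \<open>aff_bar n i j y\<close> would have to equal \<open>y\<close>; but it
        fixes j, and \<open>y\<close> does not.\<close>
      case True
      from fun_cong[OF T, of j] have "y j = j" using True by (simp add: aff_bar_fixed aff_trans_def)
      then show False using c by auto
    next
      case False
      from fun_cong[OF T, of i] have "y i = y j" by (simp add: aff_bar_fixed trans_left False)
      then show False using yinj ij by simp
    qed
  qed
  have 6: "\<not> ?c6"
  proof
    assume c: ?c6
    have T: "t (y i) j \<circ> aff_bar n i j y = y" using tau3[unfolded if_not_P[OF 4] if_not_P[OF 5] if_P[OF c]] .
    show False
    proof (cases "y i \<sim> j")
      case True
      from fun_cong[OF T, of i] have "y i = i" using True by (simp add: aff_bar_fixed aff_trans_def)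
      then show False using c by auto
    next
      case False
      from fun_cong[OF T, of j] have "y j = y i" by (simp add: aff_bar_fixed trans_right False)
      then show False using yinj ij by simp
    qed
  qed
  show "\<not> (i < y j \<and> y i < j)" "y j < y i"
  proof -
    have "y i \<noteq> y j" using yinj ij by simp
    moreover have "y j = i \<longleftrightarrow> y i = j" using yy by metis
    ultimately show lt: "y j < y i" using 1 4 5 6 ij by (smt (z3))
    then show "\<not> (i < y j \<and> y i < j)" using 2 by linarith
  qed
qed

lemma toggle_property:
  assumes y: "y \<in> I" and at: "\<pi> \<in> atoms n y" and ij: "i < j" "\<not> i \<sim> j"
    and cov: "aff_covers n \<pi> (\<pi> \<circ> t i j)" and tau: "tau n i j y = y"
  shows "(case_A y \<pi> i j \<or> case_B y \<pi> i j \<or> case_C y \<pi> i j) \<and>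
    (let k = (if case_A y \<pi> i j then j else y j);
         l = (if case_B y \<pi> i j then i else y i);
         \<sigma> = \<pi> \<circ> t i j \<circ> t k l
     in k < l \<and> \<not> l \<sim> k \<and> \<pi> \<noteq> \<sigma> \<and> \<sigma> \<in> atoms n y \<and> y = tau n k l y)"
proof -
  note yy = invol_invol[OF y]
  have \<pi>: "\<pi> \<in> S" and f: "fits \<pi> y" using at atoms_iff_fits[OF y] by blast+
  note cov' = covers_trans[OF \<pi> ij cov]
  have lt: "y j < y i" and no: "\<not> (i < y j \<and> y i < j)" using tau_fixed[OF y ij tau] .
  have inj: "\<pi> a = \<pi> b \<longleftrightarrow> a = b" for a b using \<pi> by simp
  have at_iff: "\<sigma> \<in> atoms n y" if "fits \<sigma> y" "\<sigma> = \<pi> \<circ> t a b \<circ> t c d" for \<sigma> a b c d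
    using that \<pi> atoms_iff_fits[OF y] by simp
  \<comment> \<open>The ascent \<pi> i < \<pi> j excludes that i and j form a 2-cycle and that their
    cycles cross with j on the left cycle. With \<open>lt\<close> and \<open>no\<close> this leaves
    the two nested configurations.\<close>
  have "y i \<noteq> j" using fitsD(1)[OF f, of i] cov'(1) ij(1) by auto
  moreover have "\<not> (y j < i \<and> j < y i)"
    using fitsD(3)[OF f, of j "y i"] yy[of i] cov'(1) by fastforce
  moreover have "y j = i \<longleftrightarrow> y i = j" using yy by metis
  ultimately consider "i < y j" "j < y i" | "y j < i" "y i < j" using no lt by linarith
  then show ?thesis
  proof cases
    case 1
    have mi: "\<pi> (y i) < \<pi> i" using fitsD(1)[OF f, of i] 1 ij by simp
    have inner: "\<not> (\<pi> (y i) < \<pi> (y j) \<and> \<pi> (y j) < \<pi> i)" using fitsD(2)[OF f, of i "y j"] 1 lt by simp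
    have jp: "j < y j \<Longrightarrow> \<pi> (y j) < \<pi> j" "y j < j \<Longrightarrow> \<pi> j < \<pi> (y j)"
      using fitsD(1)[OF f, of j] fitsD(1)[OF f, of "y j"] yy[of j] by auto
    have ne: "\<pi> (y j) \<noteq> \<pi> i" "\<pi> (y j) \<noteq> \<pi> (y i)" unfolding inj using 1 lt by auto
    consider (a) "y j = j" | (b) "j < y j" "\<pi> (y j) < \<pi> (y i)" | (c) "j < y j" "\<pi> i < \<pi> (y j)" | (d) "y j < j"
      using inner ne by linarith
    then have A: "case_A y \<pi> i j \<longleftrightarrow> \<not> (j < y j \<and> \<pi> i < \<pi> (y j))"
      and C: "case_C y \<pi> i j \<longleftrightarrow> j < y j \<and> \<pi> i < \<pi> (y j)"
      unfolding case_A_def case_C_def using 1 lt ij mi cov'(1) jp by (cases; force)+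
    have B: "\<not> case_B y \<pi> i j" unfolding case_B_def using 1 by linarith
    define k where "k = (if case_A y \<pi> i j then j else y j)"
    have k: "k = (if j < y j \<and> \<pi> i < \<pi> (y j) then y j else j)" unfolding k_def A by simp
    note T = toggle_left[OF y \<pi> f ij cov' 1(1) lt 1(2), folded k]
    have "\<pi> \<noteq> \<pi> \<circ> t i j \<circ> t k (y i)" using T(2) cov'(1) by (metis less_irrefl)
    moreover have "k < y i" using 1 lt k by simp
    moreover have "tau n k (y i) y = y"
      using 1 lt ij k yy \<open>k < y i\<close> by (intro tau_eqI) (auto split: if_splits)
    ultimately show ?thesis
      using at_iff[OF T(1) refl] T(3) A B C unfolding k_def[symmetric] Let_def by (auto simp: cong_sym_eq)
  next
    case 2
    have mi: "\<pi> j < \<pi> (y j)" using fitsD(1)[OF f, of "y j"] 2 ij yy[of j] by simp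
    have inner: "\<not> (\<pi> j < \<pi> (y i) \<and> \<pi> (y i) < \<pi> (y j))"
      using fitsD(2)[OF f, of "y j" "y i"] 2 lt yy[of j] by simp
    have jp: "i < y i \<Longrightarrow> \<pi> (y i) < \<pi> i" "y i < i \<Longrightarrow> \<pi> i < \<pi> (y i)"
      using fitsD(1)[OF f, of i] fitsD(1)[OF f, of "y i"] yy[of i] by auto
    have ne: "\<pi> (y i) \<noteq> \<pi> j" "\<pi> (y i) \<noteq> \<pi> (y j)" unfolding inj using 2 lt by auto
    consider (a) "y i = i" | (b) "y i < i" "\<pi> (y j) < \<pi> (y i)" | (c) "y i < i" "\<pi> (y i) < \<pi> j" | (d) "i < y i"
      using inner ne by linarith
    then have B: "case_B y \<pi> i j \<longleftrightarrow> \<not> (y i < i \<and> \<pi> (y i) < \<pi> j)"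
      and C: "case_C y \<pi> i j \<longleftrightarrow> y i < i \<and> \<pi> (y i) < \<pi> j"
      unfolding case_B_def case_C_def using 2 lt ij mi cov'(1) jp by (cases; force)+
    have A: "\<not> case_A y \<pi> i j" unfolding case_A_def using 2 by linarith
    define l where "l = (if case_B y \<pi> i j then i else y i)"
    have l: "l = (if y i < i \<and> \<pi> (y i) < \<pi> j then y i else i)" unfolding l_def B by simp
    note T = toggle_right[OF y \<pi> f ij cov' 2(2) lt 2(1), folded l]
    have "y j < l" using 2 lt l by simp
    moreover have "tau n (y j) l y = y"
      using 2 lt ij l yy \<open>y j < l\<close> by (intro tau_eqI) (auto split: if_splits)
    ultimately show ?thesis
      using at_iff[OF T(1) refl] T(2,3) A B C unfolding l_def[symmetric] Let_def by auto
  qed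
qed

end

theorem theorem4p10:
  fixes n :: nat and y \<pi> :: "int \<Rightarrow> int" and i j :: int
  assumes "n > 0"
    and "y \<in> aff_invols n"
    and "\<pi> \<in> atoms n y"
    and "i < j" and "\<not> [j = i] (mod int n)"
    and "aff_covers n \<pi> (\<pi> \<circ> aff_trans n i j)"
    and "y = tau n i j y"
  shows "(case_A y \<pi> i j \<or> case_B y \<pi> i j \<or> case_C y \<pi> i j) \<and>
    (let k = (if case_A y \<pi> i j then j else y j);
         l = (if case_B y \<pi> i j then i else y i);
         \<sigma> = \<pi> \<circ> aff_trans n i j \<circ> aff_trans n k l
     in k < l \<and> \<not> [l = k] (mod int n) \<and> \<pi> \<noteq> \<sigma> \<and> \<sigma> \<in> atoms n y \<and> y = tau n k l y)"
proof -
  \<comment> \<open>Modulo 1 all integers are congruent, against the hypothesis on i and j.\<close>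
  have "n \<noteq> 1" using assms(5) by auto
  then interpret affine_perms n using assms(1) by unfold_locales simp
  show ?thesis
    using toggle_property[of y \<pi> i j] assms by (simp only: cong_sym_eq[of j i] simp_thms)
qed

end
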